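(* For any integer $d>1$, there are at least as many non-isomorphic rational unicuspidal plane curves $C\subset\mathbb{P}^2_{\mathbb{C}}$ of degree $d$ as there are ordered factorizations of $d$.
   Context: A plane curve $C\subset\mathbb{P}^2_{\mathbb{C}}$ is cuspidal if it is locally (analytically) irreducible at all of its singular points; it is unicuspidal if it has a unique singular point and this point is cuspidal (unibranch). A projective curve $C$ is rational if its normalization is isomorphic to $\mathbb{P}^1$. An ordered factorization of $d$ is a finite sequence $(n_1,\dots,n_r)$, $r\ge 1$, of integers $n_i\ge 2$ with $n_1n_2\cdots n_r=d$ (the order of the factors matters, and the one-term factorization $(d)$ is counted).
   Formalization: The degree d = 2 is excluded: every irreducible conic is smooth, so there is no rational unicuspidal curve of degree 2 in the stated sense, while 2 has one ordered factorization. *)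

theory Defs
  imports
    "HOL-Analysis.Analysis"
    "HOL-Library.Poly_Mapping"
    "HOL-Library.Equipollence"
    "HOL-Computational_Algebra.Computational_Algebra"
begin

section \<open>Polynomials in variables indexed by a finite type\<close>

text \<open>
  A polynomial maps exponent vectors to coefficients, and the product of
  \<^theory>\<open>HOL-Library.Poly_Mapping\<close> is the usual product of polynomials.
\<close>

type_synonym 'n mpoly = "('n \<Rightarrow>\<^sub>0 nat) \<Rightarrow>\<^sub>0 complex"

definition homogeneous :: "nat \<Rightarrow> 'n::finite mpoly \<Rightarrow> bool" where
  "homogeneous k F \<longleftrightarrow>
     (\<forall>m \<in> Poly_Mapping.keys F. (\<Sum>i\<in>UNIV. Poly_Mapping.lookup m i) = k)"

text \<open>Substitution of \<open>x i\<close> for the \<open>i\<close>-th variable, coefficients being embedded by \<open>c\<close>.\<close>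

definition subst_mpoly ::
  "(complex \<Rightarrow> 'r) \<Rightarrow> ('n \<Rightarrow> 'r) \<Rightarrow> 'n::finite mpoly \<Rightarrow> 'r::comm_semiring_1" where
  "subst_mpoly c x F =
     (\<Sum>m\<in>Poly_Mapping.keys F. c (Poly_Mapping.lookup F m) *
        (\<Prod>i\<in>UNIV. x i ^ Poly_Mapping.lookup m i))"

definition mpeval :: "'n::finite mpoly \<Rightarrow> complex ^ 'n \<Rightarrow> complex" where
  "mpeval F v = subst_mpoly (\<lambda>a. a) (\<lambda>i. v $ i) F"


section \<open>Projective space and its Zariski topology\<close>

text \<open>
  \<open>'n proj\<close> is the projective space of lines in \<open>complex ^ 'n\<close>, so \<open>2 proj\<close> is the
  projective line and \<open>3 proj\<close> the projective plane. \<open>point v\<close> is the point with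
  homogeneous coordinates \<open>v\<close>; it is meaningful only for \<open>v \<noteq> 0\<close>.
\<close>

quotient_type (overloaded) 'n proj = "complex ^ ('n::finite)" / partial:
  "\<lambda>v w. v \<noteq> 0 \<and> w \<noteq> 0 \<and> (\<exists>c. c \<noteq> 0 \<and> w = c *s v)"
  morphisms coords point
proof (rule part_equivpI)
  have "(1::complex ^ 'n) \<noteq> 0 \<and> (1::complex ^ 'n) \<noteq> 0 \<and> (\<exists>c. c \<noteq> 0 \<and> (1::complex ^ 'n) = c *s 1)"
    by (auto simp: vec_eq_iff intro!: exI[of _ 1])
  then show "\<exists>v::complex ^ 'n. v \<noteq> 0 \<and> v \<noteq> 0 \<and> (\<exists>c. c \<noteq> 0 \<and> v = c *s v)"
    by (rule exI)
  have "\<exists>c'. c' \<noteq> 0 \<and> v = c' *s (c *s v)" if "c \<noteq> 0" for v :: "complex ^ 'n" and c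
    using that by (intro exI[of _ "inverse c"]) simp
  then show "symp (\<lambda>v w::complex ^ 'n. v \<noteq> 0 \<and> w \<noteq> 0 \<and> (\<exists>c. c \<noteq> 0 \<and> w = c *s v))"
    by (intro sympI) blast
  show "transp (\<lambda>v w::complex ^ 'n. v \<noteq> 0 \<and> w \<noteq> 0 \<and> (\<exists>c. c \<noteq> 0 \<and> w = c *s v))"
    by (rule transpI) (metis mult_eq_0_iff vector_smult_assoc)
qed

definition zeros :: "'n::finite mpoly \<Rightarrow> 'n proj set" where
  "zeros F = {point v | v. v \<noteq> 0 \<and> mpeval F v = 0}"

definition open_in :: "'n::finite proj set \<Rightarrow> 'n proj set \<Rightarrow> bool" where
  "open_in X U \<longleftrightarrow>
     (\<exists>H. (\<forall>h\<in>H. \<exists>k. homogeneous k h) \<and> U = X - (\<Inter>h\<in>H. zeros h))"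


section \<open>Regular functions and morphisms\<close>

text \<open>
  In this section \<open>X\<close>, \<open>Y\<close>, \<open>U\<close> stand for locally closed subsets of projective space, i.e.
  quasi-projective varieties.
\<close>

definition regular_fun :: "'n::finite proj set \<Rightarrow> ('n proj \<Rightarrow> complex) \<Rightarrow> bool" where
  "regular_fun X f \<longleftrightarrow>
     (\<forall>p\<in>X. \<exists>U k g h. open_in X U \<and> p \<in> U \<and> homogeneous k g \<and> homogeneous k h \<and>
        (\<forall>v. v \<noteq> 0 \<and> point v \<in> U \<longrightarrow>
           mpeval h v \<noteq> 0 \<and> f (point v) = mpeval g v / mpeval h v))"

definition regular_map ::
  "'n::finite proj set \<Rightarrow> 'm::finite proj set \<Rightarrow> ('n proj \<Rightarrow> 'm proj) \<Rightarrow> bool" where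
  "regular_map X Y \<phi> \<longleftrightarrow> \<phi> ` X \<subseteq> Y \<and>
     (\<forall>p\<in>X. \<exists>U k (G :: 'm \<Rightarrow> 'n mpoly).
        open_in X U \<and> p \<in> U \<and> (\<forall>i. homogeneous k (G i)) \<and>
        (\<forall>v. v \<noteq> 0 \<and> point v \<in> U \<longrightarrow>
           (\<chi> i. mpeval (G i) v) \<noteq> 0 \<and> \<phi> (point v) = point (\<chi> i. mpeval (G i) v)))"

definition isomorphism ::
  "'n::finite proj set \<Rightarrow> 'm::finite proj set \<Rightarrow> ('n proj \<Rightarrow> 'm proj) \<Rightarrow> bool" where
  "isomorphism X Y \<phi> \<longleftrightarrow> regular_map X Y \<phi> \<and>
     (\<exists>\<psi>. regular_map Y X \<psi> \<and> (\<forall>p\<in>X. \<psi> (\<phi> p) = p) \<and> (\<forall>q\<in>Y. \<phi> (\<psi> q) = q))"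

definition isomorphic :: "'n::finite proj set \<Rightarrow> 'm::finite proj set \<Rightarrow> bool" where
  "isomorphic X Y \<longleftrightarrow> (\<exists>\<phi>. isomorphism X Y \<phi>)"


section \<open>Normalization\<close>

text \<open>
  Below, \<open>X\<close> and \<open>Y\<close> are irreducible projective varieties, so that nonempty open subsets are
  dense. A regular function on a nonempty open subset represents an element of the function
  field. Normality says that each local ring is integrally closed in the function field.
\<close>

definition normal_variety :: "'n::finite proj set \<Rightarrow> bool" where
  "normal_variety X \<longleftrightarrow>
     (\<forall>p\<in>X. \<forall>U f V n a.
        open_in X U \<and> U \<noteq> {} \<and> regular_fun U f \<and>
        open_in X V \<and> p \<in> V \<and> n > 0 \<and> (\<forall>i<n. regular_fun V (a i)) \<and>
        (\<forall>q\<in>U \<inter> V. f q ^ n + (\<Sum>i<n. a i q * f q ^ i) = 0)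
        \<longrightarrow> (\<exists>W g. open_in X W \<and> p \<in> W \<and> regular_fun W g \<and> (\<forall>q\<in>U \<inter> W. g q = f q)))"

definition birational_map ::
  "'n::finite proj set \<Rightarrow> 'm::finite proj set \<Rightarrow> ('n proj \<Rightarrow> 'm proj) \<Rightarrow> bool" where
  "birational_map X Y \<nu> \<longleftrightarrow> regular_map X Y \<nu> \<and>
     (\<exists>U V. open_in X U \<and> U \<noteq> {} \<and> open_in Y V \<and> V \<noteq> {} \<and> isomorphism U V \<nu>)"

text \<open>
  The complement in \<open>X\<close> of a hypersurface (of positive degree) is affine. A morphism is finite
  if the target is covered by affine open sets \<open>V\<close> whose preimages \<open>U\<close> are affine with
  \<open>\<O>(U)\<close> integral over \<open>\<O>(V)\<close>. The affine open sets used here are complements of hypersurfaces;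
  for \<open>X\<close> the projective line, the only case needed, every nonempty proper open subset is one.
\<close>

definition principal_affine :: "'n::finite proj set \<Rightarrow> 'n proj set \<Rightarrow> bool" where
  "principal_affine X U \<longleftrightarrow> (\<exists>k h. k > 0 \<and> homogeneous k h \<and> U = X - zeros h)"

definition finite_map ::
  "'n::finite proj set \<Rightarrow> 'm::finite proj set \<Rightarrow> ('n proj \<Rightarrow> 'm proj) \<Rightarrow> bool" where
  "finite_map X Y \<nu> \<longleftrightarrow> regular_map X Y \<nu> \<and>
     (\<forall>q\<in>Y. \<exists>V U. principal_affine Y V \<and> q \<in> V \<and> principal_affine X U \<and>
        U = {p \<in> X. \<nu> p \<in> V} \<and>
        (\<forall>f. regular_fun U f \<longrightarrow>
           (\<exists>n a. n > 0 \<and> (\<forall>i<n. regular_fun V (a i)) \<and>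
              (\<forall>p\<in>U. f p ^ n + (\<Sum>i<n. a i (\<nu> p) * f p ^ i) = 0))))"

definition is_normalization ::
  "'n::finite proj set \<Rightarrow> ('n proj \<Rightarrow> 'm::finite proj) \<Rightarrow> 'm proj set \<Rightarrow> bool" where
  "is_normalization X \<nu> Y \<longleftrightarrow> normal_variety X \<and> finite_map X Y \<nu> \<and> birational_map X Y \<nu>"

text \<open>
  The normalization is unique up to isomorphism over the curve, so it is isomorphic to the
  projective line iff the projective line itself, with a suitable map, is a normalization.
\<close>

definition rational_curve :: "'m::finite proj set \<Rightarrow> bool" where
  "rational_curve C \<longleftrightarrow> (\<exists>\<nu>. is_normalization (UNIV :: 2 proj set) \<nu> C)"


section \<open>Unicuspidal plane curves\<close>

text \<open>Here \<open>F\<close> is an irreducible form in three variables, the equation of the curve.\<close>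

definition singular_points :: "3 mpoly \<Rightarrow> 3 proj set" where
  "singular_points F =
     {point v | v. v \<noteq> 0 \<and> mpeval F v = 0 \<and> (mpeval F has_derivative (\<lambda>_. 0)) (at v)}"

text \<open>
  The expansion of \<open>F (v + s u + t w)\<close> in \<open>\<complex>[[s, t]]\<close>, with \<open>s\<close> the inner and \<open>t\<close> the outer
  variable. If \<open>v\<close>, \<open>u\<close>, \<open>w\<close> is a basis then \<open>s\<close>, \<open>t\<close> are affine coordinates centred
  at \<open>point v\<close>, and the completed local ring of the curve there is \<open>\<complex>[[s, t]]\<close> modulo this
  series.
\<close>

definition local_equation ::
  "3 mpoly \<Rightarrow> complex ^ 3 \<Rightarrow> complex ^ 3 \<Rightarrow> complex ^ 3 \<Rightarrow> complex fps fps" where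
  "local_equation F v u w =
     (let c = (\<lambda>a. fps_const (fps_const a)); s = fps_const fps_X; t = fps_X
      in subst_mpoly c (\<lambda>i. c (v $ i) + s * c (u $ i) + t * c (w $ i)) F)"

text \<open>Irreducibility of the local equation does not depend on the basis.\<close>

definition analytically_irreducible_at :: "3 mpoly \<Rightarrow> 3 proj \<Rightarrow> bool" where
  "analytically_irreducible_at F p \<longleftrightarrow>
     (\<exists>v u w. det (vector [v, u, w] :: complex ^ 3 ^ 3) \<noteq> 0 \<and> p = point v \<and>
        irreducible (local_equation F v u w))"

text \<open>A unicuspidal curve is singular; in particular no conic is unicuspidal.\<close>

definition unicuspidal :: "3 mpoly \<Rightarrow> bool" where
  "unicuspidal F \<longleftrightarrow> (\<exists>p. singular_points F = {p} \<and> analytically_irreducible_at F p)"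

text \<open>
  A rational curve is irreducible, so the curve has an irreducible equation; this equation is
  unique up to a nonzero constant and its degree is the degree of the curve.
\<close>

definition rational_unicuspidal_curve :: "nat \<Rightarrow> 3 proj set \<Rightarrow> bool" where
  "rational_unicuspidal_curve d C \<longleftrightarrow>
     (\<exists>F. homogeneous d F \<and> irreducible F \<and> C = zeros F \<and> rational_curve C \<and> unicuspidal F)"


section \<open>Ordered factorizations\<close>

definition ordered_factorizations :: "nat \<Rightarrow> nat list set" where
  "ordered_factorizations d = {ns. ns \<noteq> [] \<and> (\<forall>n\<in>set ns. n \<ge> 2) \<and> prod_list ns = d}"

end

theory Submission
  imports Defs
begin

text \<open>
  For \<open>d \<ge> 3\<close> the curve \<open>y z^(d-1) = x^d + b x^(d-2) z^2 + c x^(d-3) z^3\<close> contains the graph of a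
  polynomial as its affine part, hence is rational, and its only point at infinity \<open>[0:1:0]\<close> is
  singular with local equation \<open>z^(d-1) = x^d + \<dots>\<close>, hence unibranch because \<open>d - 1\<close> and \<open>d\<close> are
  coprime. An isomorphism between two such curves maps cusp to cusp, so on the affine parts it is
  \<open>t \<mapsto> \<alpha> t + \<beta>\<close>. Comparing the local rings of the cusps modulo functions of order \<open>2 d - 2\<close> gives
  \<open>\<beta> = 0\<close> and \<open>b' = \<alpha>^2 b\<close> for \<open>d \<ge> 4\<close>, and \<open>c' = \<alpha>^3 c\<close> for \<open>d \<ge> 5\<close>. Thus for \<open>d \<ge> 5\<close> the curves with
  \<open>b = 1\<close> and \<open>c\<close> a natural number are pairwise non-isomorphic, and for \<open>d = 4\<close> those with
  \<open>b = 0\<close>, \<open>b = 1\<close> are; \<open>4\<close> has only two ordered factorizations, and \<open>3\<close> has one.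
\<close>

text \<open>Dropping \<open>x^(d-1)\<close> from the graph polynomial makes \<open>y\<close> equal
  to \<open>1 + b t^2 + c t^3\<close> along the cusp, with no linear term; this is what forces
  \<open>\<beta> = 0\<close>. The remaining scaling acts on \<open>b\<close> and \<open>c\<close>
  with weights 2 and 3. With \<open>b = 1\<close> only \<open>\<alpha> = 1\<close> and
  \<open>\<alpha> = -1\<close> survive, so \<open>c^2\<close> is an invariant with infinitely many
  values, and ordered factorizations can be labelled by natural numbers instead of being counted.
  After division by \<open>t^(d-1)\<close>, the comparison of local rings sees the coefficients of
  \<open>t^0, ..., t^(d-2)\<close>; hence \<open>b\<close> shows from \<open>d = 4\<close> on and
  \<open>c\<close> from \<open>d = 5\<close> on. Two steps are delicate. A function regular on the
  line need not descend to the curve, but a high power of its difference from its value over the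
  cusp does, and this supplies the integral equation for finiteness. That an isomorphism fixes the
  cusp is seen from orders: no form on the curve has a linear term in \<open>t\<close> there, so a
  map to a smooth point would have order \<open>m\<close> different from 1 in \<open>t\<close>,
  whereas \<open>m\<close> would divide \<open>d - 1\<close> and \<open>d\<close>, the orders of
  \<open>x / y\<close> and \<open>z / y\<close>.\<close>

no_notation fps_nth (infixl "$" 75)

section \<open>Substitution into polynomials\<close>

text \<open>Substitution is used over three rings: complex numbers (values of forms), nested
  polynomials (irreducibility of the equation) and iterated power series (the local equation). The
  locale proves once that substitution is a ring homomorphism.\<close>

locale coefficient_hom =
  fixes c :: "complex \<Rightarrow> 'r::comm_ring_1"
  assumes hom_zero: "c 0 = 0" and hom_one: "c 1 = 1"
    and hom_add: "c (a + b) = c a + c b" and hom_mult: "c (a * b) = c a * c b"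
begin

context
  notes hom_zero [simp] hom_one [simp]
begin

lemma subst_superset:
  assumes "finite A" "Poly_Mapping.keys F \<subseteq> A"
  shows "subst_mpoly c x F =
    (\<Sum>m\<in>A. c (Poly_Mapping.lookup F m) * (\<Prod>i\<in>UNIV. x i ^ Poly_Mapping.lookup m i))"
  unfolding subst_mpoly_def using assms
  by (intro sum.mono_neutral_left) (auto simp: in_keys_iff)

lemma subst_zero: "subst_mpoly c x 0 = 0"
  by (simp add: subst_mpoly_def)

lemma subst_add: "subst_mpoly c x (F + G) = subst_mpoly c x F + subst_mpoly c x G"
proof -
  let ?A = "Poly_Mapping.keys F \<union> Poly_Mapping.keys G"
  have "Poly_Mapping.keys (F + G) \<subseteq> ?A"
    by (rule keys_add)
  then show ?thesis
    by (simp add: subst_superset[of ?A] lookup_add hom_add sum.distrib distrib_right)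
qed

lemma subst_sum: "subst_mpoly c x (\<Sum>i\<in>I. F i) = (\<Sum>i\<in>I. subst_mpoly c x (F i))"
  by (induction I rule: infinite_finite_induct) (auto simp: subst_zero subst_add)

lemma subst_single:
  "subst_mpoly c x (Poly_Mapping.single m a) = c a * (\<Prod>i\<in>UNIV. x i ^ Poly_Mapping.lookup m i)"
  by (subst subst_superset[of "{m}"]) auto

lemma subst_mult:
  fixes F G :: "'n::finite mpoly"
  shows "subst_mpoly c x (F * G) = subst_mpoly c x F * subst_mpoly c x G"
proof -
  have expand: "(\<Sum>m\<in>Poly_Mapping.keys H. Poly_Mapping.single m (Poly_Mapping.lookup H m)) = H"
    for H :: "'n mpoly"
  proof (rule poly_mapping_eqI)
    fix k
    have "(\<Sum>m\<in>Poly_Mapping.keys H. Poly_Mapping.lookup H m when m = k) =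
        Poly_Mapping.lookup H k"
      by (cases "k \<in> Poly_Mapping.keys H") (auto simp: when_def in_keys_iff)
    then show "Poly_Mapping.lookup
        (\<Sum>m\<in>Poly_Mapping.keys H. Poly_Mapping.single m (Poly_Mapping.lookup H m)) k =
        Poly_Mapping.lookup H k"
      by (simp add: lookup_sum lookup_single)
  qed
  have single: "subst_mpoly c x (Poly_Mapping.single m a * Poly_Mapping.single n b) =
      subst_mpoly c x (Poly_Mapping.single m a) * subst_mpoly c x (Poly_Mapping.single n b)"
    for m n a b
    by (simp add: mult_single subst_single hom_mult lookup_add power_add prod.distrib mult_ac)
  \<comment> \<open>Stated for arbitrary sums, because rewriting \<open>F\<close> by its monomial
    expansion would also hit the occurrences of \<open>F\<close> inside that expansion.\<close>
  have "subst_mpoly c x (sum f A * sum g B) = subst_mpoly c x (sum f A) * subst_mpoly c x (sum g B)"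
    if "\<And>i j. subst_mpoly c x (f i * g j) = subst_mpoly c x (f i) * subst_mpoly c x (g j)"
    for f g :: "('n \<Rightarrow>\<^sub>0 nat) \<Rightarrow> 'n mpoly" and A B
    by (simp add: sum_product subst_sum that)
  from this[of "\<lambda>m. Poly_Mapping.single m (Poly_Mapping.lookup F m)"
      "\<lambda>m. Poly_Mapping.single m (Poly_Mapping.lookup G m)"
      "Poly_Mapping.keys F" "Poly_Mapping.keys G", OF single]
  show ?thesis
    by (simp only: expand)
qed

lemma subst_one: "subst_mpoly c x 1 = 1"
  using subst_single[of x 0 1] by simp

lemma subst_power: "subst_mpoly c x (F ^ n) = subst_mpoly c x F ^ n"
  by (induction n) (auto simp: subst_one subst_mult)

lemma subst_const: "subst_mpoly c x (Poly_Mapping.single 0 a) = c a"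
  by (simp add: subst_single)

lemma subst_diff: "subst_mpoly c x (F - G) = subst_mpoly c x F - subst_mpoly c x G"
  using subst_add[of x "F - G" G] by simp

end

end

definition var :: "'n::finite \<Rightarrow> 'n mpoly" where
  "var i = Poly_Mapping.single (Poly_Mapping.single i 1) 1"

abbreviation const :: "complex \<Rightarrow> 'n::finite mpoly" where
  "const a \<equiv> Poly_Mapping.single 0 a"

lemma (in coefficient_hom) subst_var: "subst_mpoly c x (var i) = x i"
proof -
  have "(\<Prod>j\<in>UNIV. x j ^ Poly_Mapping.lookup (Poly_Mapping.single i 1) j) =
      (\<Prod>j\<in>{i}. x j ^ Poly_Mapping.lookup (Poly_Mapping.single i 1) j)"
    by (rule prod.mono_neutral_right) (auto simp: lookup_single when_def)
  then show ?thesis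
    by (simp add: var_def subst_single hom_one)
qed

interpretation mpeval: coefficient_hom "\<lambda>a. a"
  by unfold_locales auto

lemma homogeneous_zero: "homogeneous k 0"
  and homogeneous_const: "homogeneous 0 (const a)"
  by (auto simp: homogeneous_def)

lemma homogeneous_var: "homogeneous 1 (var i)"
proof -
  have "(\<Sum>j\<in>UNIV. Poly_Mapping.lookup (Poly_Mapping.single i (1::nat)) j) = (\<Sum>j\<in>{i}. 1)"
    by (rule sum.mono_neutral_cong_right) (auto simp: lookup_single when_def)
  then show ?thesis
    by (auto simp: homogeneous_def var_def)
qed

lemma homogeneous_add: "homogeneous k F \<Longrightarrow> homogeneous k G \<Longrightarrow> homogeneous k (F + G)"
  unfolding homogeneous_def using keys_add[of F G] by blast

lemma homogeneous_mult:
  assumes "homogeneous k F" "homogeneous l G"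
  shows "homogeneous (k + l) (F * G)"
  unfolding homogeneous_def
proof
  fix m assume "m \<in> Poly_Mapping.keys (F * G)"
  then obtain a b where "a \<in> Poly_Mapping.keys F" "b \<in> Poly_Mapping.keys G" "m = a + b"
    using keys_mult[of F G] by auto
  with assms show "(\<Sum>i\<in>UNIV. Poly_Mapping.lookup m i) = k + l"
    by (simp add: homogeneous_def lookup_add sum.distrib)
qed

lemma homogeneous_diff:
  assumes "homogeneous k F" "homogeneous k G"
  shows "homogeneous k (F - G)"
proof -
  have "F - G = F + const (-1) * G"
    by (simp add: single_uminus)
  moreover have "homogeneous k (F + const (-1) * G)"
    using homogeneous_add[OF assms(1)] homogeneous_mult[OF homogeneous_const assms(2)] by simp
  ultimately show ?thesis
    by (simp only:)
qed

lemma homogeneous_power: "homogeneous k F \<Longrightarrow> homogeneous (k * n) (F ^ n)"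
proof (induction n)
  case 0
  then show ?case using homogeneous_const[of 1] by simp
qed (use homogeneous_mult in fastforce)


section \<open>Forms as functions\<close>

text \<open>Regularity depends only on values, so forms are handled as functions: products,
  composites and quotients then need no polynomial representatives. The zero function is a form of
  every degree.\<close>

definition is_form :: "nat \<Rightarrow> (complex ^ 'n::finite \<Rightarrow> complex) \<Rightarrow> bool" where
  "is_form k f \<longleftrightarrow> (\<exists>F. homogeneous k F \<and> f = mpeval F)"

lemma is_formI: "homogeneous k F \<Longrightarrow> (\<And>v. f v = mpeval F v) \<Longrightarrow> is_form k f"
  unfolding is_form_def by blast

lemma is_formE:
  assumes "is_form k f"
  obtains F where "homogeneous k F" "\<And>v. f v = mpeval F v"
  using assms unfolding is_form_def by blast

lemma is_form_mpeval: "homogeneous k F \<Longrightarrow> is_form k (mpeval F)"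
  by (auto simp: is_form_def)

lemma is_form_zero: "is_form k (\<lambda>_. 0)"
  unfolding is_form_def by (rule exI[of _ 0]) (auto simp: homogeneous_zero mpeval_def mpeval.subst_zero)

lemma is_form_const: "is_form 0 (\<lambda>_. a)"
  unfolding is_form_def
  by (rule exI[of _ "const a"]) (auto simp: homogeneous_const mpeval_def mpeval.subst_const)

lemma is_form_coord: "is_form 1 (\<lambda>v. v $ i)"
  unfolding is_form_def
  by (rule exI[of _ "var i"]) (use homogeneous_var in \<open>auto simp: mpeval_def mpeval.subst_var\<close>)

lemma is_form_add: "is_form k f \<Longrightarrow> is_form k g \<Longrightarrow> is_form k (\<lambda>v. f v + g v)"
  by (elim is_formE, rule is_formI[OF homogeneous_add], assumption, assumption, simp add: mpeval_def mpeval.subst_add)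

lemma is_form_diff: "is_form k f \<Longrightarrow> is_form k g \<Longrightarrow> is_form k (\<lambda>v. f v - g v)"
  by (elim is_formE, rule is_formI[OF homogeneous_diff], assumption, assumption, simp add: mpeval_def mpeval.subst_diff)

lemma is_form_mult: "is_form k f \<Longrightarrow> is_form l g \<Longrightarrow> is_form (k + l) (\<lambda>v. f v * g v)"
  by (elim is_formE, rule is_formI[OF homogeneous_mult], assumption, assumption, simp add: mpeval_def mpeval.subst_mult)

lemma is_form_power: "is_form k f \<Longrightarrow> is_form (k * n) (\<lambda>v. f v ^ n)"
  by (elim is_formE) (auto intro!: is_formI[OF homogeneous_power] simp: mpeval_def mpeval.subst_power)

lemma is_form_cmult: "is_form k f \<Longrightarrow> is_form k (\<lambda>v. a * f v)"
  using is_form_mult[OF is_form_const] by fastforce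

lemma is_form_sum: "(\<And>i. i \<in> I \<Longrightarrow> is_form k (f i)) \<Longrightarrow> is_form k (\<lambda>v. \<Sum>i\<in>I. f i v)"
  by (induction I rule: infinite_finite_induct) (auto simp: is_form_zero intro: is_form_add)

lemma is_form_prod:
  "(\<And>i. i \<in> I \<Longrightarrow> is_form (k i) (f i)) \<Longrightarrow> is_form (\<Sum>i\<in>I. k i) (\<lambda>v. \<Prod>i\<in>I. f i v)"
  by (induction I rule: infinite_finite_induct) (auto simp: is_form_const intro: is_form_mult)

lemma is_form_expand:
  assumes "is_form k f"
  obtains S a where "finite S" "\<And>m. m \<in> S \<Longrightarrow> (\<Sum>i\<in>UNIV. Poly_Mapping.lookup m i) = k"
    "f = (\<lambda>v. \<Sum>m\<in>S. a m * (\<Prod>i\<in>UNIV. v $ i ^ Poly_Mapping.lookup m i))"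
proof -
  from assms obtain F where "homogeneous k F" "f = mpeval F"
    by (auto simp: is_form_def)
  then show ?thesis
    by (intro that[of "Poly_Mapping.keys F" "Poly_Mapping.lookup F"])
      (auto simp: homogeneous_def mpeval_def subst_mpoly_def fun_eq_iff)
qed

lemma is_form_compose:
  assumes "is_form k f" "\<And>i. is_form l (g i)"
  shows "is_form (k * l) (\<lambda>v. f (\<chi> i. g i v))"
proof -
  obtain S a where S: "finite S" "\<And>m. m \<in> S \<Longrightarrow> (\<Sum>i\<in>UNIV. Poly_Mapping.lookup m i) = k"
    and f: "f = (\<lambda>v. \<Sum>m\<in>S. a m * (\<Prod>i\<in>UNIV. v $ i ^ Poly_Mapping.lookup m i))"
    by (rule is_form_expand[OF assms(1)]) (rule that)
  have "is_form (k * l) (\<lambda>v. a m * (\<Prod>i\<in>UNIV. g i v ^ Poly_Mapping.lookup m i))"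
    if "m \<in> S" for m
  proof -
    have "is_form (\<Sum>i\<in>UNIV. l * Poly_Mapping.lookup m i)
        (\<lambda>v. \<Prod>i\<in>UNIV. g i v ^ Poly_Mapping.lookup m i)"
      by (intro is_form_prod is_form_power assms)
    moreover have "(\<Sum>i\<in>UNIV. l * Poly_Mapping.lookup m i) = k * l"
      using S(2)[OF that] by (metis mult.commute sum_distrib_left)
    ultimately show ?thesis
      by (intro is_form_cmult) simp
  qed
  then show ?thesis
    unfolding f by (simp add: is_form_sum)
qed

lemma is_form_scale:
  assumes "is_form k f"
  shows "f (c *s v) = c ^ k * f v"
proof -
  obtain S a where S: "finite S" "\<And>m. m \<in> S \<Longrightarrow> (\<Sum>i\<in>UNIV. Poly_Mapping.lookup m i) = k"
    and f: "f = (\<lambda>v. \<Sum>m\<in>S. a m * (\<Prod>i\<in>UNIV. v $ i ^ Poly_Mapping.lookup m i))"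
    by (rule is_form_expand[OF assms(1)]) (rule that)
  have "(\<Prod>i\<in>UNIV. (c * v $ i) ^ Poly_Mapping.lookup m i) =
      c ^ k * (\<Prod>i\<in>UNIV. v $ i ^ Poly_Mapping.lookup m i)" if "m \<in> S" for m
    by (simp add: power_mult_distrib prod.distrib S(2)[OF that] flip: power_sum)
  then show ?thesis
    by (simp add: f sum_distrib_left mult_ac)
qed

lemma poly_subst_mpoly:
  "poly (subst_mpoly (\<lambda>a. [:a:]) x F) t = mpeval F (\<chi> i. poly (x i) t)"
  by (simp add: mpeval_def subst_mpoly_def poly_sum poly_prod)

text \<open>The bridge to one variable: along a polynomial parametrization every form becomes a
  polynomial in \<open>t\<close>, so that roots, degrees and limits are available.\<close>

lemma is_form_poly:
  assumes "is_form k f"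
  obtains P where "\<And>t. f (\<chi> i. poly (x i) t) = poly P t"
  using assms unfolding is_form_def by (metis poly_subst_mpoly)

lemma is_form_binary:
  fixes f :: "complex ^ 2 \<Rightarrow> complex"
  assumes "is_form k f"
  obtains e where "\<And>v. f v = (\<Sum>i\<le>k. e i * v $ 1 ^ i * v $ 2 ^ (k - i))"
proof -
  obtain S a where S: "finite S" "\<And>m. m \<in> S \<Longrightarrow> (\<Sum>i\<in>UNIV. Poly_Mapping.lookup m i) = k"
    and f: "f = (\<lambda>v. \<Sum>m\<in>S. a m * (\<Prod>i\<in>UNIV. v $ i ^ Poly_Mapping.lookup m i))"
    by (rule is_form_expand[OF assms(1)]) (rule that)
  define e where "e i = (\<Sum>m | m \<in> S \<and> Poly_Mapping.lookup m 1 = i. a m)" for i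
  have "f v = (\<Sum>i\<le>k. e i * v $ 1 ^ i * v $ 2 ^ (k - i))" for v
  proof -
    have k: "Poly_Mapping.lookup m 1 + Poly_Mapping.lookup m 2 = k" if "m \<in> S" for m
      using S(2)[OF that] by (simp add: sum_2)
    have "f v = (\<Sum>m\<in>S. a m * (v $ 1 ^ Poly_Mapping.lookup m 1 * v $ 2 ^ Poly_Mapping.lookup m 2))"
      by (simp add: f UNIV_2)
    also have "\<dots> = (\<Sum>m\<in>S. a m * (v $ 1 ^ Poly_Mapping.lookup m 1 *
        v $ 2 ^ (k - Poly_Mapping.lookup m 1)))"
      by (intro sum.cong) (auto simp flip: k)
    also have "\<dots> = (\<Sum>i\<le>k. \<Sum>m | m \<in> S \<and> Poly_Mapping.lookup m 1 = i.
        a m * (v $ 1 ^ Poly_Mapping.lookup m 1 * v $ 2 ^ (k - Poly_Mapping.lookup m 1)))"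
      by (rule sum.group[symmetric]) (use S k in force)+
    also have "\<dots> = (\<Sum>i\<le>k. e i * v $ 1 ^ i * v $ 2 ^ (k - i))"
      by (intro sum.cong) (auto simp: e_def sum_distrib_right mult.assoc)
    finally show ?thesis .
  qed
  then show ?thesis using that by blast
qed


section \<open>Points, open sets, and regular maps\<close>

lemma point_eq_iff:
  fixes v w :: "complex ^ 'n::finite"
  assumes "v \<noteq> 0" "w \<noteq> 0"
  shows "point v = point w \<longleftrightarrow> (\<exists>c. c \<noteq> 0 \<and> w = c *s v)"
  using Quotient3_rel[OF Quotient3_proj, of v w] assms
  by (metis (mono_tags, lifting) scalar_mult_eq_scaleR vector_smult_lid zero_neq_one)

lemma point_scale:
  fixes v :: "complex ^ 'n::finite"
  assumes "v \<noteq> 0" "c \<noteq> 0"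
  shows "point (c *s v) = point v"
  using point_eq_iff[of v "c *s v"] assms by auto

lemma coords_nonzero: "coords p \<noteq> 0"
  using Quotient3_rep_reflp[OF Quotient3_proj] by blast

lemma point_coords [simp]: "point (coords p) = p"
  by (rule Quotient3_abs_rep[OF Quotient3_proj])

lemma point_cases:
  obtains v where "v \<noteq> 0" "p = point v"
  using coords_nonzero point_coords by metis

lemma is_form_zero_iff:
  assumes "is_form k f" "v \<noteq> 0" "w \<noteq> 0" "point v = point w"
  shows "f v = 0 \<longleftrightarrow> f w = 0"
  using assms by (auto simp: point_eq_iff is_form_scale)

lemma is_form_quotient_eq:
  assumes "is_form k f" "is_form k g" "v \<noteq> 0" "w \<noteq> 0" "point v = point w"
  shows "f v / g v = f w / g w"
  using assms by (auto simp: point_eq_iff is_form_scale)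

lemma point_in_zeros_iff:
  assumes "homogeneous k F" "v \<noteq> 0"
  shows "point v \<in> zeros F \<longleftrightarrow> mpeval F v = 0"
  using is_form_zero_iff[OF is_form_mpeval[OF assms(1)] assms(2)] assms(2)
  unfolding zeros_def by blast

text \<open>The basic open sets, given by a function instead of a polynomial; finite intersections
  correspond to products of forms.\<close>

definition nonzero_locus ::
  "'n::finite proj set \<Rightarrow> (complex ^ 'n \<Rightarrow> complex) \<Rightarrow> 'n proj set" where
  "nonzero_locus X f = {point v | v. v \<noteq> 0 \<and> point v \<in> X \<and> f v \<noteq> 0}"

lemma point_in_nonzero_locus_iff:
  assumes "is_form k f" "v \<noteq> 0"
  shows "point v \<in> nonzero_locus X f \<longleftrightarrow> point v \<in> X \<and> f v \<noteq> 0"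
  using is_form_zero_iff[OF assms] assms(2) unfolding nonzero_locus_def mem_Collect_eq by metis

lemma nonzero_locus_eq:
  assumes "homogeneous k F"
  shows "nonzero_locus X (mpeval F) = X - zeros F"
proof (rule set_eqI)
  fix p show "p \<in> nonzero_locus X (mpeval F) \<longleftrightarrow> p \<in> X - zeros F"
    using point_in_zeros_iff[OF assms] point_in_nonzero_locus_iff[OF is_form_mpeval[OF assms]]
    by (cases p rule: point_cases) auto
qed

lemma open_in_nonzero_locus:
  assumes "is_form k f"
  shows "open_in X (nonzero_locus X f)"
proof -
  obtain F where "homogeneous k F" "f = mpeval F"
    using assms by (auto simp: is_form_def)
  then show ?thesis
    unfolding open_in_def by (intro exI[of _ "{F}"]) (auto simp: nonzero_locus_eq)
qed

lemma principal_affine_nonzero_locus: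
  assumes "is_form k f" "k > 0"
  shows "principal_affine X (nonzero_locus X f)"
  using assms unfolding principal_affine_def is_form_def by (metis nonzero_locus_eq)

lemma open_in_basis:
  assumes "open_in X U" "v \<noteq> 0" "point v \<in> U"
  obtains k h where "is_form k h" "h v \<noteq> 0" "nonzero_locus X h \<subseteq> U"
proof -
  from assms obtain H where "\<forall>h\<in>H. \<exists>k. homogeneous k h" "U = X - (\<Inter>h\<in>H. zeros h)"
    by (auto simp: open_in_def)
  with assms obtain h k where h: "homogeneous k h" "point v \<notin> zeros h" "X - zeros h \<subseteq> U"
    by blast
  with assms(2) show ?thesis
    using that[OF is_form_mpeval[OF h(1)]] point_in_zeros_iff[OF h(1)]
    by (auto simp: nonzero_locus_eq[OF h(1)])
qed

text \<open>Open neighbourhoods are shrunk to basic ones, cut out by a form \<open>u\<close>, and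
  points are replaced by vectors. Later local constructions then only multiply forms instead of
  intersecting open sets.\<close>

lemma regular_fun_iff:
  "regular_fun X f \<longleftrightarrow>
     (\<forall>v. v \<noteq> 0 \<and> point v \<in> X \<longrightarrow>
        (\<exists>l u k g h. is_form l u \<and> u v \<noteq> 0 \<and> is_form k g \<and> is_form k h \<and>
           (\<forall>w. w \<noteq> 0 \<and> point w \<in> X \<and> u w \<noteq> 0 \<longrightarrow> h w \<noteq> 0 \<and> f (point w) = g w / h w)))"
  (is "?L \<longleftrightarrow> ?R")
proof
  assume L: ?L
  show ?R
  proof (intro allI impI, elim conjE)
    fix v :: "complex ^ 'a" assume v: "v \<noteq> 0" "point v \<in> X"
    with L obtain U k g h where U: "open_in X U" "point v \<in> U"
      and gh: "homogeneous k g" "homogeneous k h"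
      and f: "\<And>w. w \<noteq> 0 \<Longrightarrow> point w \<in> U \<Longrightarrow> mpeval h w \<noteq> 0 \<and> f (point w) = mpeval g w / mpeval h w"
      unfolding regular_fun_def by blast
    obtain l u where u: "is_form l u" "u v \<noteq> 0" "nonzero_locus X u \<subseteq> U"
      using open_in_basis U v by metis
    show "\<exists>l u k g h. is_form l u \<and> u v \<noteq> 0 \<and> is_form k g \<and> is_form k h \<and>
        (\<forall>w. w \<noteq> 0 \<and> point w \<in> X \<and> u w \<noteq> 0 \<longrightarrow> h w \<noteq> 0 \<and> f (point w) = g w / h w)"
    proof (intro exI conjI)
      show "is_form l u" "u v \<noteq> 0" "is_form k (mpeval g)" "is_form k (mpeval h)"
        using u gh by (auto simp: is_form_mpeval)
      show "\<forall>w. w \<noteq> 0 \<and> point w \<in> X \<and> u w \<noteq> 0 \<longrightarrow>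
          mpeval h w \<noteq> 0 \<and> f (point w) = mpeval g w / mpeval h w"
        using u(3) f unfolding nonzero_locus_def by blast
    qed
  qed
next
  assume R: ?R
  show ?L
    unfolding regular_fun_def
  proof
    fix p assume "p \<in> X"
    moreover obtain v where v: "v \<noteq> 0" "p = point v"
      by (rule point_cases)
    ultimately obtain l u k g h where *: "is_form l u" "u v \<noteq> 0" "is_form k g" "is_form k h"
      "\<forall>w. w \<noteq> 0 \<and> point w \<in> X \<and> u w \<noteq> 0 \<longrightarrow> h w \<noteq> 0 \<and> f (point w) = g w / h w"
      using R by blast
    then obtain g' h' where gh: "homogeneous k g'" "g = mpeval g'" "homogeneous k h'" "h = mpeval h'"
      by (auto simp: is_form_def)
    show "\<exists>U k g h. open_in X U \<and> p \<in> U \<and> homogeneous k g \<and> homogeneous k h \<and>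
        (\<forall>v. v \<noteq> 0 \<and> point v \<in> U \<longrightarrow> mpeval h v \<noteq> 0 \<and> f (point v) = mpeval g v / mpeval h v)"
    proof (intro exI conjI)
      show "open_in X (nonzero_locus X u)" "p \<in> nonzero_locus X u"
        using * v \<open>p \<in> X\<close> by (auto simp: open_in_nonzero_locus point_in_nonzero_locus_iff[OF *(1)])
      show "homogeneous k g'" "homogeneous k h'"
        using gh by auto
      show "\<forall>v. v \<noteq> 0 \<and> point v \<in> nonzero_locus X u \<longrightarrow>
          mpeval h' v \<noteq> 0 \<and> f (point v) = mpeval g' v / mpeval h' v"
        using * gh point_in_nonzero_locus_iff[OF *(1)] by blast
    qed
  qed
qed

lemma regular_map_iff:
  "regular_map X Y (\<phi> :: 'n::finite proj \<Rightarrow> 'm::finite proj) \<longleftrightarrow> \<phi> ` X \<subseteq> Y \<and>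
     (\<forall>v. v \<noteq> 0 \<and> point v \<in> X \<longrightarrow>
        (\<exists>l u k (g :: 'm \<Rightarrow> complex ^ 'n \<Rightarrow> complex). is_form l u \<and> u v \<noteq> 0 \<and> (\<forall>i. is_form k (g i)) \<and>
           (\<forall>w. w \<noteq> 0 \<and> point w \<in> X \<and> u w \<noteq> 0 \<longrightarrow>
              (\<chi> i. g i w) \<noteq> 0 \<and> \<phi> (point w) = point (\<chi> i. g i w))))"
  (is "?L \<longleftrightarrow> ?I \<and> ?R")
proof (intro iffI conjI)
  assume L: ?L
  show ?I using L by (simp add: regular_map_def)
  show ?R
  proof (intro allI impI, elim conjE)
    fix v :: "complex ^ 'n" assume v: "v \<noteq> 0" "point v \<in> X"
    obtain U k and G :: "'m \<Rightarrow> 'n mpoly" where U: "open_in X U" "point v \<in> U"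
      and G: "\<forall>i. homogeneous k (G i)"
      and \<phi>: "\<forall>w. w \<noteq> 0 \<and> point w \<in> U \<longrightarrow>
        (\<chi> i. mpeval (G i) w) \<noteq> 0 \<and> \<phi> (point w) = point (\<chi> i. mpeval (G i) w)"
      using bspec[OF conjunct2[OF L[unfolded regular_map_def]] v(2)]
      by (elim exE conjE) (rule that)
    obtain l u where u: "is_form l u" "u v \<noteq> 0" "nonzero_locus X u \<subseteq> U"
      using open_in_basis U v by metis
    show "\<exists>l u k (g :: 'm \<Rightarrow> complex ^ 'n \<Rightarrow> complex). is_form l u \<and> u v \<noteq> 0 \<and> (\<forall>i. is_form k (g i)) \<and>
        (\<forall>w. w \<noteq> 0 \<and> point w \<in> X \<and> u w \<noteq> 0 \<longrightarrow>
          (\<chi> i. g i w) \<noteq> 0 \<and> \<phi> (point w) = point (\<chi> i. g i w))"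
    proof (intro exI conjI)
      show "is_form l u" "u v \<noteq> 0" "\<forall>i. is_form k (mpeval (G i))"
        using u G by (auto simp: is_form_mpeval)
      show "\<forall>w. w \<noteq> 0 \<and> point w \<in> X \<and> u w \<noteq> 0 \<longrightarrow>
          (\<chi> i. mpeval (G i) w) \<noteq> 0 \<and> \<phi> (point w) = point (\<chi> i. mpeval (G i) w)"
        using u(3) \<phi> unfolding nonzero_locus_def by blast
    qed
  qed
next
  assume R: "?I \<and> ?R"
  show ?L
    unfolding regular_map_def
  proof (intro conjI ballI)
    fix p assume "p \<in> X"
    moreover obtain v where v: "v \<noteq> 0" "p = point v"
      by (rule point_cases)
    ultimately have vX: "v \<noteq> 0 \<and> point v \<in> X"
      by simp
    obtain l u k and g :: "'m \<Rightarrow> complex ^ 'n \<Rightarrow> complex"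
      where *: "is_form l u" "u v \<noteq> 0" "\<forall>i. is_form k (g i)"
      "\<forall>w. w \<noteq> 0 \<and> point w \<in> X \<and> u w \<noteq> 0 \<longrightarrow>
        (\<chi> i. g i w) \<noteq> 0 \<and> \<phi> (point w) = point (\<chi> i. g i w)"
      using R[THEN conjunct2, THEN spec, THEN mp, OF vX] by (elim exE conjE) (rule that)
    obtain G where "\<And>i. homogeneous k (G i) \<and> g i = mpeval (G i)"
      using *(3) unfolding is_form_def by metis
    then have G: "\<And>i. homogeneous k (G i)" "\<And>i. g i = mpeval (G i)"
      by auto
    show "\<exists>U k (G :: 'm \<Rightarrow> 'n mpoly). open_in X U \<and> p \<in> U \<and>
        (\<forall>i. homogeneous k (G i)) \<and>
        (\<forall>v. v \<noteq> 0 \<and> point v \<in> U \<longrightarrow>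
          (\<chi> i. mpeval (G i) v) \<noteq> 0 \<and> \<phi> (point v) = point (\<chi> i. mpeval (G i) v))"
    proof (intro exI conjI)
      show "open_in X (nonzero_locus X u)" "p \<in> nonzero_locus X u"
        using * v \<open>p \<in> X\<close> by (auto simp: open_in_nonzero_locus point_in_nonzero_locus_iff[OF *(1)])
      show "\<forall>i. homogeneous k (G i)"
        using G by auto
      show "\<forall>v. v \<noteq> 0 \<and> point v \<in> nonzero_locus X u \<longrightarrow>
          (\<chi> i. mpeval (G i) v) \<noteq> 0 \<and> \<phi> (point v) = point (\<chi> i. mpeval (G i) v)"
        using *(4) point_in_nonzero_locus_iff[OF *(1)] unfolding G(2)[symmetric] by blast
    qed
  qed (use R in blast)
qed

lemma regular_funE:
  assumes "regular_fun X f" "v \<noteq> 0" "point v \<in> X"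
  obtains l u k g h where "is_form l u" "u v \<noteq> 0" "is_form k g" "is_form k h"
    "\<And>w. w \<noteq> 0 \<Longrightarrow> point w \<in> X \<Longrightarrow> u w \<noteq> 0 \<Longrightarrow> h w \<noteq> 0 \<and> f (point w) = g w / h w"
  using assms unfolding regular_fun_iff by blast

lemma regular_mapE:
  fixes \<phi> :: "'n::finite proj \<Rightarrow> 'm::finite proj"
  assumes "regular_map X Y \<phi>" "v \<noteq> 0" "point v \<in> X"
  obtains l u k and g :: "'m \<Rightarrow> complex ^ 'n \<Rightarrow> complex"
  where "is_form l u" "u v \<noteq> 0" "\<forall>i. is_form k (g i)"
    "\<And>w. w \<noteq> 0 \<Longrightarrow> point w \<in> X \<Longrightarrow> u w \<noteq> 0 \<Longrightarrow>
      (\<chi> i. g i w) \<noteq> 0 \<and> \<phi> (point w) = point (\<chi> i. g i w)"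
proof -
  have "v \<noteq> 0 \<and> point v \<in> X"
    using assms by simp
  from assms(1)[unfolded regular_map_iff, THEN conjunct2, THEN spec, THEN mp, OF this] show ?thesis
    by (elim exE conjE) (rule that, assumption, assumption, assumption, simp)
qed

lemma regular_map_form:
  fixes g :: "'m::finite \<Rightarrow> complex ^ 'n::finite \<Rightarrow> complex"
  assumes "\<And>i. is_form k (g i)"
    and "\<And>w. w \<noteq> 0 \<Longrightarrow> point w \<in> X \<Longrightarrow>
      (\<chi> i. g i w) \<noteq> 0 \<and> \<phi> (point w) = point (\<chi> i. g i w) \<and> \<phi> (point w) \<in> Y"
  shows "regular_map X Y \<phi>"
  unfolding regular_map_iff
proof (intro conjI allI impI)
  show "\<phi> ` X \<subseteq> Y"
    using assms(2) by (metis image_subsetI point_cases)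
  show "\<exists>l u k (g :: 'm \<Rightarrow> complex ^ 'n \<Rightarrow> complex). is_form l u \<and> u v \<noteq> 0 \<and> (\<forall>i. is_form k (g i)) \<and>
      (\<forall>w. w \<noteq> 0 \<and> point w \<in> X \<and> u w \<noteq> 0 \<longrightarrow>
        (\<chi> i. g i w) \<noteq> 0 \<and> \<phi> (point w) = point (\<chi> i. g i w))" for v
    by (rule exI[of _ 0], rule exI[of _ "\<lambda>_. 1"], rule exI[of _ k], rule exI[of _ g])
      (use assms is_form_const in auto)
qed

lemma regular_map_id: "regular_map X X (\<lambda>p. p)"
  by (rule regular_map_form[of 1 "\<lambda>i v. v $ i"]) (use is_form_coord in auto)

lemma regular_map_subset:
  assumes "regular_map X Y \<phi>" "X' \<subseteq> X" "\<phi> ` X' \<subseteq> Y'"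
  shows "regular_map X' Y' \<phi>"
  unfolding regular_map_iff
proof (intro conjI allI impI)
  fix v :: "complex ^ 'a"
  assume "v \<noteq> 0 \<and> point v \<in> X'"
  with assms(2) have "v \<noteq> 0 \<and> point v \<in> X"
    by blast
  then obtain l u k and g :: "'b \<Rightarrow> complex ^ 'a \<Rightarrow> complex"
    where *: "is_form l u" "u v \<noteq> 0" "\<forall>i. is_form k (g i)"
      "\<And>w. w \<noteq> 0 \<Longrightarrow> point w \<in> X \<Longrightarrow> u w \<noteq> 0 \<Longrightarrow>
        (\<chi> i. g i w) \<noteq> 0 \<and> \<phi> (point w) = point (\<chi> i. g i w)"
    by (elim conjE) (rule regular_mapE[OF assms(1)], assumption, assumption, rule that)
  show "\<exists>l u k (g :: 'b \<Rightarrow> complex ^ 'a \<Rightarrow> complex). is_form l u \<and> u v \<noteq> 0 \<and>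
      (\<forall>i. is_form k (g i)) \<and> (\<forall>w. w \<noteq> 0 \<and> point w \<in> X' \<and> u w \<noteq> 0 \<longrightarrow>
        (\<chi> i. g i w) \<noteq> 0 \<and> \<phi> (point w) = point (\<chi> i. g i w))"
    by (rule exI[of _ l], rule exI[of _ u], rule exI[of _ k], rule exI[of _ g])
      (use * assms(2) in auto)
qed (use assms in auto)

lemma isomorphic_refl: "isomorphic X X"
  unfolding isomorphic_def isomorphism_def
  by (intro exI[of _ "\<lambda>p. p"] conjI regular_map_id) auto

lemma regular_fun_compose:
  fixes \<phi> :: "'n::finite proj \<Rightarrow> 'm::finite proj"
  assumes "regular_fun Y f" "regular_map X Y \<phi>"
  shows "regular_fun X (\<lambda>p. f (\<phi> p))"
  unfolding regular_fun_iff
proof (intro allI impI)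
  fix v :: "complex ^ 'n" assume v: "v \<noteq> 0 \<and> point v \<in> X"
  then obtain l u k and G :: "'m \<Rightarrow> complex ^ 'n \<Rightarrow> complex"
    where u: "is_form l u" "u v \<noteq> 0" and G: "\<forall>i. is_form k (G i)"
      and \<phi>: "\<And>w. w \<noteq> 0 \<Longrightarrow> point w \<in> X \<Longrightarrow> u w \<noteq> 0 \<Longrightarrow>
        (\<chi> i. G i w) \<noteq> 0 \<and> \<phi> (point w) = point (\<chi> i. G i w)"
    by (elim conjE) (rule regular_mapE[OF assms(2)], assumption, assumption, rule that)
  have img: "\<phi> ` X \<subseteq> Y"
    using assms(2) by (simp add: regular_map_def)
  have "(\<chi> i. G i v) \<noteq> 0" "point (\<chi> i. G i v) \<in> Y"
    using \<phi>[of v] u v img by (auto simp: image_subset_iff)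
  then obtain l' u' k' g h
    where u': "is_form l' u'" "u' (\<chi> i. G i v) \<noteq> 0" and gh: "is_form k' g" "is_form k' h"
      and f: "\<And>w. w \<noteq> 0 \<Longrightarrow> point w \<in> Y \<Longrightarrow> u' w \<noteq> 0 \<Longrightarrow> h w \<noteq> 0 \<and> f (point w) = g w / h w"
    using regular_funE[OF assms(1)] by blast
  show "\<exists>l u k g h. is_form l u \<and> u v \<noteq> 0 \<and> is_form k g \<and> is_form k h \<and>
      (\<forall>w. w \<noteq> 0 \<and> point w \<in> X \<and> u w \<noteq> 0 \<longrightarrow> h w \<noteq> 0 \<and> f (\<phi> (point w)) = g w / h w)"
  proof (intro exI conjI allI impI)
    show "is_form (l + l' * k) (\<lambda>w. u w * u' (\<chi> i. G i w))"
      by (intro is_form_mult is_form_compose u u' G[rule_format])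
    show "is_form (k' * k) (\<lambda>w. g (\<chi> i. G i w))" "is_form (k' * k) (\<lambda>w. h (\<chi> i. G i w))"
      by (intro is_form_compose gh G[rule_format])+
    show "u v * u' (\<chi> i. G i v) \<noteq> 0"
      using u u' by simp
    fix w assume w: "w \<noteq> 0 \<and> point w \<in> X \<and> u w * u' (\<chi> i. G i w) \<noteq> 0"
    then have "(\<chi> i. G i w) \<noteq> 0 \<and> \<phi> (point w) = point (\<chi> i. G i w)"
      using \<phi>[of w] by simp
    moreover from this have "point (\<chi> i. G i w) \<in> Y"
      using img w by (metis image_subset_iff)
    ultimately show "h (\<chi> i. G i w) \<noteq> 0"
      "f (\<phi> (point w)) = g (\<chi> i. G i w) / h (\<chi> i. G i w)"
      using f[of "\<chi> i. G i w"] w by auto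
  qed
qed

section \<open>The curves\<close>

text \<open>
  The affine part \<open>z = 1\<close> is the graph of a polynomial whose coefficient of \<open>x^(d-1)\<close> has been
  normalized to \<open>0\<close>.
\<close>

definition curve_form :: "nat \<Rightarrow> complex \<Rightarrow> complex \<Rightarrow> 3 mpoly" where
  "curve_form d b c = var 2 * var 3 ^ (d - 1) - var 1 ^ d -
     const b * var 1 ^ (d - 2) * var 3 ^ 2 - const c * var 1 ^ (d - 3) * var 3 ^ 3"

abbreviation cusp :: "complex ^ 3" where
  "cusp \<equiv> vector [0, 1, 0]"

lemma vec3_eq_iff: "v = w \<longleftrightarrow> v $ 1 = w $ 1 \<and> v $ 2 = w $ 2 \<and> v $ 3 = (w :: 'a ^ 3) $ 3"
  and vec2_eq_iff: "u = u' \<longleftrightarrow> u $ 1 = u' $ 1 \<and> u $ 2 = (u' :: 'a ^ 2) $ 2"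
  by (auto simp: vec_eq_iff forall_3 forall_2)

lemma cusp_nonzero: "cusp \<noteq> 0"
  by (simp add: vec3_eq_iff)

lemma (in coefficient_hom) subst_curve_form:
  "subst_mpoly c x (curve_form d a b) = x 2 * x 3 ^ (d - 1) - x 1 ^ d -
     c a * x 1 ^ (d - 2) * x 3 ^ 2 - c b * x 1 ^ (d - 3) * x 3 ^ 3"
  by (simp add: curve_form_def subst_diff subst_mult subst_power subst_var subst_const)

lemma mpeval_curve_form:
  "mpeval (curve_form d b c) v = v $ 2 * v $ 3 ^ (d - 1) - v $ 1 ^ d -
     b * v $ 1 ^ (d - 2) * v $ 3 ^ 2 - c * v $ 1 ^ (d - 3) * v $ 3 ^ 3"
  unfolding mpeval_def mpeval.subst_curve_form ..

lemma homogeneous_curve_form: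
  assumes "d \<ge> 3"
  shows "homogeneous d (curve_form d b c)"
proof -
  have var_power: "homogeneous n (var i ^ n)" for n and i :: 3
    using homogeneous_power[OF homogeneous_var, of n i] by simp
  have terms: "homogeneous (1 + (d - 1)) (var 2 * var 3 ^ (d - 1) :: 3 mpoly)"
    "homogeneous (0 + (d - 2) + 2) (const b * var 1 ^ (d - 2) * var 3 ^ 2 :: 3 mpoly)"
    "homogeneous (0 + (d - 3) + 3) (const c * var 1 ^ (d - 3) * var 3 ^ 3 :: 3 mpoly)"
    by (intro homogeneous_mult homogeneous_const homogeneous_var var_power)+
  have "1 + (d - 1) = d" "0 + (d - 2) + 2 = d" "0 + (d - 3) + 3 = d"
    using assms by auto
  from terms[unfolded this] show ?thesis
    unfolding curve_form_def by (intro homogeneous_diff var_power)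
qed


subsection \<open>Irreducibility of the equation\<close>

text \<open>The ring is \<open>C[z][x][y]\<close> with \<open>y\<close> outermost and
  \<open>z\<close> innermost, because the equation of the curve has degree 1 in
  \<open>y\<close>.\<close>

definition nested_poly :: "3 mpoly \<Rightarrow> complex poly poly poly" where
  "nested_poly = subst_mpoly (\<lambda>a. [:[:[:a:]:]:])
     (($) (vector [[:[:0, 1:]:], [:0, 1:], [:[:[:0, 1:]:]:]] :: complex poly poly poly ^ 3))"

text \<open>One factor \<open>g\<close> has degree 0 in \<open>y\<close>, so it divides both
  \<open>p\<close> and \<open>q\<close>. Dividing \<open>p\<close>, it is free of \<open>x\<close>;
  then it divides every coefficient of \<open>q\<close> in \<open>x\<close>, one of which is a
  unit.\<close>

lemma irreducible_linear_poly:
  fixes q :: "complex poly poly"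
  assumes p: "p \<noteq> 0" and q: "coeff q n dvd 1"
  shows "irreducible [:q, [:p:]:]"
proof (rule irreducibleI)
  show "[:q, [:p:]:] \<noteq> 0"
    using p by simp
  have deg: "degree [:q, [:p:]:] = 1"
    using p by simp
  then show "\<not> [:q, [:p:]:] dvd 1"
    by (metis One_nat_def is_unit_iff_degree degree_1 dvd_imp_degree_le le_0_eq one_neq_zero zero_neq_one)
  have unit: "G dvd 1" if GH: "[:q, [:p:]:] = G * H" and "degree G = 0" for G H
  proof -
    obtain g where G: "G = [:g:]"
      using \<open>degree G = 0\<close> by (rule degree_eq_zeroE)
    have 1: "q = g * coeff H 0" "[:p:] = g * coeff H 1"
      using arg_cong[OF GH, of "\<lambda>f. coeff f 0"] arg_cong[OF GH, of "\<lambda>f. coeff f 1"]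
      by (simp_all add: G)
    have "g \<noteq> 0" "coeff H 1 \<noteq> 0"
      using 1(2) p by auto
    then have "degree g + degree (coeff H 1) = 0"
      using arg_cong[OF 1(2), of degree] by (simp add: degree_mult_eq)
    then obtain g0 where g: "g = [:g0:]"
      by (auto elim: degree_eq_zeroE)
    have "g0 dvd coeff q n"
      by (simp add: 1 g)
    then have "g0 dvd 1"
      using q dvd_trans by blast
    then show ?thesis
      by (simp add: G g is_unit_const_poly_iff)
  qed
  fix G H assume GH: "[:q, [:p:]:] = G * H"
  then have "G \<noteq> 0" "H \<noteq> 0"
    using p by auto
  then have "degree G + degree H = 1"
    using arg_cong[OF GH, of degree] deg by (simp add: degree_mult_eq)
  then consider "degree G = 0" | "degree H = 0"
    by linarith
  then show "G dvd 1 \<or> H dvd 1"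
    using unit[OF GH] unit[of H G] GH by (cases) (auto simp: mult.commute)
qed

interpretation nested: coefficient_hom "\<lambda>a. [:[:[:a:]:]:]"
  by unfold_locales (auto simp: one_pCons)

lemma nested_monom:
  "[:0, 1:] ^ n = (monom 1 n :: complex poly poly poly)"
  "[:[:0, 1:]:] ^ n = (monom (monom 1 n) 0 :: complex poly poly poly)"
  "[:[:[:0, 1:]:]:] ^ n = (monom (monom (monom 1 n) 0) 0 :: complex poly poly poly)"
  "[:[:[:a:]:]:] = monom (monom (monom a 0) 0) 0"
  by (simp_all add: monom_altdef poly_const_pow monom_0)

lemma coeff_nested_poly:
  "coeff (coeff (coeff (nested_poly F) (Poly_Mapping.lookup m 2)) (Poly_Mapping.lookup m 1))
     (Poly_Mapping.lookup m 3) = Poly_Mapping.lookup F m"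
proof -
  have eq_iff: "Poly_Mapping.lookup n 1 = Poly_Mapping.lookup m 1 \<and>
      Poly_Mapping.lookup n 2 = Poly_Mapping.lookup m 2 \<and>
      Poly_Mapping.lookup n 3 = Poly_Mapping.lookup m 3 \<longleftrightarrow> n = m" for n :: "3 \<Rightarrow>\<^sub>0 nat"
    by (auto simp: poly_mapping_eq_iff fun_eq_iff forall_3)
  have "nested_poly F = (\<Sum>n\<in>Poly_Mapping.keys F. monom (monom (monom (Poly_Mapping.lookup F n)
      (Poly_Mapping.lookup n 3)) (Poly_Mapping.lookup n 1)) (Poly_Mapping.lookup n 2))"
    unfolding nested_poly_def subst_mpoly_def UNIV_3
    by (intro sum.cong) (auto simp: nested_monom mult_monom)
  then have "coeff (coeff (coeff (nested_poly F) (Poly_Mapping.lookup m 2)) (Poly_Mapping.lookup m 1))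
      (Poly_Mapping.lookup m 3) = (\<Sum>n\<in>Poly_Mapping.keys F.
        if n = m then Poly_Mapping.lookup F n else 0)"
    by (simp add: coeff_sum flip: eq_iff) (rule sum.cong, auto)
  also have "\<dots> = Poly_Mapping.lookup F m"
    by (simp add: in_keys_iff)
  finally show ?thesis .
qed

lemma inj_nested_poly: "nested_poly F = nested_poly G \<Longrightarrow> F = G"
  by (rule poly_mapping_eqI) (metis coeff_nested_poly)

text \<open>\<open>nested_poly\<close> is an injective ring homomorphism, and the units of the
  target are nonzero constants, which are images of constants. So factorizations map forward and
  units pull back.\<close>

lemma irreducible_nested_poly:
  assumes "irreducible (nested_poly F)"
  shows "irreducible F"
proof (rule irreducibleI)
  have mult: "nested_poly (G * H) = nested_poly G * nested_poly H" for G H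
    by (simp add: nested_poly_def nested.subst_mult)
  have unit: "G dvd 1" if G: "nested_poly G dvd 1" for G
  proof -
    obtain a where a: "nested_poly G = [:[:[:a:]:]:]" "a dvd 1"
      using G unfolding is_unit_poly_iff by auto
    then have "nested_poly G = nested_poly (const a)"
      by (simp add: nested_poly_def nested.subst_const)
    then have "G = const a"
      by (rule inj_nested_poly)
    moreover have "const a * const (inverse a) = (1 :: 3 mpoly)"
    proof -
      have "a \<noteq> 0"
        using a(2) by auto
      then show ?thesis
        by (simp add: mult_single)
    qed
    ultimately show ?thesis
      by (metis dvdI)
  qed
  show "F \<noteq> 0"
    using assms by (auto simp: nested_poly_def nested.subst_zero)
  show "\<not> F dvd 1"
  proof
    assume "F dvd 1"
    then obtain H where "1 = F * H" ..
    then have "nested_poly F * nested_poly H = nested_poly 1"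
      by (simp flip: mult)
    then have "nested_poly F dvd 1"
      by (metis dvdI nested_poly_def nested.subst_one)
    with assms show False
      by (simp add: irreducible_def)
  qed
  show "G dvd 1 \<or> H dvd 1" if "F = G * H" for G H
    using assms unit irreducibleD[OF assms] mult that by metis
qed

lemma irreducible_curve_form:
  assumes "d \<ge> 3"
  shows "irreducible (curve_form d b c)"
proof (rule irreducible_nested_poly)
  \<comment> \<open>The terms free of \<open>y\<close>, as a polynomial in \<open>x\<close> over
    polynomials in \<open>z\<close>. The coefficient \<open>-1\<close> of \<open>x^d\<close> is the
    unit that excludes a common factor.\<close>
  define q :: "complex poly poly" where "q = - monom 1 d -
     monom (monom b 2) (d - 2) - monom (monom c 3) (d - 3)"
  have "nested_poly (curve_form d b c) = [:q, [:monom 1 (d - 1):]:]"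
    unfolding nested_poly_def nested.subst_curve_form
    using nested_monom(1)[of 1]
    by (simp add: nested_monom mult_monom)
      (simp add: q_def monom_Suc monom_0 numeral_2_eq_2 numeral_3_eq_3)
  moreover have "coeff q d dvd 1"
    using assms by (auto simp: q_def)
  ultimately show "irreducible (nested_poly (curve_form d b c))"
    using irreducible_linear_poly[of "monom 1 (d - 1)" q d] by (simp add: monom_eq_0_iff)
qed


subsection \<open>The singularity\<close>

lemma fps_fps_dvd_one:
  fixes f :: "complex fps fps"
  assumes "fps_nth (fps_nth f 0) 0 \<noteq> 0"
  shows "f dvd 1"
proof -
  have "fps_nth f 0 dvd 1"
    using assms by (simp add: fps_is_unit_iff)
  then obtain y where "1 = fps_nth f 0 * y" ..
  then show ?thesis
    by (metis dvdI fps_right_inverse)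
qed

lemma fps_fps_mult_nth:
  "fps_nth (fps_nth (f * g) n) m =
     (\<Sum>j\<le>n. \<Sum>i\<le>m. fps_nth (fps_nth f j) i * fps_nth (fps_nth g (n - j)) (m - i))"
  by (simp add: fps_mult_nth fps_sum_nth atLeast0AtMost)

text \<open>
  Give \<open>s\<close> the weight \<open>d - 1\<close> and \<open>t\<close> the weight \<open>d\<close>. Minimal weights are additive, because the
  term of minimal weight and then of minimal exponent of \<open>t\<close> cannot cancel in a product.
\<close>

definition weight :: "nat \<Rightarrow> nat \<Rightarrow> nat \<Rightarrow> nat" where
  "weight d j i = j * d + i * (d - 1)"

lemma weight_leading_term:
  fixes f :: "complex fps fps"
  assumes "fps_nth (fps_nth f j') i' \<noteq> 0"
  obtains j i where "fps_nth (fps_nth f j) i \<noteq> 0"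
    "\<And>j' i'. fps_nth (fps_nth f j') i' \<noteq> 0 \<Longrightarrow> weight d j i \<le> weight d j' i'"
    "\<And>j' i'. fps_nth (fps_nth f j') i' \<noteq> 0 \<Longrightarrow> weight d j' i' = weight d j i \<Longrightarrow> j \<le> j'"
proof -
  define S where "S = {(j, i). fps_nth (fps_nth f j) i \<noteq> 0}"
  define w where "w = (LEAST n. \<exists>(j, i)\<in>S. n = weight d j i)"
  have ex: "\<exists>n. \<exists>(j, i)\<in>S. n = weight d j i"
    using assms unfolding S_def by auto
  have w: "\<exists>(j, i)\<in>S. w = weight d j i"
    unfolding w_def by (rule LeastI_ex[OF ex])
  have w_le: "w \<le> weight d j i" if "(j, i) \<in> S" for j i
    unfolding w_def using that by (intro Least_le) auto
  define j where "j = (LEAST j. \<exists>i. (j, i) \<in> S \<and> w = weight d j i)"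
  have "\<exists>j i. (j, i) \<in> S \<and> w = weight d j i"
    using w by auto
  then have "\<exists>i. (j, i) \<in> S \<and> w = weight d j i"
    unfolding j_def by (rule LeastI_ex)
  then obtain i where i: "(j, i) \<in> S" "w = weight d j i"
    by blast
  have j_le: "j \<le> j'" if "(j', i') \<in> S" "w = weight d j' i'" for j' i'
    unfolding j_def using that by (intro Least_le) auto
  show ?thesis
  proof (rule that)
    show "fps_nth (fps_nth f j) i \<noteq> 0"
      using i(1) by (simp add: S_def)
    show "weight d j i \<le> weight d j' i'" if "fps_nth (fps_nth f j') i' \<noteq> 0" for j' i'
      using w_le[of j' i'] that i(2) by (simp add: S_def)
    show "j \<le> j'" if "fps_nth (fps_nth f j') i' \<noteq> 0" "weight d j' i' = weight d j i" for j' i'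
      using j_le[of j' i'] that i(2) by (simp add: S_def)
  qed
qed

text \<open>A Newton polygon argument. The pure powers \<open>t^(d-1)\<close> and \<open>s^d\<close>
  both have the minimal weight \<open>d (d - 1)\<close>. They split as \<open>t^j t^(d-1-j)\<close>
  and \<open>s^i s^(d-i)\<close> over the factors, and additivity of minimal weights makes the
  weight of \<open>g\<close> equal to both \<open>j d\<close> and \<open>i (d - 1)\<close>.
  Coprimality gives \<open>i = 0\<close> or \<open>i = d\<close>, so one factor has a nonzero
  constant term.\<close>

lemma irreducible_fps_fps:
  fixes f :: "complex fps fps"
  assumes d: "d \<ge> 2"
    and wt: "\<And>j i. fps_nth (fps_nth f j) i \<noteq> 0 \<Longrightarrow> weight d j i \<ge> d * (d - 1)"
    and t: "fps_nth (fps_nth f (d - 1)) 0 \<noteq> 0" and s: "fps_nth (fps_nth f 0) d \<noteq> 0"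
  shows "irreducible f"
proof (rule irreducibleI)
  show "f \<noteq> 0"
    using s by auto
  have "fps_nth (fps_nth f 0) 0 = 0"
    using wt[of 0 0] d by (auto simp: weight_def)
  then show "\<not> f dvd 1"
    by (metis dvdE fps_mult_nth_0 fps_one_nth mult_zero_left zero_neq_one)
  fix g h assume f: "f = g * h"
  let ?c = "\<lambda>f j i. fps_nth (fps_nth f j) i"
  have "(\<Sum>j\<le>d - 1. ?c g j 0 * ?c h (d - 1 - j) 0) \<noteq> 0"
    using t by (simp add: f fps_fps_mult_nth)
  then obtain j where j: "j \<le> d - 1" "?c g j 0 \<noteq> 0" "?c h (d - 1 - j) 0 \<noteq> 0"
    by (metis (no_types, lifting) atMost_iff mult_eq_0_iff sum.neutral)
  have "(\<Sum>i\<le>d. ?c g 0 i * ?c h 0 (d - i)) \<noteq> 0"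
    using s unfolding f fps_fps_mult_nth by simp
  then obtain i where i: "i \<le> d" "?c g 0 i \<noteq> 0" "?c h 0 (d - i) \<noteq> 0"
    by (metis (no_types, lifting) atMost_iff mult_eq_0_iff sum.neutral)
  obtain jg ig where g: "?c g jg ig \<noteq> 0"
    "\<And>j' i'. ?c g j' i' \<noteq> 0 \<Longrightarrow> weight d jg ig \<le> weight d j' i'"
    "\<And>j' i'. ?c g j' i' \<noteq> 0 \<Longrightarrow> weight d j' i' = weight d jg ig \<Longrightarrow> jg \<le> j'"
    using weight_leading_term[OF j(2)] by blast
  obtain jh ih where h: "?c h jh ih \<noteq> 0"
    "\<And>j' i'. ?c h j' i' \<noteq> 0 \<Longrightarrow> weight d jh ih \<le> weight d j' i'"
    "\<And>j' i'. ?c h j' i' \<noteq> 0 \<Longrightarrow> weight d j' i' = weight d jh ih \<Longrightarrow> jh \<le> j'"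
    using weight_leading_term[OF j(3)] by blast
  have "?c g j' i' * ?c h (jg + jh - j') (ig + ih - i') = 0"
    if le: "j' \<le> jg + jh" "i' \<le> ig + ih" and ne: "(j', i') \<noteq> (jg, ig)" for j' i'
  proof (rule ccontr)
    assume *: "\<not> ?thesis"
    define j'' i'' where "j'' = jg + jh - j'" and "i'' = ig + ih - i'"
    have sum: "j' + j'' = jg + jh" "i' + i'' = ig + ih"
      using le by (auto simp: j''_def i''_def)
    have nz: "?c g j' i' \<noteq> 0" "?c h j'' i'' \<noteq> 0"
      using * by (auto simp: j''_def i''_def)
    have "weight d j' i' + weight d j'' i'' = (j' + j'') * d + (i' + i'') * (d - 1)"
      by (simp add: weight_def add_mult_distrib)
    also have "\<dots> = weight d jg ig + weight d jh ih"
      unfolding sum by (simp add: weight_def add_mult_distrib)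
    finally have "weight d j' i' = weight d jg ig" "weight d j'' i'' = weight d jh ih"
      using g(2)[OF nz(1)] h(2)[OF nz(2)] by linarith+
    then have "jg \<le> j'" "jh \<le> j''"
      using g(3)[OF nz(1)] h(3)[OF nz(2)] by auto
    then have "j' = jg"
      using sum by linarith
    moreover from this have "i' * (d - 1) = ig * (d - 1)"
      using \<open>weight d j' i' = weight d jg ig\<close> by (simp add: weight_def)
    ultimately show False
      using ne d by simp
  qed
  then have "?c f (jg + jh) (ig + ih) = (\<Sum>j\<le>jg + jh. \<Sum>i\<le>ig + ih.
      if j = jg \<and> i = ig then ?c g jg ig * ?c h jh ih else 0)"
    unfolding f fps_fps_mult_nth by (intro sum.cong refl) auto
  also have "\<dots> = (\<Sum>j\<le>jg + jh. if j = jg then ?c g jg ig * ?c h jh ih else 0)"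
    by (intro sum.cong refl) (simp add: sum.delta)
  also have "\<dots> = ?c g jg ig * ?c h jh ih"
    by (simp add: sum.delta)
  finally have "weight d (jg + jh) (ig + ih) \<ge> d * (d - 1)"
    using g(1) h(1) by (intro wt) auto
  then have ge: "weight d jg ig + weight d jh ih \<ge> d * (d - 1)"
    by (simp add: weight_def add_mult_distrib)
  have "j * d + (d - 1 - j) * d = d * (d - 1)" "i * (d - 1) + (d - i) * (d - 1) = d * (d - 1)"
    using j(1) i(1) by (metis add_mult_distrib le_add_diff_inverse mult.commute)+
  then have "weight d jg ig = j * d" "weight d jg ig = i * (d - 1)"
    using ge g(2)[OF j(2)] h(2)[OF j(3)] g(2)[OF i(2)] h(2)[OF i(3)] by (auto simp: weight_def)
  then have "d dvd i * (d - 1)"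
    by (metis dvd_triv_right)
  moreover have "coprime d (d - 1)"
    using d by (metis coprime_Suc_right_nat Suc_diff_1 coprime_commute gr0I not_numeral_le_zero)
  ultimately have "d dvd i"
    by (simp add: coprime_dvd_mult_left_iff)
  then have "i = 0 \<or> i = d"
    using i(1) by (auto elim!: dvdE)
  then show "g dvd 1 \<or> h dvd 1"
    using i fps_fps_dvd_one by auto
qed

interpretation fps_fps: coefficient_hom "\<lambda>a. fps_const (fps_const a)"
  by unfold_locales auto

text \<open>In this basis \<open>y = 1\<close>, \<open>s\<close> is \<open>x\<close> and
  \<open>t\<close> is \<open>z\<close>; the index \<open>j\<close> counts powers of
  \<open>t\<close>, the outer variable.\<close>

lemma local_equation_curve_form:
  "fps_nth (fps_nth (local_equation (curve_form d b c) cusp (vector [1, 0, 0]) (vector [0, 0, 1])) j) i =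
     (if j = d - 1 \<and> i = 0 then 1 else 0) - (if j = 0 \<and> i = d then 1 else 0) -
     (if j = 2 \<and> i = d - 2 then b else 0) - (if j = 3 \<and> i = d - 3 then c else 0)"
proof -
  have nth: "fps_nth (fps_nth (fps_const (fps_const a) * fps_const fps_X ^ k * fps_X ^ l) j) i =
      (if j = l \<and> i = k then a else 0)" for a :: complex and k l
    by (auto simp: fps_const_power fps_X_power_nth fps_mult_left_const_nth)
  have "local_equation (curve_form d b c) cusp (vector [1, 0, 0]) (vector [0, 0, 1]) =
      fps_const (fps_const 1) * fps_const fps_X ^ 0 * fps_X ^ (d - 1) -
      fps_const (fps_const 1) * fps_const fps_X ^ d * fps_X ^ 0 -
      fps_const (fps_const b) * fps_const fps_X ^ (d - 2) * fps_X ^ 2 -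
      fps_const (fps_const c) * fps_const fps_X ^ (d - 3) * fps_X ^ 3"
    unfolding local_equation_def Let_def fps_fps.subst_curve_form by simp
  then show ?thesis
    by (simp only: fps_sub_nth nth)
qed

lemma analytically_irreducible_curve_form:
  assumes "d \<ge> 3"
  shows "analytically_irreducible_at (curve_form d b c) (point cusp)"
  unfolding analytically_irreducible_at_def
proof (intro exI conjI)
  show "det (vector [cusp, vector [1, 0, 0], vector [0, 0, 1]] :: complex ^ 3 ^ 3) \<noteq> 0"
    by (simp add: det_3)
  \<comment> \<open>The terms with \<open>b\<close> and \<open>c\<close> exceed the minimal weight
    by exactly 2 and 3.\<close>
  have "2 * d + (d - 2) * (d - 1) \<ge> d * (d - 1)" "3 * d + (d - 3) * (d - 1) \<ge> d * (d - 1)"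
  proof -
    obtain e where "d = e + 3"
      using assms by (metis add.commute le_Suc_ex)
    then show "2 * d + (d - 2) * (d - 1) \<ge> d * (d - 1)" "3 * d + (d - 3) * (d - 1) \<ge> d * (d - 1)"
      by (auto simp: algebra_simps)
  qed
  then show "irreducible (local_equation (curve_form d b c) cusp (vector [1, 0, 0]) (vector [0, 0, 1]))"
    using assms by (intro irreducible_fps_fps[of d])
      (auto simp: local_equation_curve_form weight_def split: if_splits)
qed (rule refl)

lemma singular_points_curve_form:
  assumes "d \<ge> 3"
  shows "singular_points (curve_form d b c) = {point cusp}"
proof (intro set_eqI iffI)
  fix p assume "p \<in> singular_points (curve_form d b c)"
  then obtain v where v: "p = point v" "v \<noteq> 0" "mpeval (curve_form d b c) v = 0"
    and deriv: "(mpeval (curve_form d b c) has_derivative (\<lambda>_. 0)) (at v)"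
    by (auto simp: singular_points_def)
  let ?e = "axis 2 1 :: complex ^ 3"
  \<comment> \<open>Along a real line in the \<open>y\<close> direction the form is affine with
    slope \<open>z^(d-1)\<close>; a vanishing derivative therefore forces \<open>z = 0\<close>, and
    the equation then gives \<open>x = 0\<close>.\<close>
  have "((\<lambda>r::real. v + r *\<^sub>R ?e) has_derivative (\<lambda>r. r *\<^sub>R ?e)) (at 0)"
    by (auto intro!: derivative_eq_intros)
  from has_derivative_compose[OF this, of "mpeval (curve_form d b c)" "\<lambda>_. 0"] deriv
  have "((\<lambda>r::real. mpeval (curve_form d b c) (v + r *\<^sub>R ?e)) has_derivative (\<lambda>_. 0)) (at 0)"
    by simp
  moreover have "mpeval (curve_form d b c) (v + r *\<^sub>R ?e) =
      mpeval (curve_form d b c) v + of_real r * v $ 3 ^ (d - 1)" for r :: real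
    by (simp add: mpeval_curve_form axis_def algebra_simps flip: of_real_def)
  ultimately have "((\<lambda>r::real. of_real r * v $ 3 ^ (d - 1)) has_derivative (\<lambda>_. 0)) (at 0)"
    by (simp add: v(3))
  moreover have "((\<lambda>r::real. of_real r * v $ 3 ^ (d - 1)) has_derivative
      (\<lambda>r. of_real r * v $ 3 ^ (d - 1))) (at 0)"
    by (auto intro!: derivative_eq_intros)
  ultimately have "(\<lambda>r::real. of_real r * v $ 3 ^ (d - 1)) = (\<lambda>_. 0)"
    by (metis has_derivative_unique)
  from fun_cong[OF this, of 1] have "v $ 3 = 0"
    by simp
  with v(3) assms have "v $ 1 = 0"
    by (simp add: mpeval_curve_form power_0_left)
  with \<open>v $ 3 = 0\<close> v(2) have "v = (v $ 2) *s cusp" "v $ 2 \<noteq> 0"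
    by (auto simp: vec3_eq_iff)
  then show "p \<in> {point cusp}"
    using point_scale[OF cusp_nonzero, of "v $ 2"] v(1) by simp
next
  fix p assume "p \<in> {point cusp}"
  have nth: "((\<lambda>v. v $ i) has_derivative (\<lambda>h. h $ i)) (at v)" for i :: 3 and v :: "complex ^ 3"
    by (rule bounded_linear.has_derivative[OF bounded_linear_vec_nth]) auto
  have "(mpeval (curve_form d b c) has_derivative (\<lambda>_. 0)) (at cusp)"
    unfolding mpeval_curve_form[abs_def]
    by (rule derivative_eq_intros nth refl | use assms in \<open>simp add: fun_eq_iff power_0_left\<close>)+
  moreover have "mpeval (curve_form d b c) cusp = 0"
    using assms by (simp add: mpeval_curve_form power_0_left)
  ultimately show "p \<in> singular_points (curve_form d b c)"
    using \<open>p \<in> {point cusp}\<close> cusp_nonzero unfolding singular_points_def by blast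
qed

lemma unicuspidal_curve_form:
  assumes "d \<ge> 3"
  shows "unicuspidal (curve_form d b c)"
  unfolding unicuspidal_def
  using singular_points_curve_form[OF assms] analytically_irreducible_curve_form[OF assms] by blast

section \<open>Restriction to parametrized curves\<close>

text \<open>The parameters that must be avoided are the zeros of one polynomial \<open>E\<close> not
  vanishing at \<open>t0\<close>: a finite set away from \<open>t0\<close>.\<close>

lemma open_in_along_curve:
  fixes x :: "'n::finite \<Rightarrow> complex poly"
  assumes \<gamma>: "\<gamma> = (\<lambda>t. \<chi> i. poly (x i) t)" and nz: "\<And>t. \<gamma> t \<noteq> 0" and Y: "\<And>t. point (\<gamma> t) \<in> Y"
    and U: "open_in Y U" "point (\<gamma> t0) \<in> U"
  obtains E where "poly E t0 \<noteq> 0" "\<And>t. poly E t \<noteq> 0 \<Longrightarrow> point (\<gamma> t) \<in> U"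
proof -
  obtain k h where h: "is_form k h" "h (\<gamma> t0) \<noteq> 0" "nonzero_locus Y h \<subseteq> U"
    using open_in_basis[OF U(1) nz U(2)] .
  obtain E where E: "\<And>t. h (\<chi> i. poly (x i) t) = poly E t"
    using is_form_poly[OF h(1)] by blast
  show ?thesis
  proof (rule that)
    show "poly E t0 \<noteq> 0"
      using h(2) by (simp add: \<gamma> E)
    show "point (\<gamma> t) \<in> U" if "poly E t \<noteq> 0" for t
    proof -
      have "h (\<gamma> t) \<noteq> 0"
        using that by (simp add: \<gamma> E)
      then show ?thesis
        using h(3) Y nz unfolding nonzero_locus_def by blast
    qed
  qed
qed

lemma regular_fun_along_curve:
  fixes x :: "'n::finite \<Rightarrow> complex poly"
  assumes \<gamma>: "\<gamma> = (\<lambda>t. \<chi> i. poly (x i) t)" and nz: "\<And>t. \<gamma> t \<noteq> 0" and Y: "\<And>t. point (\<gamma> t) \<in> Y"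
    and U: "open_in Y U" "point (\<gamma> t0) \<in> U" and f: "regular_fun U f"
  obtains A B E where "poly E t0 \<noteq> 0"
    "\<And>t. poly E t \<noteq> 0 \<Longrightarrow> point (\<gamma> t) \<in> U \<and> poly B t \<noteq> 0 \<and> f (point (\<gamma> t)) = poly A t / poly B t"
proof -
  obtain E where E: "poly E t0 \<noteq> 0" "\<And>t. poly E t \<noteq> 0 \<Longrightarrow> point (\<gamma> t) \<in> U"
    using open_in_along_curve[OF \<gamma> nz Y U] by blast
  obtain l u k g h where u: "is_form l u" "u (\<gamma> t0) \<noteq> 0" and gh: "is_form k g" "is_form k h"
    and f: "\<And>w. w \<noteq> 0 \<Longrightarrow> point w \<in> U \<Longrightarrow> u w \<noteq> 0 \<Longrightarrow> h w \<noteq> 0 \<and> f (point w) = g w / h w"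
    using regular_funE[OF f nz U(2)] by blast
  obtain E' where E': "\<And>t. u (\<chi> i. poly (x i) t) = poly E' t"
    using is_form_poly[OF u(1)] by blast
  obtain A where A: "\<And>t. g (\<chi> i. poly (x i) t) = poly A t"
    using is_form_poly[OF gh(1)] by blast
  obtain B where B: "\<And>t. h (\<chi> i. poly (x i) t) = poly B t"
    using is_form_poly[OF gh(2)] by blast
  show ?thesis
  proof (rule that[of "E * E'" B A])
    show "poly (E * E') t0 \<noteq> 0"
      using E(1) u(2) by (simp add: \<gamma> E')
    show "point (\<gamma> t) \<in> U \<and> poly B t \<noteq> 0 \<and> f (point (\<gamma> t)) = poly A t / poly B t"
      if "poly (E * E') t \<noteq> 0" for t
    proof -
      have "point (\<gamma> t) \<in> U" "u (\<gamma> t) \<noteq> 0"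
        using that E(2) by (auto simp: \<gamma> E')
      from f[OF nz this] show ?thesis
        using E(2) that by (simp add: \<gamma> A B)
    qed
  qed
qed

text \<open>Both the forms \<open>g\<close> and their restrictions \<open>G\<close> are kept: the
  restrictions give limits and polynomial identities, while their origin from plane forms restricts
  which polynomials can occur at the cusp.\<close>

lemma regular_map_along_curve:
  fixes x :: "'n::finite \<Rightarrow> complex poly" and \<phi> :: "'n proj \<Rightarrow> 'm::finite proj"
  assumes \<gamma>: "\<gamma> = (\<lambda>t. \<chi> i. poly (x i) t)" and nz: "\<And>t. \<gamma> t \<noteq> 0" and Y: "\<And>t. point (\<gamma> t) \<in> Y"
    and \<phi>: "regular_map Y Z \<phi>"
  obtains l u k and g :: "'m \<Rightarrow> complex ^ 'n \<Rightarrow> complex" and E and G :: "'m \<Rightarrow> complex poly"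
  where "is_form l u" "u (\<gamma> t0) \<noteq> 0" "\<forall>i. is_form k (g i)"
    "\<forall>t. u (\<gamma> t) = poly E t" "\<forall>i t. g i (\<gamma> t) = poly (G i) t"
    "\<forall>t. poly E t \<noteq> 0 \<longrightarrow> (\<chi> i. poly (G i) t) \<noteq> 0 \<and> \<phi> (point (\<gamma> t)) = point (\<chi> i. poly (G i) t)"
proof -
  obtain l u k and g :: "'m \<Rightarrow> complex ^ 'n \<Rightarrow> complex"
    where u: "is_form l u" "u (\<gamma> t0) \<noteq> 0" and g: "\<forall>i. is_form k (g i)"
    and *: "\<And>w. w \<noteq> 0 \<Longrightarrow> point w \<in> Y \<Longrightarrow> u w \<noteq> 0 \<Longrightarrow>
      (\<chi> i. g i w) \<noteq> 0 \<and> \<phi> (point w) = point (\<chi> i. g i w)"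
    by (rule regular_mapE[OF \<phi> nz Y]) (rule that)
  obtain E where E: "\<And>t. u (\<chi> i. poly (x i) t) = poly E t"
    using is_form_poly[OF u(1)] by blast
  have "\<forall>i. \<exists>A. \<forall>t. g i (\<chi> i. poly (x i) t) = poly A t"
    using is_form_poly[OF g[rule_format]] by metis
  then obtain G where G: "\<And>i t. g i (\<chi> i. poly (x i) t) = poly (G i) t"
    by metis
  have E': "\<forall>t. u (\<gamma> t) = poly E t" and G': "\<forall>i t. g i (\<gamma> t) = poly (G i) t"
    using E G by (auto simp: \<gamma>)
  show ?thesis
    by (rule that[OF u g E' G']) (use *[OF nz Y] E' G' in simp)
qed


section \<open>The projective line is normal\<close>

lemma point_eq_iff_binary:
  fixes v w :: "complex ^ 2"
  assumes "v \<noteq> 0" "w \<noteq> 0"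
  shows "point v = point w \<longleftrightarrow> v $ 1 * w $ 2 = v $ 2 * w $ 1"
proof
  assume "point v = point w"
  then show "v $ 1 * w $ 2 = v $ 2 * w $ 1"
    using assms by (auto simp: point_eq_iff)
next
  assume *: "v $ 1 * w $ 2 = v $ 2 * w $ 1"
  have "\<exists>c. w = c *s v"
  proof (cases "v $ 1 = 0")
    case True
    then have "v $ 2 \<noteq> 0"
      using assms by (simp add: vec2_eq_iff)
    then show ?thesis
      using True * by (intro exI[of _ "w $ 2 / v $ 2"]) (simp add: vec2_eq_iff)
  next
    case False
    then show ?thesis
      using * by (intro exI[of _ "w $ 1 / v $ 1"]) (simp add: vec2_eq_iff field_simps)
  qed
  then show "point v = point w"
    using assms by (auto simp: point_eq_iff)
qed

text \<open>By Cramer's rule \<open>\<alpha>\<close> and \<open>\<beta>\<close> are the coordinates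
  dual to the basis \<open>v\<close>, \<open>u\<close>. They equal 1 and \<open>t\<close> on the
  line, so homogenizing \<open>P\<close> in them does not change its values there.\<close>

lemma homogenize_along_line:
  fixes v u :: "complex ^ 2"
  assumes "v $ 1 * u $ 2 \<noteq> v $ 2 * u $ 1"
  obtains k f where "is_form k f" "\<And>t. f (v + t *s u) = poly P t"
proof -
  define D where "D = v $ 1 * u $ 2 - v $ 2 * u $ 1"
  define \<alpha> where "\<alpha> x = u $ 2 / D * x $ 1 - u $ 1 / D * x $ 2" for x :: "complex ^ 2"
  define \<beta> where "\<beta> x = v $ 1 / D * x $ 2 - v $ 2 / D * x $ 1" for x :: "complex ^ 2"
  have D: "D \<noteq> 0"
    using assms by (simp add: D_def)
  have line: "\<alpha> (v + t *s u) = 1" "\<beta> (v + t *s u) = t" for t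
    using D by (simp_all add: \<alpha>_def \<beta>_def divide_simps) (simp_all add: D_def algebra_simps)
  have forms: "is_form 1 \<alpha>" "is_form 1 \<beta>"
    unfolding \<alpha>_def \<beta>_def by (intro is_form_diff is_form_cmult is_form_coord)+
  let ?K = "degree P"
  show ?thesis
  proof (rule that)
    show "is_form ?K (\<lambda>x. \<Sum>i\<le>?K. coeff P i * (\<beta> x ^ i * \<alpha> x ^ (?K - i)))"
    proof (intro is_form_sum is_form_cmult)
      fix i assume "i \<in> {..?K}"
      then show "is_form ?K (\<lambda>x. \<beta> x ^ i * \<alpha> x ^ (?K - i))"
        using is_form_mult[OF is_form_power[OF forms(2), of i] is_form_power[OF forms(1), of "?K - i"]]
        by simp
    qed
    show "(\<Sum>i\<le>?K. coeff P i * (\<beta> (v + t *s u) ^ i * \<alpha> (v + t *s u) ^ (?K - i))) = poly P t" for t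
      by (simp add: line poly_altdef)
  qed
qed

lemma regular_fun_quotient:
  assumes "is_form k g" "is_form k h" "\<And>w. w \<noteq> 0 \<Longrightarrow> point w \<in> X \<Longrightarrow> h w \<noteq> 0"
  shows "regular_fun X (\<lambda>p. g (coords p) / h (coords p))"
  unfolding regular_fun_iff
proof (intro allI impI)
  fix v :: "complex ^ 'a" assume "v \<noteq> 0 \<and> point v \<in> X"
  have "g (coords (point w)) / h (coords (point w)) = g w / h w" if "w \<noteq> 0" for w
    using is_form_quotient_eq[OF assms(1,2) coords_nonzero that] by simp
  then show "\<exists>l u k g' h'. is_form l u \<and> u v \<noteq> 0 \<and> is_form k g' \<and> is_form k h' \<and>
      (\<forall>w. w \<noteq> 0 \<and> point w \<in> X \<and> u w \<noteq> 0 \<longrightarrow>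
        h' w \<noteq> 0 \<and> g (coords (point w)) / h (coords (point w)) = g' w / h' w)"
    by (rule_tac x = 0 in exI, rule_tac x = "\<lambda>_. 1" in exI, rule_tac x = k in exI,
        rule_tac x = g in exI, rule_tac x = h in exI) (simp add: assms is_form_const)
qed

text \<open>
  Near \<open>p\<close>, in an affine coordinate \<open>t\<close> centred at \<open>p\<close>, the function is \<open>A / B\<close> with polynomials
  \<open>A\<close>, \<open>B\<close> not both vanishing at \<open>0\<close>. If \<open>B\<close> vanished there, the inverse of the function would
  tend to \<open>0\<close>, contradicting the integral equation divided by its leading term.
\<close>

lemma normal_variety_proj_line: "normal_variety (UNIV :: 2 proj set)"
  unfolding normal_variety_def
proof (intro ballI allI impI, elim conjE)
  fix p :: "2 proj" and U f V n a
  assume U: "open_in UNIV U" "U \<noteq> {}" and f: "regular_fun U f"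
    and V: "open_in UNIV V" "p \<in> V" and n: "n > 0"
    and a: "\<forall>i<n. regular_fun V (a i)"
    and eq: "\<forall>q\<in>U \<inter> V. f q ^ n + (\<Sum>i<n. a i q * f q ^ i) = 0"
  show "\<exists>W g. open_in UNIV W \<and> p \<in> W \<and> regular_fun W g \<and> (\<forall>q\<in>U \<inter> W. g q = f q)"
  proof (cases "p \<in> U")
    case True
    then show ?thesis
      using U f by blast
  next
    case False
    obtain v where v: "v \<noteq> 0" "p = point v"
      by (rule point_cases)
    obtain w where w: "w \<noteq> 0" "point w \<in> U"
      using U(2) point_cases by (metis all_not_in_conv)
    \<comment> \<open>The coordinate \<open>t\<close> on the line is 0 at \<open>p\<close> and 1 at
      a chosen point of \<open>U\<close>; the point \<open>u\<close> lies at infinity.\<close>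
    define u where "u = w - v"
    have indep: "v $ 1 * u $ 2 \<noteq> v $ 2 * u $ 1"
      using False v w point_eq_iff_binary[OF v(1) w(1)] by (auto simp: u_def algebra_simps)
    define \<gamma> where "\<gamma> t = v + t *s u" for t
    have \<gamma>_poly: "\<gamma> = (\<lambda>t. \<chi> i. poly [:v $ i, u $ i:] t)"
      by (auto simp: \<gamma>_def vec_eq_iff)
    have \<gamma>: "\<gamma> 0 = v" "\<gamma> 1 = w"
      by (simp_all add: \<gamma>_def u_def)
    have \<gamma>_nz: "\<gamma> t \<noteq> 0" for t
    proof
      assume "\<gamma> t = 0"
      then have "v $ 1 = - t * u $ 1" "v $ 2 = - t * u $ 2"
        by (simp_all add: \<gamma>_def vec2_eq_iff eq_neg_iff_add_eq_0)
      then show False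
        using indep by simp
    qed
    obtain A B E where E1: "poly E 1 \<noteq> 0" and E: "\<And>t. poly E t \<noteq> 0 \<Longrightarrow>
        point (\<gamma> t) \<in> U \<and> poly B t \<noteq> 0 \<and> f (point (\<gamma> t)) = poly A t / poly B t"
      by (rule regular_fun_along_curve[OF \<gamma>_poly \<gamma>_nz UNIV_I U(1) _ f, of 1])
        (use w \<gamma> in simp, rule that)
    have E_nz: "E \<noteq> 0" and B_nz: "B \<noteq> 0"
      using E1 E[of 1] by auto
    have ev_nz: "eventually (\<lambda>t. poly Q t \<noteq> 0) (at 0)" if "Q \<noteq> 0" for Q :: "complex poly"
    proof -
      have "open (- ({t. poly Q t = 0} - {0}))"
        using poly_roots_finite[OF that] by (intro open_Compl finite_imp_closed) simp
      then show ?thesis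
        unfolding eventually_at_topological by blast
    qed
    have lim_a: "\<exists>L. ((\<lambda>t. a i (point (\<gamma> t))) \<longlongrightarrow> L) (at 0)" if i: "i < n" for i
    proof -
      have "point (\<gamma> 0) \<in> V" "regular_fun V (a i)"
        using v V(2) \<gamma>(1) a i by auto
      then obtain C D F where F: "poly F 0 \<noteq> 0" "\<And>t. poly F t \<noteq> 0 \<Longrightarrow> point (\<gamma> t) \<in> V \<and>
          poly D t \<noteq> 0 \<and> a i (point (\<gamma> t)) = poly C t / poly D t"
        by (rule regular_fun_along_curve[OF \<gamma>_poly \<gamma>_nz UNIV_I V(1)]) (rule that)
      have lim: "((\<lambda>t. poly C t / poly D t) \<longlongrightarrow> poly C 0 / poly D 0) (at 0)"
        using F by (intro tendsto_intros) auto
      have ev: "eventually (\<lambda>t. a i (point (\<gamma> t)) = poly C t / poly D t) (at 0)"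
        using ev_nz[of F] F by (force elim: eventually_mono)
      show ?thesis
        using tendsto_cong[OF ev] lim by blast
    qed
    then obtain L where L: "\<And>i. i < n \<Longrightarrow> ((\<lambda>t. a i (point (\<gamma> t))) \<longlongrightarrow> L i) (at 0)"
      by metis
    obtain EV where EV: "poly EV 0 \<noteq> 0" "\<And>t. poly EV t \<noteq> 0 \<Longrightarrow> point (\<gamma> t) \<in> V"
      using open_in_along_curve[OF \<gamma>_poly \<gamma>_nz UNIV_I V(1), of 0] V(2) v \<gamma>(1) by metis
    \<comment> \<open>The zero of the denominator at \<open>p\<close> is split off; comparing its
      order \<open>j\<close> with that of the numerator decides whether \<open>f\<close> has a
      pole.\<close>
    obtain B1 j where B1: "B = [:0, 1:] ^ j * B1" "poly B1 0 \<noteq> 0"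
      using order_decomp[OF B_nz, of 0] by (auto simp: poly_eq_0_iff_dvd)
    obtain A' B' where B': "poly B' 0 \<noteq> 0"
      and f_eq: "\<And>t. t \<noteq> 0 \<Longrightarrow> poly E t \<noteq> 0 \<Longrightarrow> f (point (\<gamma> t)) = poly A' t / poly B' t"
    proof (cases "A = 0")
      case True
      then show ?thesis
        using E by (intro that[of 1 0]) auto
    next
      case False
      obtain A1 i where A1: "A = [:0, 1:] ^ i * A1" "poly A1 0 \<noteq> 0"
        using order_decomp[OF False, of 0] by (auto simp: poly_eq_0_iff_dvd)
      show ?thesis
      proof (cases "j \<le> i")
        case True
        then obtain m where m: "i = j + m"
          using le_Suc_ex by blast
        have "f (point (\<gamma> t)) = poly ([:0, 1:] ^ m * A1) t / poly B1 t"
          if "t \<noteq> 0" "poly E t \<noteq> 0" for t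
          using that E[of t] by (simp add: A1 B1 m power_add)
        then show ?thesis
          using that B1(2) by blast
      next
        case ij: False
        \<comment> \<open>In the case of a pole, \<open>r\<close> is the inverse of \<open>f\<close>
          and tends to 0. The integral equation multiplied by \<open>r^n\<close> becomes
          \<open>1 = 0\<close> in the limit.\<close>
        define r where "r t = t ^ (j - i) * poly B1 t / poly A1 t" for t
        have "(r \<longlongrightarrow> 0 ^ (j - i) * poly B1 0 / poly A1 0) (at 0)"
          unfolding r_def using A1(2) by (intro tendsto_intros)
        then have r: "(r \<longlongrightarrow> 0) (at 0)"
          using ij by (simp add: power_0_left)
        have lim: "((\<lambda>t. 1 + (\<Sum>i<n. a i (point (\<gamma> t)) * r t ^ (n - i))) \<longlongrightarrow>
            1 + (\<Sum>i<n. L i * 0 ^ (n - i))) (at 0)"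
          by (intro tendsto_intros L r) auto
        have ev: "eventually (\<lambda>t. 1 + (\<Sum>i<n. a i (point (\<gamma> t)) * r t ^ (n - i)) = 0) (at 0)"
        proof -
          have "A1 \<noteq> 0" "EV \<noteq> 0"
            using A1 EV by auto
          then have "eventually (\<lambda>t. poly A1 t \<noteq> 0 \<and> poly EV t \<noteq> 0 \<and> poly E t \<noteq> 0 \<and> t \<noteq> 0) (at 0)"
            using ev_nz E_nz by (intro eventually_conj eventually_neq_at_within) auto
          then show ?thesis
          proof eventually_elim
            case (elim t)
            let ?f = "f (point (\<gamma> t))"
            have Et: "point (\<gamma> t) \<in> U" "poly B t \<noteq> 0" "?f = poly A t / poly B t"
              using E elim by auto
            have fr: "?f * r t = 1"
              using elim Et(2) ij unfolding Et(3) r_def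
              by (simp add: A1 B1 power_diff field_simps)
            have "?f ^ n + (\<Sum>i<n. a i (point (\<gamma> t)) * ?f ^ i) = 0"
              using eq Et(1) EV(2) elim by blast
            then have "r t ^ n * (?f ^ n + (\<Sum>i<n. a i (point (\<gamma> t)) * ?f ^ i)) = 0"
              by simp
            moreover have "r t ^ n * (a i (point (\<gamma> t)) * ?f ^ i) =
                a i (point (\<gamma> t)) * r t ^ (n - i)" if "i < n" for i
            proof -
              have "r t ^ n = r t ^ (n - i) * r t ^ i"
                using that by (simp flip: power_add)
              then have "r t ^ n * ?f ^ i = r t ^ (n - i) * (?f * r t) ^ i"
                by (simp add: power_mult_distrib mult_ac)
              then have "r t ^ n * ?f ^ i = r t ^ (n - i)"
                by (simp only: fr power_one mult_1_right)
              then show ?thesis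
                by (metis mult.left_commute)
            qed
            moreover have "r t ^ n * ?f ^ n = 1"
              by (metis fr mult.commute power_mult_distrib power_one)
            ultimately show ?case
              by (simp add: distrib_left sum_distrib_left)
          qed
        qed
        have "((\<lambda>t::complex. 0) \<longlongrightarrow> 1 + (\<Sum>i<n. L i * 0 ^ (n - i))) (at 0)"
          using lim unfolding tendsto_cong[OF ev] .
        then have "1 + (\<Sum>i<n. L i * 0 ^ (n - i)) = 0"
          by (simp add: tendsto_const_iff)
        moreover have "(\<Sum>i<n. L i * 0 ^ (n - i)) = 0"
          by (intro sum.neutral) (simp add: power_0_left)
        ultimately show ?thesis
          by simp
      qed
    qed
    \<comment> \<open>As \<open>p\<close> is not in \<open>U\<close>, \<open>E\<close> vanishes at
      0. Dividing out the power of \<open>t\<close> leaves a condition that \<open>p\<close>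
      satisfies and that still implies \<open>f_eq\<close> for \<open>t\<close> different from
      0.\<close>
    obtain E' k where E': "E = [:0, 1:] ^ k * E'" "poly E' 0 \<noteq> 0"
      using order_decomp[OF E_nz, of 0] by (auto simp: poly_eq_0_iff_dvd)
    obtain kA gA where gA: "is_form kA gA" "\<And>t. gA (\<gamma> t) = poly A' t"
      using homogenize_along_line[OF indep] unfolding \<gamma>_def by metis
    obtain kB gB where gB: "is_form kB gB" "\<And>t. gB (\<gamma> t) = poly B' t"
      using homogenize_along_line[OF indep] unfolding \<gamma>_def by metis
    obtain kE gE where gE: "is_form kE gE" "\<And>t. gE (\<gamma> t) = poly E' t"
      using homogenize_along_line[OF indep] unfolding \<gamma>_def by metis
    \<comment> \<open>The linear form vanishing exactly at the point at infinity \<open>u\<close>;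
      it is constant along \<open>\<gamma>\<close>. Its powers equalize the degrees of numerator and
      denominator.\<close>
    define \<alpha> where "\<alpha> x = u $ 2 * x $ 1 - u $ 1 * x $ 2" for x :: "complex ^ 2"
    have \<alpha>: "is_form 1 \<alpha>"
      unfolding \<alpha>_def by (intro is_form_diff is_form_cmult is_form_coord)
    have \<alpha>_\<gamma>: "\<alpha> (\<gamma> t) = \<alpha> v" "\<alpha> v \<noteq> 0" for t
      using indep by (simp_all add: \<alpha>_def \<gamma>_def algebra_simps)
    have \<alpha>_line: "\<exists>t. point x = point (\<gamma> t)" if "x \<noteq> 0" "\<alpha> x \<noteq> 0" for x
    proof -
      have "x $ 1 * \<gamma> t $ 2 = x $ 2 * \<gamma> t $ 1"
        if "t = (x $ 2 * v $ 1 - x $ 1 * v $ 2) / \<alpha> x" for t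
      proof -
        have "t * \<alpha> x = x $ 2 * v $ 1 - x $ 1 * v $ 2"
          using that \<open>\<alpha> x \<noteq> 0\<close> by simp
        then show ?thesis
          by (simp add: \<alpha>_def \<gamma>_def algebra_simps)
      qed
      then show ?thesis
        using point_eq_iff_binary[OF that(1) \<gamma>_nz] by blast
    qed
    let ?num = "\<lambda>x. gA x * \<alpha> x ^ kB" and ?den = "\<lambda>x. gB x * \<alpha> x ^ kA"
    \<comment> \<open>Cancels the constant powers of \<open>\<alpha> v\<close> introduced by
      equalizing the degrees.\<close>
    let ?c = "\<alpha> v ^ kA / \<alpha> v ^ kB"
    have forms: "is_form (kA + kB) (\<lambda>x. ?c * ?num x)" "is_form (kA + kB) ?den"
      using is_form_cmult[OF is_form_mult[OF gA(1) is_form_power[OF \<alpha>, of kB]], of ?c]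
        is_form_mult[OF gB(1) is_form_power[OF \<alpha>, of kA]]
      by (simp_all add: add.commute)
    have loc: "is_form (kB + kE + 1) (\<lambda>x. gB x * gE x * \<alpha> x)"
      by (intro is_form_mult gB gE \<alpha>)
    let ?W = "nonzero_locus UNIV (\<lambda>x. gB x * gE x * \<alpha> x)"
    let ?g = "\<lambda>q. (?c * ?num (coords q)) / ?den (coords q)"
    show ?thesis
    proof (intro exI conjI ballI)
      show "open_in UNIV ?W"
        by (rule open_in_nonzero_locus[OF loc])
      show "p \<in> ?W"
        using gB(2)[of 0] gE(2)[of 0] B' E'(2) \<alpha>_\<gamma>(2) v
        by (simp add: point_in_nonzero_locus_iff[OF loc] \<gamma>)
      show "regular_fun ?W ?g"
        by (rule regular_fun_quotient[OF forms]) (simp add: point_in_nonzero_locus_iff[OF loc])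
      fix q assume q: "q \<in> U \<inter> ?W"
      obtain x where x: "x \<noteq> 0" "q = point x"
        by (rule point_cases)
      with q have "\<alpha> x \<noteq> 0"
        by (simp add: point_in_nonzero_locus_iff[OF loc])
      then obtain t where t: "q = point (\<gamma> t)"
        using \<alpha>_line x by blast
      have nz: "poly B' t \<noteq> 0" "poly E' t \<noteq> 0"
        using q gB(2) gE(2) by (auto simp: t point_in_nonzero_locus_iff[OF loc \<gamma>_nz])
      have "t \<noteq> 0"
        using q False v(2) \<gamma>(1) t by auto
      then have "f q = poly A' t / poly B' t"
        using f_eq[of t] nz(2) unfolding t by (simp add: E')
      moreover have "?g q = (?c * ?num (\<gamma> t)) / ?den (\<gamma> t)"
        using is_form_quotient_eq[OF forms coords_nonzero \<gamma>_nz] t by simp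
      ultimately show "?g q = f q"
        using \<alpha>_\<gamma> nz by (simp add: gA gB)
    qed
  qed
qed

section \<open>Regular functions: gluing and ring operations\<close>

lemma regular_funI:
  assumes "\<And>v. v \<noteq> 0 \<Longrightarrow> point v \<in> X \<Longrightarrow>
    \<exists>l u k g h. is_form l u \<and> u v \<noteq> 0 \<and> is_form k g \<and> is_form k h \<and>
      (\<forall>w. w \<noteq> 0 \<and> point w \<in> X \<and> u w \<noteq> 0 \<longrightarrow> h w \<noteq> 0 \<and> f (point w) = g w / h w)"
  shows "regular_fun X f"
  unfolding regular_fun_iff using assms by blast

lemma regular_fun_const: "regular_fun X (\<lambda>_. c)"
proof -
  have "regular_fun X (\<lambda>p :: 'a proj. c / 1)"
    by (rule regular_fun_quotient[of 0 "\<lambda>_. c" "\<lambda>_. 1"]) (auto simp: is_form_const)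
  then show ?thesis
    by simp
qed

lemma regular_fun_local:
  assumes "\<And>v. v \<noteq> 0 \<Longrightarrow> point v \<in> X \<Longrightarrow>
    \<exists>l u. is_form l u \<and> u v \<noteq> 0 \<and> regular_fun (nonzero_locus X u) f"
  shows "regular_fun X f"
proof (rule regular_funI)
  fix v :: "complex ^ 'a" assume v: "v \<noteq> 0" "point v \<in> X"
  then obtain l u where u: "is_form l u" "u v \<noteq> 0" "regular_fun (nonzero_locus X u) f"
    using assms by blast
  have "point v \<in> nonzero_locus X u"
    using u v by (simp add: point_in_nonzero_locus_iff)
  with regular_funE[OF u(3) v(1)] obtain l' u' k g h
    where u': "is_form l' u'" "u' v \<noteq> 0" and gh: "is_form k g" "is_form k h"
      and f: "\<And>w. w \<noteq> 0 \<Longrightarrow> point w \<in> nonzero_locus X u \<Longrightarrow> u' w \<noteq> 0 \<Longrightarrow>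
        h w \<noteq> 0 \<and> f (point w) = g w / h w"
    by blast
  show "\<exists>l u k g h. is_form l u \<and> u v \<noteq> 0 \<and> is_form k g \<and> is_form k h \<and>
      (\<forall>w. w \<noteq> 0 \<and> point w \<in> X \<and> u w \<noteq> 0 \<longrightarrow> h w \<noteq> 0 \<and> f (point w) = g w / h w)"
  proof (intro exI conjI)
    show "is_form (l + l') (\<lambda>w. u w * u' w)" "u v * u' v \<noteq> 0"
      using u u' by (auto intro: is_form_mult)
    show "\<forall>w. w \<noteq> 0 \<and> point w \<in> X \<and> u w * u' w \<noteq> 0 \<longrightarrow> h w \<noteq> 0 \<and> f (point w) = g w / h w"
      using f u(1) by (auto simp: point_in_nonzero_locus_iff)
  qed (rule gh)+
qed

text \<open>Common pattern for differences and products: \<open>N\<close> is the numerator over the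
  common denominator \<open>h1 * h2\<close>, and the neighbourhood is cut out by
  \<open>u1 * u2\<close>.\<close>

lemma regular_fun_op:
  fixes X :: "'n::finite proj set"
    and N :: "(complex ^ 'n \<Rightarrow> complex) \<Rightarrow> (complex ^ 'n \<Rightarrow> complex) \<Rightarrow>
      (complex ^ 'n \<Rightarrow> complex) \<Rightarrow> (complex ^ 'n \<Rightarrow> complex) \<Rightarrow> complex ^ 'n \<Rightarrow> complex"
  assumes f1: "regular_fun X f1" and f2: "regular_fun X f2"
    and N: "\<And>k1 g1 h1 k2 g2 h2. is_form k1 g1 \<Longrightarrow> is_form k1 h1 \<Longrightarrow> is_form k2 g2 \<Longrightarrow> is_form k2 h2 \<Longrightarrow>
      is_form (k1 + k2) (N g1 h1 g2 h2)"
    and op: "\<And>g1 h1 g2 h2 w. h1 w \<noteq> 0 \<Longrightarrow> h2 w \<noteq> 0 \<Longrightarrow>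
      op (g1 w / h1 w) (g2 w / h2 w) = N g1 h1 g2 h2 w / (h1 w * h2 w)"
  shows "regular_fun X (\<lambda>p. op (f1 p) (f2 p))"
proof (rule regular_funI)
  fix v :: "complex ^ 'n" assume v: "v \<noteq> 0" "point v \<in> X"
  obtain l1 u1 k1 g1 h1 where 1: "is_form l1 u1" "u1 v \<noteq> 0" "is_form k1 g1" "is_form k1 h1"
    "\<And>w. w \<noteq> 0 \<Longrightarrow> point w \<in> X \<Longrightarrow> u1 w \<noteq> 0 \<Longrightarrow> h1 w \<noteq> 0 \<and> f1 (point w) = g1 w / h1 w"
    using regular_funE[OF f1 v] by blast
  obtain l2 u2 k2 g2 h2 where 2: "is_form l2 u2" "u2 v \<noteq> 0" "is_form k2 g2" "is_form k2 h2"
    "\<And>w. w \<noteq> 0 \<Longrightarrow> point w \<in> X \<Longrightarrow> u2 w \<noteq> 0 \<Longrightarrow> h2 w \<noteq> 0 \<and> f2 (point w) = g2 w / h2 w"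
    using regular_funE[OF f2 v] by blast
  show "\<exists>l u k g h. is_form l u \<and> u v \<noteq> 0 \<and> is_form k g \<and> is_form k h \<and>
      (\<forall>w. w \<noteq> 0 \<and> point w \<in> X \<and> u w \<noteq> 0 \<longrightarrow>
        h w \<noteq> 0 \<and> op (f1 (point w)) (f2 (point w)) = g w / h w)"
  proof (intro exI conjI)
    show "is_form (l1 + l2) (\<lambda>w. u1 w * u2 w)" "u1 v * u2 v \<noteq> 0"
      using 1 2 by (auto intro: is_form_mult)
    show "is_form (k1 + k2) (N g1 h1 g2 h2)"
      by (rule N) (use 1 2 in auto)
    show "is_form (k1 + k2) (\<lambda>w. h1 w * h2 w)"
      using 1 2 by (intro is_form_mult)
    show "\<forall>w. w \<noteq> 0 \<and> point w \<in> X \<and> u1 w * u2 w \<noteq> 0 \<longrightarrow>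
        h1 w * h2 w \<noteq> 0 \<and> op (f1 (point w)) (f2 (point w)) = N g1 h1 g2 h2 w / (h1 w * h2 w)"
      using 1(5) 2(5) op by auto
  qed
qed

lemma regular_fun_diff:
  "regular_fun X f1 \<Longrightarrow> regular_fun X f2 \<Longrightarrow> regular_fun X (\<lambda>p. f1 p - f2 p)"
  by (rule regular_fun_op[where op = "(-)" and N = "\<lambda>g1 h1 g2 h2 w. g1 w * h2 w - h1 w * g2 w"])
    (auto intro!: is_form_diff is_form_mult simp: field_simps)

lemma regular_fun_mult:
  "regular_fun X f1 \<Longrightarrow> regular_fun X f2 \<Longrightarrow> regular_fun X (\<lambda>p. f1 p * f2 p)"
  by (rule regular_fun_op[where op = "(*)" and N = "\<lambda>g1 h1 g2 h2 w. g1 w * g2 w"]) (auto intro!: is_form_mult)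

lemma regular_fun_power: "regular_fun X f \<Longrightarrow> regular_fun X (\<lambda>p. f p ^ n)"
  by (induction n) (auto intro: regular_fun_const regular_fun_mult)


section \<open>The parametrization is the normalization\<close>

lemma is_form_monomial: "is_form (i + j) (\<lambda>v. v $ p ^ i * v $ q ^ j)"
  using is_form_mult[OF is_form_power[OF is_form_coord] is_form_power[OF is_form_coord]] by simp

definition graph_form :: "nat \<Rightarrow> complex \<Rightarrow> complex \<Rightarrow> complex ^ 2 \<Rightarrow> complex" where
  "graph_form d b c v = v $ 1 ^ d + b * (v $ 1 ^ (d - 2) * v $ 2 ^ 2) + c * (v $ 1 ^ (d - 3) * v $ 2 ^ 3)"

definition param :: "nat \<Rightarrow> complex \<Rightarrow> complex \<Rightarrow> complex ^ 2 \<Rightarrow> complex ^ 3" where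
  "param d b c v = vector [v $ 1 * v $ 2 ^ (d - 1), graph_form d b c v, v $ 2 ^ d]"

definition param_map :: "nat \<Rightarrow> complex \<Rightarrow> complex \<Rightarrow> 2 proj \<Rightarrow> 3 proj" where
  "param_map d b c p = point (param d b c (coords p))"

text \<open>The projection from the cusp, \<open>[x:y:z]\<close> to \<open>[x:z]\<close>. It is
  undefined at the cusp itself, where the direction \<open>[1:0]\<close> of the tangent line
  \<open>z = 0\<close> is filled in.\<close>

definition param_inv :: "3 proj \<Rightarrow> 2 proj" where
  "param_inv q = (if coords q $ 3 = 0 then point (vector [1, 0])
     else point (vector [coords q $ 1, coords q $ 3]))"

lemma param_nth [simp]:
  "param d b c v $ 1 = v $ 1 * v $ 2 ^ (d - 1)"
  "param d b c v $ 2 = graph_form d b c v"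
  "param d b c v $ 3 = v $ 2 ^ d"
  by (simp_all add: param_def)

lemma is_form_graph_form:
  assumes "d \<ge> 3"
  shows "is_form d (graph_form d b c)"
proof -
  have power: "is_form n (\<lambda>v. v $ i ^ n)" for n and i :: 2
    using is_form_power[OF is_form_coord, of n i] by simp
  have deg: "d - 2 + 2 = d" "d - 3 + 3 = d"
    using assms by auto
  have "is_form d (\<lambda>v::complex^2. v $ 1 ^ (d - 2) * v $ 2 ^ 2)"
    "is_form d (\<lambda>v::complex^2. v $ 1 ^ (d - 3) * v $ 2 ^ 3)"
    using is_form_monomial[of "d - 2" 2 1 "2::2"] is_form_monomial[of "d - 3" 3 1 "2::2"]
    unfolding deg by simp_all
  then show ?thesis
    unfolding graph_form_def[abs_def] by (intro is_form_add is_form_cmult power)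
qed

lemma is_form_param:
  assumes "d \<ge> 3"
  shows "is_form d (\<lambda>v. param d b c v $ i)"
proof -
  have "is_form d (\<lambda>v::complex^2. v $ 1 * v $ 2 ^ (d - 1))" "is_form d (\<lambda>v::complex^2. v $ 2 ^ d)"
    using is_form_monomial[of 1 "d - 1" 1 "2::2"] is_form_monomial[of 0 d 1 "2::2"]
      assms by simp_all
  then have "\<forall>i. is_form d (\<lambda>v. param d b c v $ i)"
    using is_form_graph_form[OF assms] by (simp add: forall_3)
  then show ?thesis ..
qed

lemma param_nonzero:
  assumes "d \<ge> 3" "v \<noteq> 0"
  shows "param d b c v \<noteq> 0"
  using assms by (auto simp: vec3_eq_iff vec2_eq_iff graph_form_def)

lemma param_map_point:
  assumes "d \<ge> 3" "v \<noteq> 0"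
  shows "param_map d b c (point v) = point (param d b c v)"
proof -
  obtain a where a: "a \<noteq> 0" "coords (point v) = a *s v"
    using point_eq_iff[OF assms(2) coords_nonzero, of "point v"] by auto
  have "param d b c (a *s v) = a ^ d *s param d b c v"
    using is_form_scale[OF is_form_param[OF assms(1)]] by (simp add: vec_eq_iff)
  then show ?thesis
    using a point_scale[OF param_nonzero[OF assms]] by (simp add: param_map_def)
qed

lemma param_inv_point:
  assumes "w \<noteq> 0"
  shows "param_inv (point w) = (if w $ 3 = 0 then point (vector [1, 0]) else point (vector [w $ 1, w $ 3]))"
proof -
  obtain a where "a \<noteq> 0" "coords (point w) = a *s w"
    using point_eq_iff[OF assms coords_nonzero, of "point w"] by auto
  moreover have "vector [a * x, a * z] = a *s (vector [x, z] :: complex ^ 2)" for x z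
    by (simp add: vec2_eq_iff)
  moreover have "vector [x, z] \<noteq> (0 :: complex ^ 2)" if "z \<noteq> 0" for x z
    using that by (simp add: vec2_eq_iff)
  ultimately show ?thesis
    by (simp add: param_inv_def point_scale)
qed

lemma e1_nonzero: "vector [1, 0] \<noteq> (0 :: complex ^ 2)"
  by (simp add: vec2_eq_iff)

lemma param_e1: "d \<ge> 3 \<Longrightarrow> param d b c (vector [1, 0]) = cusp"
  by (simp add: vec3_eq_iff graph_form_def power_0_left)

lemma mpeval_curve_form_param:
  assumes "d \<ge> 3"
  shows "mpeval (curve_form d b c) (param d b c v) = 0"
proof -
  obtain e where d: "d = e + 3"
    using assms by (metis add.commute le_Suc_ex)
  have exps: "d - 1 = e + 2" "d - 2 = e + 1" "d - 3 = e"
    by (simp_all add: d)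
  show ?thesis
    unfolding mpeval_curve_form param_nth graph_form_def exps unfolding d
    by (simp add: power_mult_distrib algebra_simps flip: power_mult power_add)
      (auto simp: power_add eval_nat_numeral)
qed

lemma point_in_curve_iff:
  assumes "d \<ge> 3" "w \<noteq> 0"
  shows "point w \<in> zeros (curve_form d b c) \<longleftrightarrow> mpeval (curve_form d b c) w = 0"
  by (rule point_in_zeros_iff[OF homogeneous_curve_form[OF assms(1)] assms(2)])

lemma param_in_curve:
  assumes "d \<ge> 3" "v \<noteq> 0"
  shows "point (param d b c v) \<in> zeros (curve_form d b c)"
  using assms param_nonzero by (simp add: point_in_curve_iff mpeval_curve_form_param)

lemma param_map_inv:
  assumes "d \<ge> 3" "q \<in> zeros (curve_form d b c)"
  shows "param_map d b c (param_inv q) = q"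
proof -
  obtain w where w: "w \<noteq> 0" "q = point w"
    by (rule point_cases)
  then have F: "mpeval (curve_form d b c) w = 0"
    using assms point_in_curve_iff by blast
  show ?thesis
  proof (cases "w $ 3 = 0")
    case True
    then have "w $ 1 = 0"
      using F assms(1) by (simp add: mpeval_curve_form power_0_left)
    then have "w = (w $ 2) *s cusp" "w $ 2 \<noteq> 0"
      using True w(1) by (auto simp: vec3_eq_iff)
    then have "point w = point cusp"
      using point_scale[OF cusp_nonzero] by metis
    moreover have "param_inv (point w) = point (vector [1, 0])"
      using True w(1) by (simp add: param_inv_point)
    moreover have "param_map d b c (point (vector [1, 0])) = point cusp"
      by (simp add: param_map_point[OF assms(1) e1_nonzero] param_e1[OF assms(1)])
    ultimately show ?thesis
      using w(2) by metis
  next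
    case False
    let ?v = "vector [w $ 1, w $ 3] :: complex ^ 2"
    have v: "?v \<noteq> 0"
      using False by (simp add: vec2_eq_iff)
    have "w $ 3 ^ d = w $ 3 ^ (d - 1) * w $ 3"
      using assms(1) by (metis power_minus_mult less_le_trans zero_less_numeral)
    then have "param d b c ?v = w $ 3 ^ (d - 1) *s w"
      using F by (simp add: vec3_eq_iff graph_form_def mpeval_curve_form algebra_simps)
    then show ?thesis
      using False w assms(1) v point_scale[OF w(1)] by (simp add: param_inv_point param_map_point)
  qed
qed

lemma param_inv_map:
  assumes "d \<ge> 3"
  shows "param_inv (param_map d b c p) = p"
proof -
  obtain v where v: "v \<noteq> 0" "p = point v"
    by (rule point_cases)
  show ?thesis
  proof (cases "v $ 2 = 0")
    case True
    then have "point v = point (vector [1, 0])"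
      using v(1) by (subst point_eq_iff_binary) (auto simp: e1_nonzero)
    moreover have "param_inv (point (param d b c v)) = point (vector [1, 0])"
      using True assms v(1) by (simp add: param_inv_point param_nonzero power_0_left)
    ultimately show ?thesis
      using v(2) param_map_point[OF assms v(1)] by metis
  next
    case False
    have "v $ 2 ^ d = v $ 2 ^ (d - 1) * v $ 2"
      using assms by (metis power_minus_mult less_le_trans zero_less_numeral)
    then have "vector [v $ 1 * v $ 2 ^ (d - 1), v $ 2 ^ d] = v $ 2 ^ (d - 1) *s v"
      by (simp add: vec2_eq_iff)
    then show ?thesis
      using assms v False point_scale[OF v(1)] by (simp add: param_map_point param_inv_point param_nonzero)
  qed
qed

lemma regular_map_param_map:
  assumes "d \<ge> 3"
  shows "regular_map UNIV (zeros (curve_form d b c)) (param_map d b c)"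
  by (rule regular_map_form[where g = "\<lambda>i v. param d b c v $ i", OF is_form_param[OF assms]])
    (simp add: assms param_nonzero param_in_curve param_map_point)

lemma regular_map_param_inv:
  assumes "V \<subseteq> nonzero_locus UNIV (\<lambda>w. w $ 3)" "param_inv ` V \<subseteq> U"
  shows "regular_map V U param_inv"
proof (rule regular_map_form[where k = 1 and g = "\<lambda>i w. if i = 1 then w $ 1 else w $ 3"])
  show "is_form 1 (\<lambda>w::complex^3. if i = 1 then w $ 1 else w $ 3)" for i :: 2
    by (cases "i = 1") (simp_all add: is_form_coord[unfolded One_nat_def])
  fix w :: "complex ^ 3" assume w: "w \<noteq> 0" "point w \<in> V"
  have "w $ 3 \<noteq> 0"
    using assms(1) w(2) point_in_nonzero_locus_iff[OF is_form_coord w(1)] by blast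
  have eq: "(\<chi> i. if i = 1 then w $ 1 else w $ 3) = (vector [w $ 1, w $ 3] :: complex ^ 2)"
    by (simp add: vec2_eq_iff)
  show "(\<chi> i. if i = 1 then w $ 1 else w $ 3) \<noteq> (0 :: complex ^ 2) \<and>
      param_inv (point w) = point (\<chi> i. if i = 1 then w $ 1 else w $ 3) \<and> param_inv (point w) \<in> U"
    unfolding eq using \<open>w $ 3 \<noteq> 0\<close> w assms(2) by (auto simp: param_inv_point vec2_eq_iff)
qed

lemma birational_map_param_map:
  assumes "d \<ge> 3"
  shows "birational_map UNIV (zeros (curve_form d b c)) (param_map d b c)"
proof -
  let ?C = "zeros (curve_form d b c)"
  let ?U = "nonzero_locus UNIV (\<lambda>v :: complex ^ 2. v $ 2)"
  let ?V = "nonzero_locus ?C (\<lambda>w. w $ 3)"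
  have e2: "vector [0, 1] \<noteq> (0 :: complex ^ 2)"
    by (simp add: vec2_eq_iff)
  have U: "open_in UNIV ?U" "point (vector [0, 1]) \<in> ?U"
    using open_in_nonzero_locus[OF is_form_coord] point_in_nonzero_locus_iff[OF is_form_coord e2]
    by auto
  have img: "param_map d b c p \<in> ?V" if "p \<in> ?U" for p
  proof -
    obtain v where v: "v \<noteq> 0" "p = point v"
      by (rule point_cases)
    then show ?thesis
      using that assms param_in_curve[OF assms v(1)]
        point_in_nonzero_locus_iff[OF is_form_coord param_nonzero[OF assms v(1)]]
        point_in_nonzero_locus_iff[OF is_form_coord v(1)]
      by (simp add: param_map_point)
  qed
  have inv_img: "param_inv q \<in> ?U" if "q \<in> ?V" for q
  proof -
    obtain w where w: "w \<noteq> 0" "q = point w"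
      by (rule point_cases)
    then have "w $ 3 \<noteq> 0"
      using that point_in_nonzero_locus_iff[OF is_form_coord w(1)] by blast
    moreover from this have "vector [w $ 1, w $ 3] \<noteq> (0 :: complex ^ 2)"
      by (simp add: vec2_eq_iff)
    ultimately show ?thesis
      using w point_in_nonzero_locus_iff[OF is_form_coord, of "vector [w $ 1, w $ 3] :: complex ^ 2" UNIV 2]
      by (simp add: param_inv_point)
  qed
  have "isomorphism ?U ?V (param_map d b c)"
    unfolding isomorphism_def
  proof (intro conjI exI ballI)
    show "regular_map ?U ?V (param_map d b c)"
      using regular_map_subset[OF regular_map_param_map[OF assms]] img by blast
    show "regular_map ?V ?U param_inv"
      using inv_img by (intro regular_map_param_inv) (auto simp: nonzero_locus_def)
    show "param_inv (param_map d b c p) = p" for p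
      by (rule param_inv_map[OF assms])
    show "param_map d b c (param_inv q) = q" if "q \<in> ?V" for q
      using that by (intro param_map_inv[OF assms]) (auto simp: nonzero_locus_def)
  qed
  moreover have "open_in ?C ?V" "?V \<noteq> {}"
    using open_in_nonzero_locus[OF is_form_coord] img U(2) by auto
  ultimately show ?thesis
    unfolding birational_map_def using U regular_map_param_map[OF assms] by blast
qed


subsection \<open>Forms on the line that come from the plane\<close>

text \<open>
  The conductor of the cusp: binary forms vanishing to order \<open>(d - 1)^2\<close> at the point over the cusp,
  of degree divisible by \<open>d\<close>, are forms in the coordinates of the plane. Monomials of degree less
  than \<open>d\<close> in the first variable are monomials in \<open>x\<close> and \<open>z\<close>; the others are reduced with \<open>y\<close>.
\<close>

lemma monomial_from_plane:
  assumes d: "d \<ge> 3"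
  shows "j + l = d * m \<Longrightarrow> l \<ge> (d - 1)\<^sup>2 \<Longrightarrow>
    \<exists>G. is_form m G \<and> (\<forall>v. G (param d b c v) = v $ 1 ^ j * v $ 2 ^ l)"
proof (induction j arbitrary: l m rule: less_induct)
  case (less j)
  show ?case
  proof (cases "j < d")
    case True
    \<comment> \<open>The origin of the bound \<open>(d - 1)^2\<close>: in \<open>x^j z^i\<close>
      the factor \<open>x^j\<close> already contributes \<open>j (d - 1)\<close> to the exponent of
      the second variable, and \<open>j\<close> is at most \<open>d - 1\<close>.\<close>
    then have "j * (d - 1) \<le> (d - 1) * (d - 1)"
      by (intro mult_le_mono) (use True in auto)
    then have le: "j * (d - 1) \<le> l"
      using less.prems(2) unfolding power2_eq_square by (rule order.trans)
    have jd: "j + j * (d - 1) = d * j"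
      using d by (cases d) auto
    then have "d * j \<le> d * m"
      using le less.prems(1) by linarith
    then have "j \<le> m"
      using d by simp
    then obtain i where m: "m = j + i"
      using le_Suc_ex by blast
    have l: "l = (d - 1) * j + d * i"
      using less.prems(1) jd by (simp add: m add_mult_distrib2 mult.commute)
    have "is_form m (\<lambda>w::complex^3. w $ 1 ^ j * w $ 3 ^ i)"
      using is_form_monomial[of j i 1 "3::3"] by (simp add: m)
    moreover have "param d b c v $ 1 ^ j * param d b c v $ 3 ^ i = v $ 1 ^ j * v $ 2 ^ l" for v
      by (simp add: l power_mult_distrib power_add power_mult)
    ultimately show ?thesis
      by blast
  next
    case False
    then obtain k where j: "j = d + k"
      using le_Suc_ex not_less by blast
    have "m \<noteq> 0"
      using less.prems(1) j d by (intro notI) simp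
    then obtain m' where m: "m = Suc m'"
      using not0_implies_Suc by blast
    have "k + l = d * m'"
      using less.prems(1) by (simp add: j m)
    \<comment> \<open>A factor \<open>v1^d\<close> is replaced by \<open>y\<close> minus the terms
      with \<open>b\<close> and \<open>c\<close> of \<open>graph_form\<close>. The three resulting
      monomials have smaller exponents of \<open>v1\<close> and are supplied by induction as
      \<open>G1\<close>, \<open>G2\<close>, \<open>G3\<close>.\<close>
    then obtain G1 where G1: "is_form m' G1" "\<And>v. G1 (param d b c v) = v $ 1 ^ k * v $ 2 ^ l"
      using less.IH[of k l m'] less.prems d j by auto
    obtain G2 where G2: "is_form m G2" "\<And>v. G2 (param d b c v) = v $ 1 ^ (j - 2) * v $ 2 ^ (l + 2)"
    proof -
      have "j - 2 < j" "j - 2 + (l + 2) = d * m" "(d - 1)\<^sup>2 \<le> l + 2"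
        using less.prems d j by linarith+
      from less.IH[OF this] show ?thesis
        using that by blast
    qed
    obtain G3 where G3: "is_form m G3" "\<And>v. G3 (param d b c v) = v $ 1 ^ (j - 3) * v $ 2 ^ (l + 3)"
    proof -
      have "j - 3 < j" "j - 3 + (l + 3) = d * m" "(d - 1)\<^sup>2 \<le> l + 3"
        using less.prems d j by linarith+
      from less.IH[OF this] show ?thesis
        using that by blast
    qed
    have "is_form m (\<lambda>w. w $ 2 * G1 w)"
      using is_form_mult[OF is_form_coord G1(1), of 2] by (simp add: m)
    then have "is_form m (\<lambda>w. w $ 2 * G1 w - b * G2 w - c * G3 w)"
      by (intro is_form_diff is_form_cmult G2 G3)
    moreover have "param d b c v $ 2 * G1 (param d b c v) - b * G2 (param d b c v) -
        c * G3 (param d b c v) = v $ 1 ^ j * v $ 2 ^ l" for v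
    proof -
      have "j - 2 = (d - 2) + k" "j - 3 = (d - 3) + k"
        using j d by auto
      then show ?thesis
        by (simp add: G1 G2 G3 graph_form_def j power_add power2_eq_square power3_eq_cube algebra_simps)
    qed
    ultimately show ?thesis
      by (intro exI[of _ "\<lambda>w. w $ 2 * G1 w - b * G2 w - c * G3 w"]) blast
  qed
qed

text \<open>Multiplication by \<open>v2^n\<close> lets every monomial of \<open>g\<close> satisfy
  the bound on the exponent of the second variable, so each one comes from the plane.\<close>

lemma form_from_plane:
  assumes d: "d \<ge> 3" and g: "is_form k g" and n: "n \<ge> (d - 1)\<^sup>2" "k + n = d * m"
  obtains G where "is_form m G" "\<And>v. G (param d b c v) = v $ 2 ^ n * g v"
proof -
  obtain e where e: "\<And>v. g v = (\<Sum>i\<le>k. e i * v $ 1 ^ i * v $ 2 ^ (k - i))"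
    using is_form_binary[OF g] by blast
  have "\<exists>G. is_form m G \<and> (\<forall>v. G (param d b c v) = v $ 1 ^ i * (v $ 2 ^ n * v $ 2 ^ (k - i)))"
    if "i \<le> k" for i
    using monomial_from_plane[OF d, of i "n + (k - i)" m b c] that n unfolding power_add by auto
  then obtain G where G: "\<And>i. i \<le> k \<Longrightarrow> is_form m (G i)"
    "\<And>i v. i \<le> k \<Longrightarrow> G i (param d b c v) = v $ 1 ^ i * (v $ 2 ^ n * v $ 2 ^ (k - i))"
    by metis
  show ?thesis
  proof (rule that)
    show "is_form m (\<lambda>w. \<Sum>i\<le>k. e i * G i w)"
      using G(1) by (intro is_form_sum is_form_cmult) auto
    show "(\<Sum>i\<le>k. e i * G i (param d b c v)) = v $ 2 ^ n * g v" for v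
      by (simp add: e G(2) sum_distrib_left mult_ac)
  qed
qed

lemma is_form_divide:
  fixes g :: "complex ^ 2 \<Rightarrow> complex"
  assumes "is_form k g" "g (vector [1, 0]) = 0"
  obtains h where "is_form (k - 1) h" "\<And>v. g v = v $ 2 * h v"
proof -
  obtain e where e: "\<And>v. g v = (\<Sum>i\<le>k. e i * v $ 1 ^ i * v $ 2 ^ (k - i))"
    using is_form_binary[OF assms(1)] by blast
  have "(\<Sum>i\<le>k. e i * 0 ^ (k - i)) = (\<Sum>i\<in>{k}. e i * 0 ^ (k - i))"
    by (rule sum.mono_neutral_right) (auto simp: power_0_left)
  then have "e k = 0"
    using assms(2) by (simp add: e)
  then have *: "g v = (\<Sum>i<k. e i * v $ 1 ^ i * v $ 2 ^ (k - i))" for v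
    by (simp add: e lessThan_Suc_atMost[symmetric])
  show ?thesis
  proof (rule that)
    show "is_form (k - 1) (\<lambda>v :: complex ^ 2. \<Sum>i<k. e i * (v $ 1 ^ i * v $ 2 ^ (k - 1 - i)))"
    proof (rule is_form_sum, rule is_form_cmult)
      fix i assume "i \<in> {..<k}"
      then show "is_form (k - 1) (\<lambda>v. v $ 1 ^ i * v $ (2::2) ^ (k - 1 - i))"
        using is_form_monomial[of i "k - 1 - i" 1 "2::2"] by simp
    qed
    have "v $ 2 ^ (k - i) = v $ 2 * v $ 2 ^ (k - 1 - i)" if "i < k" for i and v :: "complex ^ 2"
      using that by (simp flip: power_Suc add: Suc_diff_Suc)
    then show "g v = v $ 2 * (\<Sum>i<k. e i * (v $ 1 ^ i * v $ 2 ^ (k - 1 - i)))" for v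
      unfolding * sum_distrib_left by (intro sum.cong) (auto simp: mult_ac)
  qed
qed

text \<open>
  With \<open>X = h(1,0)^d P^k\<close> and \<open>Y = X - h^d\<close>, where \<open>P\<close> is the second coordinate of the
  parametrization, \<open>h\<close> divides \<open>X^n - Y^n\<close>; for large \<open>n\<close> the form \<open>Y^n\<close> comes from the plane.
\<close>

lemma denominator_from_plane:
  assumes d: "d \<ge> 3" and h: "is_form k h" "h (vector [1, 0]) \<noteq> 0" and k: "k \<ge> 1"
  obtains j s M D where "is_form j s" "is_form M D" "j + k = d * M" "D cusp \<noteq> 0"
    "\<And>v. D (param d b c v) = s v * h v"
proof -
  let ?e1 = "vector [1, 0] :: complex ^ 2"
  define e where "e = h ?e1 ^ d"
  \<comment> \<open>\<open>Y\<close> vanishes at \<open>(1,0)\<close>, hence is divisible by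
    \<open>v2\<close>, and \<open>Y^n\<close> by \<open>v2^n\<close>; this exponent lets
    \<open>form_from_plane\<close> apply.\<close>
  define n where "n = (d - 1)\<^sup>2"
  define X where "X v = e * graph_form d b c v ^ k" for v
  define Y where "Y v = X v - h v ^ d" for v
  have n: "n > 0"
    using d by (simp add: n_def)
  have X: "is_form (d * k) X"
    unfolding X_def by (intro is_form_cmult is_form_power is_form_graph_form d)
  have hd: "is_form (d * k) (\<lambda>v. h v ^ d)"
    using is_form_power[OF h(1), of d] by (simp add: mult.commute)
  have Y: "is_form (d * k) Y"
    unfolding Y_def by (intro is_form_diff X hd)
  have "graph_form d b c ?e1 = 1"
    using d by (simp add: graph_form_def power_0_left)
  then have Xe: "X ?e1 = e"
    by (simp add: X_def)
  then have "Y ?e1 = 0"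
    by (simp add: Y_def e_def)
  then obtain Y' where Y': "is_form (d * k - 1) Y'" "\<And>v. Y v = v $ 2 * Y' v"
    using is_form_divide[OF Y] by blast
  have "d * k \<ge> 1"
    using d k by (simp add: Suc_le_eq)
  then have "(d * k - 1) * n + n = d * (k * n)"
    by (metis add.commute le_add_diff_inverse mult.assoc mult_1 add_mult_distrib)
  then obtain G where G: "is_form (k * n) G" "\<And>v. G (param d b c v) = v $ 2 ^ n * Y' v ^ n"
    using form_from_plane[OF d is_form_power[OF Y'(1)], of n n "k * n"] by (auto simp: n_def)
  \<comment> \<open>The cofactor of \<open>X - Y = h^d\<close> in \<open>X^n - Y^n\<close>.\<close>
  define S where "S v = (\<Sum>i<n. Y v ^ (n - Suc i) * X v ^ i)" for v
  have S: "is_form (d * k * (n - 1)) S"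
    unfolding S_def
  proof (rule is_form_sum)
    fix i assume "i \<in> {..<n}"
    then have "d * k * (n - Suc i) + d * k * i = d * k * (n - 1)"
      by (simp flip: add_mult_distrib2)
    then show "is_form (d * k * (n - 1)) (\<lambda>v. Y v ^ (n - Suc i) * X v ^ i)"
      using is_form_mult[OF is_form_power[OF Y] is_form_power[OF X], of "n - Suc i" i] by simp
  qed
  \<comment> \<open>On the parametrized curve the first term becomes \<open>X^n\<close> and
    \<open>G\<close> becomes \<open>Y^n\<close>.\<close>
  define D where "D w = e ^ n * w $ 2 ^ (k * n) - G w" for w :: "complex ^ 3"
  have D_param: "D (param d b c v) = X v ^ n - Y v ^ n" for v
    by (simp add: D_def G X_def Y' power_mult_distrib power_mult)
  show ?thesis
  proof (rule that)
    show "is_form (k * (d - 1) + d * k * (n - 1)) (\<lambda>v. h v ^ (d - 1) * S v)"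
      by (intro is_form_mult is_form_power h S)
    show "is_form (k * n) D"
      unfolding D_def using is_form_power[OF is_form_coord, of "k * n" 2]
      by (intro is_form_diff is_form_cmult G) simp
    have "k * (d - 1) + k = d * k"
      using d by (metis add.commute add_mult_distrib2 le_add_diff_inverse mult.commute mult.right_neutral
          numeral_le_one_iff order_trans one_le_numeral)
    then have "k * (d - 1) + d * k * (n - 1) + k = d * k + d * k * (n - 1)"
      by simp
    also have "\<dots> = d * k * n"
      using n by (metis Suc_pred' mult_Suc_right diff_Suc_1 One_nat_def)
    finally show "k * (d - 1) + d * k * (n - 1) + k = d * (k * n)"
      by simp
    have "D cusp = e ^ n"
      using D_param[of ?e1] n \<open>Y ?e1 = 0\<close> Xe by (simp add: param_e1[OF d] power_0_left)
    then show "D cusp \<noteq> 0"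
      using h(2) by (simp add: e_def)
    show "D (param d b c v) = h v ^ (d - 1) * S v * h v" for v
    proof -
      have "X v ^ n - Y v ^ n = h v ^ d * S v"
        unfolding power_diff_sumr2 S_def by (simp add: Y_def)
      moreover have "h v ^ d = h v ^ (d - 1) * h v"
        using d by (metis power_minus_mult less_le_trans zero_less_numeral)
      ultimately show ?thesis
        by (simp add: D_param)
    qed
  qed
qed

text \<open>Pulled back by \<open>param_inv\<close>, \<open>f\<close> itself need not be regular at
  the cusp. Its difference from the value over the cusp is divisible by \<open>v2\<close>, so the
  power \<open>(d - 1)^2\<close> has a numerator that comes from the plane, and
  \<open>denominator_from_plane\<close> supplies a denominator nonzero at the cusp.\<close>

lemma regular_at_cusp:
  fixes f :: "2 proj \<Rightarrow> complex"
  assumes d: "d \<ge> 3" and f: "regular_fun U f" and U: "point (vector [1, 0]) \<in> U"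
    and V: "V \<subseteq> zeros (curve_form d b c)" "param_inv ` V \<subseteq> U"
  obtains M D where "is_form M D" "D cusp \<noteq> 0"
    "regular_fun (nonzero_locus V D) (\<lambda>q. (f (param_inv q) - f (point (vector [1, 0]))) ^ (d - 1)\<^sup>2)"
proof -
  let ?e1 = "vector [1, 0] :: complex ^ 2"
  define n where "n = (d - 1)\<^sup>2"
  define a where "a = f (point ?e1)"
  obtain l u k g h where u: "is_form l u" "u ?e1 \<noteq> 0" and gh: "is_form k g" "is_form k h"
    and fgh: "\<And>v. v \<noteq> 0 \<Longrightarrow> point v \<in> U \<Longrightarrow> u v \<noteq> 0 \<Longrightarrow> h v \<noteq> 0 \<and> f (point v) = g v / h v"
    using regular_funE[OF f e1_nonzero U] by blast
  have h_e1: "h ?e1 \<noteq> 0" and a: "a = g ?e1 / h ?e1"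
    using fgh[OF e1_nonzero U u(2)] by (auto simp: a_def)
  \<comment> \<open>The factor \<open>v1\<close>, equal to 1 over the cusp, makes both degrees
    positive, as dividing by \<open>v2\<close> and finding a plane denominator require. The factor
    \<open>u\<close> ensures that the fraction represents \<open>f\<close> wherever the new
    denominator is nonzero.\<close>
  have forms: "is_form (k + 1) (\<lambda>v. (g v - a * h v) * v $ 1)" "is_form (k + 1 + l) (\<lambda>v. h v * v $ 1 * u v)"
    by (intro is_form_mult is_form_diff is_form_cmult is_form_coord gh u)+
  have "(g ?e1 - a * h ?e1) * ?e1 $ 1 = 0"
    using h_e1 by (simp add: a)
  then obtain G1 where G1: "is_form k G1" "\<And>v. (g v - a * h v) * v $ 1 = v $ 2 * G1 v"
    using is_form_divide[OF forms(1)] by auto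
  have "h ?e1 * ?e1 $ 1 * u ?e1 \<noteq> 0"
    using h_e1 u(2) by simp
  from this obtain j s M D where s: "is_form j s" "is_form M D" "j + (k + 1 + l) = d * M" "D cusp \<noteq> 0"
    and D: "\<And>v. D (param d b c v) = s v * (h v * v $ 1 * u v)"
    by (rule denominator_from_plane[OF d forms(2)]) (simp, rule that)
  have num: "is_form ((k + l + j) * n) (\<lambda>v. (G1 v * u v * s v) ^ n)"
    by (intro is_form_power is_form_mult G1 u s)
  have deg: "(k + l + j) * n + n = d * (M * n)"
    using s(3) by (metis (no_types, opaque_lifting) add.assoc add.commute add_mult_distrib mult.assoc mult_1)
  have "n \<ge> (d - 1)\<^sup>2"
    by (simp add: n_def)
  then obtain N where N: "is_form (M * n) N"
    "\<And>v. N (param d b c v) = v $ 2 ^ n * (G1 v * u v * s v) ^ n"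
    by (rule form_from_plane[OF d num _ deg]) (rule that)
  have Dn: "is_form (M * n) (\<lambda>w. D w ^ n)"
    by (intro is_form_power s)
  have main: "(f (param_inv (point w)) - a) ^ n = N w / D w ^ n"
    if w: "w \<noteq> 0" "point w \<in> V" "D w \<noteq> 0" for w
  proof -
    obtain v where v: "v \<noteq> 0" "param_inv (point w) = point v"
      by (rule point_cases)
    then have pw: "point (param d b c v) = point w"
      using param_map_inv[OF d, of "point w"] V(1) w(2) d by (auto simp: param_map_point)
    have nz: "D (param d b c v) \<noteq> 0"
      using is_form_zero_iff[OF s(2) param_nonzero[OF d v(1)] w(1) pw] w(3) by simp
    then have "u v \<noteq> 0" "h v \<noteq> 0" "v $ 1 \<noteq> 0" "s v \<noteq> 0"
      by (auto simp: D)
    moreover have "point v \<in> U"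
      using V(2) w(2) v(2) by (metis image_subset_iff)
    ultimately have "f (point v) - a = v $ 2 * G1 v * u v * s v / D (param d b c v)"
      using fgh[OF v(1)] G1(2)[of v] unfolding D by (simp add: field_simps)
    then have "(f (point v) - a) ^ n = N (param d b c v) / D (param d b c v) ^ n"
      by (simp add: N power_divide power_mult_distrib mult_ac)
    also have "\<dots> = N w / D w ^ n"
      by (rule is_form_quotient_eq[OF N(1) Dn param_nonzero[OF d v(1)] w(1) pw])
    finally show ?thesis
      by (simp add: v(2))
  qed
  show ?thesis
  proof (rule that[OF s(2,4)], rule regular_funI)
    fix v assume "v \<noteq> 0" "point v \<in> nonzero_locus V D"
    show "\<exists>l u k g h. is_form l u \<and> u v \<noteq> 0 \<and> is_form k g \<and> is_form k h \<and>
        (\<forall>w. w \<noteq> 0 \<and> point w \<in> nonzero_locus V D \<and> u w \<noteq> 0 \<longrightarrow>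
          h w \<noteq> 0 \<and> (f (param_inv (point w)) - f (point ?e1)) ^ (d - 1)\<^sup>2 = g w / h w)"
    proof (intro exI conjI)
      show "is_form 0 (\<lambda>_. 1)" "(1::complex) \<noteq> 0"
        by (auto simp: is_form_const)
      show "\<forall>w. w \<noteq> 0 \<and> point w \<in> nonzero_locus V D \<and> (1::complex) \<noteq> 0 \<longrightarrow>
          D w ^ n \<noteq> 0 \<and> (f (param_inv (point w)) - f (point ?e1)) ^ (d - 1)\<^sup>2 = N w / D w ^ n"
        unfolding a_def[symmetric] n_def[symmetric] using main
        by (auto simp: point_in_nonzero_locus_iff[OF s(2)])
    qed (rule N Dn)+
  qed
qed

text \<open>The charts \<open>z \<noteq> 0\<close> and \<open>y \<noteq> 0\<close> cover the curve,
  since \<open>z = 0\<close> forces \<open>x = 0\<close>. Over the first, the parametrization has a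
  regular inverse and \<open>f\<close> satisfies an equation of degree 1. Over the second,
  \<open>f\<close> is a root of \<open>(T - e)^n - F\<close>, where \<open>e\<close> is its value
  over the cusp and \<open>F\<close> the regular power.\<close>

lemma finite_map_param_map:
  assumes d: "d \<ge> 3"
  shows "finite_map UNIV (zeros (curve_form d b c)) (param_map d b c)"
  unfolding finite_map_def
proof (intro conjI ballI regular_map_param_map[OF d])
  let ?C = "zeros (curve_form d b c)" and ?e1 = "vector [1, 0] :: complex ^ 2"
  fix q assume q: "q \<in> ?C"
  obtain w where w: "w \<noteq> 0" "q = point w"
    by (rule point_cases)
  have in_C: "param_map d b c p \<in> ?C" for p
    using regular_map_param_map[OF d, of b c] unfolding regular_map_def by blast
  have preimage: "nonzero_locus UNIV (\<lambda>v. param d b c v $ i) =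
      {p \<in> UNIV. param_map d b c p \<in> nonzero_locus ?C (\<lambda>w. w $ i)}" for i
  proof (rule set_eqI)
    fix p :: "2 proj"
    obtain v where v: "v \<noteq> 0" "p = point v"
      by (rule point_cases)
    then show "p \<in> nonzero_locus UNIV (\<lambda>v. param d b c v $ i) \<longleftrightarrow>
        p \<in> {p \<in> UNIV. param_map d b c p \<in> nonzero_locus ?C (\<lambda>w. w $ i)}"
      using in_C[of p] point_in_nonzero_locus_iff[OF is_form_coord param_nonzero[OF d v(1)]]
        point_in_nonzero_locus_iff[OF is_form_param[OF d] v(1)] param_map_point[OF d v(1)]
      by auto
  qed
  have affine: "principal_affine UNIV (nonzero_locus UNIV (\<lambda>v. param d b c v $ i))"
    "principal_affine ?C (nonzero_locus ?C (\<lambda>w. w $ i))" for i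
    using principal_affine_nonzero_locus[OF is_form_param[OF d]]
      principal_affine_nonzero_locus[OF is_form_coord] d by auto
  show "\<exists>V U. principal_affine ?C V \<and> q \<in> V \<and> principal_affine UNIV U \<and>
      U = {p \<in> UNIV. param_map d b c p \<in> V} \<and>
      (\<forall>f. regular_fun U f \<longrightarrow> (\<exists>n a. n > 0 \<and> (\<forall>i<n. regular_fun V (a i)) \<and>
        (\<forall>p\<in>U. f p ^ n + (\<Sum>i<n. a i (param_map d b c p) * f p ^ i) = 0)))"
  proof (cases "w $ 3 = 0")
    case False
    let ?V = "nonzero_locus ?C (\<lambda>w. w $ 3)"
    let ?U = "nonzero_locus UNIV (\<lambda>v. param d b c v $ 3)"
    have "q \<in> ?V"
      using False w q by (simp add: point_in_nonzero_locus_iff[OF is_form_coord])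
    have inv: "param_inv ` ?V \<subseteq> ?U"
      unfolding preimage using param_map_inv[OF d] by (force simp: nonzero_locus_def)
    have "\<exists>n a. n > 0 \<and> (\<forall>i<n. regular_fun ?V (a i)) \<and>
        (\<forall>p\<in>?U. f p ^ n + (\<Sum>i<n. a i (param_map d b c p) * f p ^ i) = 0)"
      if f: "regular_fun ?U f" for f
    proof (intro exI conjI)
      show "(1::nat) > 0"
        by simp
      have "regular_map ?V ?U param_inv"
        by (rule regular_map_param_inv[OF _ inv]) (auto simp: nonzero_locus_def)
      then have "regular_fun ?V (\<lambda>q. 0 - f (param_inv q))"
        by (intro regular_fun_diff regular_fun_const regular_fun_compose[OF f])
      then show "\<forall>i<1. regular_fun ?V ((\<lambda>i q. 0 - f (param_inv q)) i)" for i :: nat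
        by blast
      show "\<forall>p\<in>?U. f p ^ 1 + (\<Sum>i<1. (\<lambda>i q. 0 - f (param_inv q)) i (param_map d b c p) * f p ^ i) = 0"
        by (simp add: param_inv_map[OF d])
    qed
    with affine[of 3] \<open>q \<in> ?V\<close> preimage[of 3] show ?thesis
      by blast
  next
    case True
    let ?V = "nonzero_locus ?C (\<lambda>w. w $ 2)"
    let ?U = "nonzero_locus UNIV (\<lambda>v. param d b c v $ 2)"
    have F: "mpeval (curve_form d b c) w = 0"
      using q w point_in_curve_iff[OF d] by blast
    then have "w $ 1 = 0"
      using True d by (simp add: mpeval_curve_form power_0_left)
    then have "w $ 2 \<noteq> 0"
      using w(1) True by (simp add: vec3_eq_iff)
    then have "q \<in> ?V"
      using w q by (simp add: point_in_nonzero_locus_iff[OF is_form_coord])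
    have inv: "param_inv ` ?V \<subseteq> ?U"
      unfolding preimage using param_map_inv[OF d] by (force simp: nonzero_locus_def)
    have e1: "point ?e1 \<in> ?U"
      using d by (simp add: point_in_nonzero_locus_iff[OF is_form_param[OF d] e1_nonzero] param_e1
          del: param_nth)
    have "\<exists>n a. n > 0 \<and> (\<forall>i<n. regular_fun ?V (a i)) \<and>
        (\<forall>p\<in>?U. f p ^ n + (\<Sum>i<n. a i (param_map d b c p) * f p ^ i) = 0)"
      if f: "regular_fun ?U f" for f
    proof -
      define n where "n = (d - 1)\<^sup>2"
      define e where "e = f (point ?e1)"
      define F where "F q = (f (param_inv q) - e) ^ n" for q
      \<comment> \<open>The coefficients of \<open>(T - e)^n - F\<close> below the leading one:
        constants from the binomial theorem, with \<open>F\<close> entering only for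
        \<open>i = 0\<close>.\<close>
      define a where "a i q = of_nat (n choose i) * (- e) ^ (n - i) - (if i = 0 then F q else 0)" for i q
      obtain M D where D: "is_form M D" "D cusp \<noteq> 0" "regular_fun (nonzero_locus ?V D) F"
        using regular_at_cusp[OF d f e1 _ inv, of b c] unfolding F_def n_def e_def
        by (auto simp: nonzero_locus_def)
      \<comment> \<open>At the cusp the denominator \<open>D\<close> is available; at all other
        points of the chart \<open>z\<close> is nonzero and \<open>param_inv\<close> is
        regular.\<close>
      have "regular_fun ?V F"
      proof (rule regular_fun_local)
        fix v :: "complex ^ 3" assume v: "v \<noteq> 0" "point v \<in> ?V"
        show "\<exists>l u. is_form l u \<and> u v \<noteq> 0 \<and> regular_fun (nonzero_locus ?V u) F"
        proof (cases "v $ 3 = 0")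
          case True
          have "point v \<in> ?C"
            using v by (auto simp: nonzero_locus_def)
          then have "mpeval (curve_form d b c) v = 0"
            using v(1) point_in_curve_iff[OF d] by blast
          then have "v $ 1 = 0"
            using True d by (simp add: mpeval_curve_form power_0_left)
          then have "v = (v $ 2) *s cusp" "v $ 2 \<noteq> 0"
            using True v(1) by (auto simp: vec3_eq_iff)
          then have "point cusp = point v"
            using point_scale[OF cusp_nonzero] by metis
          then have "D v \<noteq> 0"
            using D(2) is_form_zero_iff[OF D(1) cusp_nonzero v(1)] by simp
          then show ?thesis
            using D by blast
        next
          case False
          let ?V3 = "nonzero_locus ?V (\<lambda>w. w $ 3)"
          have "regular_map ?V3 ?U param_inv"
            by (rule regular_map_param_inv) (use inv in \<open>force simp: nonzero_locus_def\<close>)+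
          then have "regular_fun ?V3 F"
            unfolding F_def
            by (intro regular_fun_power regular_fun_diff regular_fun_const regular_fun_compose[OF f])
          then show ?thesis
            using False is_form_coord by blast
        qed
      qed
      then have "regular_fun ?V (a i)" for i
        unfolding a_def by (cases "i = 0") (auto intro: regular_fun_diff regular_fun_const)
      moreover have "f p ^ n + (\<Sum>i<n. a i (param_map d b c p) * f p ^ i) = 0" for p
      proof -
        have n: "n > 0"
          using d by (simp add: n_def)
        have "(f p - e) ^ n = (\<Sum>i\<le>n. of_nat (n choose i) * f p ^ i * (- e) ^ (n - i))"
          using binomial_ring[of "f p" "- e" n] by simp
        also have "\<dots> = f p ^ n + (\<Sum>i<n. of_nat (n choose i) * f p ^ i * (- e) ^ (n - i))"
          by (simp add: lessThan_Suc_atMost[symmetric])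
        finally have A: "f p ^ n + (\<Sum>i<n. of_nat (n choose i) * f p ^ i * (- e) ^ (n - i)) =
            F (param_map d b c p)"
          by (simp add: F_def param_inv_map[OF d])
        have B: "(\<Sum>i<n. (if i = 0 then F (param_map d b c p) else 0) * f p ^ i) =
            F (param_map d b c p)"
          using n by (simp add: if_distrib[of "\<lambda>x. x * _"] cong: if_cong)
        have C: "(\<Sum>i<n. a i (param_map d b c p) * f p ^ i) =
            (\<Sum>i<n. of_nat (n choose i) * f p ^ i * (- e) ^ (n - i)) -
            (\<Sum>i<n. (if i = 0 then F (param_map d b c p) else 0) * f p ^ i)"
          unfolding sum_subtractf[symmetric] by (intro sum.cong refl) (simp add: a_def algebra_simps)
        show ?thesis
          unfolding C B add_diff_eq A by simp
      qed
      moreover have "n > 0"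
        using d by (simp add: n_def)
      ultimately show ?thesis
        by blast
    qed
    with affine[of 2] \<open>q \<in> ?V\<close> preimage[of 2] show ?thesis
      by blast
  qed
qed

lemma rational_curve_curve_form:
  assumes "d \<ge> 3"
  shows "rational_curve (zeros (curve_form d b c))"
  unfolding rational_curve_def is_normalization_def
  using normal_variety_proj_line finite_map_param_map[OF assms] birational_map_param_map[OF assms]
  by blast

lemma rational_unicuspidal_curve_curve_form:
  assumes "d \<ge> 3"
  shows "rational_unicuspidal_curve d (zeros (curve_form d b c))"
  unfolding rational_unicuspidal_curve_def
  using assms homogeneous_curve_form irreducible_curve_form rational_curve_curve_form
    unicuspidal_curve_form by blast

section \<open>Isomorphisms between the curves\<close>

subsection \<open>Points of the curve\<close>

abbreviation affine_point :: "nat \<Rightarrow> complex \<Rightarrow> complex \<Rightarrow> complex \<Rightarrow> complex ^ 3" where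
  "affine_point d b c t \<equiv> param d b c (vector [t, 1])"

text \<open>The point with affine parameter \<open>1/t\<close>, or the cusp for \<open>t = 0\<close>.\<close>

abbreviation cusp_point :: "nat \<Rightarrow> complex \<Rightarrow> complex \<Rightarrow> complex \<Rightarrow> complex ^ 3" where
  "cusp_point d b c t \<equiv> param d b c (vector [1, t])"

text \<open>The coordinate \<open>y\<close> in the parameter at the cusp. Its constant term makes it
  a local unit; its zero linear coefficient reflects the missing \<open>x^(d-1)\<close>
  term.\<close>

definition cusp_poly :: "complex \<Rightarrow> complex \<Rightarrow> complex poly" where
  "cusp_poly b c = [:1, 0, b, c:]"

lemma vec2_nonzero: "vector [t, 1] \<noteq> (0 :: complex ^ 2)" "vector [1, t] \<noteq> (0 :: complex ^ 2)"
  by (simp_all add: vec2_eq_iff)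

lemma cusp_point_nth:
  "cusp_point d b c t $ 1 = t ^ (d - 1)" "cusp_point d b c t $ 2 = poly (cusp_poly b c) t"
  "cusp_point d b c t $ 3 = t ^ d"
  by (simp_all add: graph_form_def cusp_poly_def algebra_simps power2_eq_square power3_eq_cube)

lemma affine_point_poly:
  "affine_point d b c = (\<lambda>t. \<chi> i. poly (if i = 1 then [:0, 1:] else
     if i = 2 then monom 1 d + monom b (d - 2) + monom c (d - 3) else 1) t)"
  by (auto simp: vec3_eq_iff graph_form_def poly_monom fun_eq_iff)

lemma cusp_point_poly:
  "cusp_point d b c = (\<lambda>t. \<chi> i. poly (if i = 1 then monom 1 (d - 1) else
     if i = 2 then cusp_poly b c else monom 1 d) t)"
  by (auto simp: vec3_eq_iff cusp_point_nth poly_monom fun_eq_iff simp del: param_nth)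

lemma point_cusp_point:
  assumes "d \<ge> 3" "t \<noteq> 0"
  shows "point (cusp_point d b c t) = point (affine_point d b c (1 / t))"
proof -
  have "t * (1 / t) = 1"
    using assms by simp
  then have "vector [1, t] = t *s (vector [1 / t, 1] :: complex ^ 2)"
    by (simp add: vec2_eq_iff)
  then have "point (vector [1, t]) = point (vector [1 / t, 1] :: complex ^ 2)"
    using point_scale[OF vec2_nonzero(1) assms(2)] by simp
  then show ?thesis
    using param_map_point[OF assms(1) vec2_nonzero(2)] param_map_point[OF assms(1) vec2_nonzero(1)]
    by metis
qed

lemma curve_point_affine:
  assumes "d \<ge> 3" "w \<noteq> 0" "point w \<in> zeros (curve_form d b c)" "w $ 3 \<noteq> 0"
  shows "point w = point (affine_point d b c (w $ 1 / w $ 3))"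
proof -
  have "vector [w $ 1, w $ 3] = w $ 3 *s (vector [w $ 1 / w $ 3, 1] :: complex ^ 2)"
    using assms(4) by (simp add: vec2_eq_iff)
  then have "param_inv (point w) = point (vector [w $ 1 / w $ 3, 1])"
    using assms(2,4) point_scale[OF vec2_nonzero(1) assms(4)] by (simp add: param_inv_point)
  then show ?thesis
    using param_map_inv[OF assms(1,3)] param_map_point[OF assms(1) vec2_nonzero(1)] by metis
qed

lemma curve_point_cusp:
  assumes "d \<ge> 3" "w \<noteq> 0" "point w \<in> zeros (curve_form d b c)" "w $ 3 = 0"
  shows "point w = point cusp"
proof -
  have "param_inv (point w) = point (vector [1, 0])"
    using assms(2,4) by (simp add: param_inv_point)
  then show ?thesis
    using param_map_inv[OF assms(1,3)] param_map_point[OF assms(1) e1_nonzero] param_e1[OF assms(1)]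
    by metis
qed

lemma affine_point_inj:
  assumes "d \<ge> 3" "point (affine_point d b c s) = point (affine_point d b c t)"
  shows "s = t"
proof -
  obtain a where "affine_point d b c t = a *s affine_point d b c s"
    using assms point_eq_iff[OF param_nonzero param_nonzero] vec2_nonzero by metis
  from arg_cong[OF this, of "\<lambda>w. w $ 1"] arg_cong[OF this, of "\<lambda>w. w $ 3"] show ?thesis
    by simp
qed

lemma affine_point_neq_cusp:
  assumes "d \<ge> 3"
  shows "point (affine_point d b c t) \<noteq> point cusp"
proof
  assume "point (affine_point d b c t) = point cusp"
  then have "affine_point d b c t $ 3 = 0 \<longleftrightarrow> cusp $ 3 = 0"
    using is_form_zero_iff[OF is_form_coord[of 3] param_nonzero[OF assms vec2_nonzero(1)] cusp_nonzero]
    by blast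
  then show False
    by simp
qed

lemma affine_point_in_curve:
  "d \<ge> 3 \<Longrightarrow> point (affine_point d b c t) \<in> zeros (curve_form d b c)"
  and cusp_point_in_curve:
  "d \<ge> 3 \<Longrightarrow> point (cusp_point d b c t) \<in> zeros (curve_form d b c)"
  by (simp_all add: param_in_curve vec2_nonzero)

lemma cusp_point_0: "d \<ge> 3 \<Longrightarrow> cusp_point d b c 0 = cusp"
  by (rule param_e1)

lemma cusp_in_curve: "d \<ge> 3 \<Longrightarrow> point cusp \<in> zeros (curve_form d b c)"
  using cusp_point_in_curve[of d b c 0] by (simp add: cusp_point_0)


subsection \<open>The local ring of the cusp\<close>

lemma monom_dvd_cancel:
  fixes q :: "complex poly"
  assumes "monom 1 n dvd q * p" "poly q 0 \<noteq> 0"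
  shows "monom 1 n dvd p"
  using assms(1)
proof (induction n arbitrary: p)
  case 0
  then show ?case
    by (simp add: monom_0 flip: one_pCons)
next
  case (Suc n)
  from Suc.prems obtain r where r: "q * p = monom 1 (Suc n) * r" ..
  have "poly q 0 * poly p 0 = 0"
    using arg_cong[OF r, of "\<lambda>p. poly p 0"] by (simp add: poly_monom)
  then have "[:0, 1:] dvd p"
    using assms(2) by (simp add: dvd_iff_poly_eq_0)
  then obtain p' where p': "p = [:0, 1:] * p'" ..
  have "[:0, 1:] * (q * p') = [:0, 1:] * (monom 1 n * r)"
    using r by (simp add: p' monom_Suc)
  then have "q * p' = monom 1 n * r"
    by (simp only: mult_cancel_left) simp
  then have "monom 1 n dvd q * p'"
    by simp
  then have "monom 1 n dvd p'"
    by (rule Suc.IH)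
  then have "[:0, 1:] * monom 1 n dvd [:0, 1:] * p'"
    by (rule mult_dvd_mono[OF dvd_refl])
  then show ?case
    by (simp add: p' monom_Suc)
qed

text \<open>
  Modulo \<open>t^(2 d - 2)\<close> a form on the curve is a power of \<open>y\<close> times a linear form, because \<open>x / y\<close> and
  \<open>z / y\<close> vanish to order at least \<open>d - 1\<close>.
\<close>

lemma form_at_cusp:
  fixes g :: "complex ^ 3 \<Rightarrow> complex"
  assumes d: "d \<ge> 3" and g: "is_form k g"
  obtains p g0 g1 g2 where "\<And>t. g (cusp_point d b c t) = poly p t"
    "monom 1 (2 * d - 2) dvd p * cusp_poly b c -
       cusp_poly b c ^ k * (smult g0 (cusp_poly b c) + monom g1 (d - 1) + monom g2 d)"
proof -
  define Q where "Q = cusp_poly b c"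
  \<comment> \<open>The restriction \<open>p\<close> should be \<open>Q^(k-1)\<close> times a linear
    form; multiplying by \<open>Q\<close> gives \<open>Q^k\<close>, which also makes sense for
    \<open>k = 0\<close>.\<close>
  define T where "T f \<longleftrightarrow> (\<exists>p g0 g1 g2. (\<forall>t. f (cusp_point d b c t) = poly p t) \<and>
    monom 1 (2 * d - 2) dvd p * Q - Q ^ k * (smult g0 Q + monom g1 (d - 1) + monom g2 d))"
    for f :: "complex ^ 3 \<Rightarrow> complex"
  have zero: "T (\<lambda>_. 0)"
    unfolding T_def by (intro exI[of _ 0]) simp
  have add: "T (\<lambda>w. f w + f' w)" if f: "T f" and f': "T f'" for f f'
  proof -
    obtain p g0 g1 g2 where p: "\<forall>t. f (cusp_point d b c t) = poly p t"
      "monom 1 (2 * d - 2) dvd p * Q - Q ^ k * (smult g0 Q + monom g1 (d - 1) + monom g2 d)"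
      using f unfolding T_def by blast
    obtain p' g0' g1' g2' where p': "\<forall>t. f' (cusp_point d b c t) = poly p' t"
      "monom 1 (2 * d - 2) dvd p' * Q - Q ^ k * (smult g0' Q + monom g1' (d - 1) + monom g2' d)"
      using f' unfolding T_def by blast
    have "(p + p') * Q - Q ^ k * (smult (g0 + g0') Q + monom (g1 + g1') (d - 1) + monom (g2 + g2') d) =
        (p * Q - Q ^ k * (smult g0 Q + monom g1 (d - 1) + monom g2 d)) +
        (p' * Q - Q ^ k * (smult g0' Q + monom g1' (d - 1) + monom g2' d))"
      by (simp add: algebra_simps smult_add_left flip: add_monom)
    then have "monom 1 (2 * d - 2) dvd (p + p') * Q -
        Q ^ k * (smult (g0 + g0') Q + monom (g1 + g1') (d - 1) + monom (g2 + g2') d)"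
      using p(2) p'(2) by (simp only: dvd_add)
    moreover have "\<forall>t. f (cusp_point d b c t) + f' (cusp_point d b c t) = poly (p + p') t"
      using p(1) p'(1) by simp
    ultimately show ?thesis
      unfolding T_def by blast
  qed
  have monomial: "T (\<lambda>w. e * (\<Prod>i\<in>UNIV. w $ i ^ Poly_Mapping.lookup m i))"
    if m: "(\<Sum>i\<in>UNIV. Poly_Mapping.lookup m i) = k" for e and m :: "3 \<Rightarrow>\<^sub>0 nat"
  proof -
    define i j l where "i = Poly_Mapping.lookup m 1" and "j = Poly_Mapping.lookup m 2"
      and "l = Poly_Mapping.lookup m 3"
    have k: "k = i + j + l"
      using m by (simp add: sum_3 i_def j_def l_def)
    define p where "p = smult e (monom 1 ((d - 1) * i + d * l) * Q ^ j)"
    have p: "\<forall>t. e * (\<Prod>i\<in>UNIV. cusp_point d b c t $ i ^ Poly_Mapping.lookup m i) = poly p t"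
      unfolding UNIV_3
      by (simp add: p_def Q_def cusp_point_nth poly_monom power_add mult_ac
          flip: i_def j_def l_def power_mult del: param_nth)
    have monom_e: "monom e n = smult e (monom 1 n)" for n
      by (simp add: smult_monom)
    \<comment> \<open>Monomials with at most one factor among \<open>x\<close> and \<open>z\<close>
      give the three terms of the linear form; two such factors already have order at least
      \<open>2 d - 2\<close>.\<close>
    consider "i = 0 \<and> l = 0" | "i = 1 \<and> l = 0" | "i = 0 \<and> l = 1" | "i + l \<ge> 2"
      by linarith
    then have "\<exists>g0 g1 g2. monom 1 (2 * d - 2) dvd
        p * Q - Q ^ k * (smult g0 Q + monom g1 (d - 1) + monom g2 d)"
    proof cases
      case 1
      then show ?thesis
        by (intro exI[of _ e] exI[of _ 0] exI[of _ 0]) (simp add: p_def k monom_0 mult_ac flip: one_pCons)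
    next
      case 2
      then have "p * Q = Q ^ k * (smult 0 Q + monom e (d - 1) + monom 0 d)"
        by (simp add: p_def k mult_ac monom_e)
      then show ?thesis
        by (metis diff_self dvd_0_right)
    next
      case 3
      then have "p * Q = Q ^ k * (smult 0 Q + monom 0 (d - 1) + monom e d)"
        by (simp add: p_def k mult_ac monom_e)
      then show ?thesis
        by (metis diff_self dvd_0_right)
    next
      case 4
      have "(d - 1) * 2 \<le> (d - 1) * (i + l)"
        using 4 by (rule mult_le_mono2)
      also have "\<dots> \<le> (d - 1) * i + d * l"
        by (simp add: add_mult_distrib2)
      finally obtain r where r: "(d - 1) * i + d * l = (2 * d - 2) + r"
        using le_Suc_ex by (metis diff_mult_distrib mult.commute mult_1)
      have "p = smult e (monom 1 (2 * d - 2) * monom 1 r * Q ^ j)"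
        unfolding p_def r by (simp add: mult_monom)
      then have "p * Q - Q ^ k * (smult 0 Q + monom 0 (d - 1) + monom 0 d) =
          monom 1 (2 * d - 2) * smult e (monom 1 r * Q ^ j * Q)"
        by (simp add: mult_ac)
      then show ?thesis
        by (metis dvd_triv_left)
    qed
    then show ?thesis
      using p unfolding T_def by blast
  qed
  obtain S a where S: "finite S" "\<And>m. m \<in> S \<Longrightarrow> (\<Sum>i\<in>UNIV. Poly_Mapping.lookup m i) = k"
    and g: "g = (\<lambda>v. \<Sum>m\<in>S. a m * (\<Prod>i\<in>UNIV. v $ i ^ Poly_Mapping.lookup m i))"
    by (rule is_form_expand[OF g]) (rule that)
  have "T (\<lambda>v. \<Sum>m\<in>S. a m * (\<Prod>i\<in>UNIV. v $ i ^ Poly_Mapping.lookup m i))"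
    using S
  proof (induction S rule: finite_induct)
    case empty
    then show ?case
      using zero by simp
  next
    case (insert m S)
    then show ?case
      using add[OF monomial[of m "a m"], of "\<lambda>v. \<Sum>m\<in>S. a m * (\<Prod>i\<in>UNIV. v $ i ^ Poly_Mapping.lookup m i)"]
      by simp
  qed
  then show ?thesis
    using that unfolding g T_def Q_def by blast
qed


subsection \<open>Isomorphisms preserve the cusp\<close>

lemma power_quotient_tendsto_unique:
  assumes "((\<lambda>t::complex. t ^ m / t ^ n) \<longlongrightarrow> L) (at 0)" "L \<noteq> 0"
  shows "m = n"
proof -
  have nz: "eventually (\<lambda>t::complex. t \<noteq> 0) (at 0)"
    by (rule eventually_neq_at_within)
  have le: "m \<le> n" if lim: "((\<lambda>t::complex. t ^ m / t ^ n) \<longlongrightarrow> L) (at 0)" and L: "L \<noteq> 0" for m n L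
  proof (rule ccontr)
    assume "\<not> m \<le> n"
    then obtain k where m: "m = n + Suc k"
      using less_imp_Suc_add by (metis add_Suc_right not_le)
    have ev: "eventually (\<lambda>t::complex. t ^ m / t ^ n = t ^ Suc k) (at 0)"
      using nz by eventually_elim (simp add: m power_add)
    have "((\<lambda>t::complex. t ^ Suc k) \<longlongrightarrow> 0 ^ Suc k) (at 0)"
      by (intro tendsto_intros)
    moreover have "((\<lambda>t::complex. t ^ Suc k) \<longlongrightarrow> L) (at 0)"
      using lim unfolding tendsto_cong[OF ev] .
    ultimately have "L = 0 ^ Suc k"
      by (intro tendsto_unique[of "at 0"]) auto
    with L show False
      by simp
  qed
  have "((\<lambda>t::complex. inverse (t ^ m / t ^ n)) \<longlongrightarrow> inverse L) (at 0)"
    by (intro tendsto_inverse assms)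
  then have "n \<le> m"
    using le[of n m "inverse L"] assms(2) by simp
  with le[OF assms] show ?thesis
    by simp
qed

lemma rational_order:
  fixes A B :: "complex poly"
  assumes "A \<noteq> 0" "poly B a \<noteq> 0"
  obtains k L q where "L \<noteq> 0" "((\<lambda>t. (poly A t / poly B t) / (t - a) ^ k) \<longlongrightarrow> L) (at a)"
    "A = [:- a, 1:] ^ k * q" "poly q a \<noteq> 0"
proof -
  obtain k q where q: "A = [:- a, 1:] ^ k * q" "poly q a \<noteq> 0"
    using order_decomp[OF assms(1), of a] by (auto simp: poly_eq_0_iff_dvd)
  have "eventually (\<lambda>t. t \<noteq> a) (at a)"
    by (rule eventually_neq_at_within)
  then have ev: "eventually (\<lambda>t. (poly A t / poly B t) / (t - a) ^ k = poly q t / poly B t) (at a)"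
    by eventually_elim (simp add: q)
  have "((\<lambda>t. poly q t / poly B t) \<longlongrightarrow> poly q a / poly B a) (at a)"
    using assms(2) by (intro tendsto_intros)
  then have "((\<lambda>t. (poly A t / poly B t) / (t - a) ^ k) \<longlongrightarrow> poly q a / poly B a) (at a)"
    unfolding tendsto_cong[OF ev] .
  then show ?thesis
    using that[of "poly q a / poly B a" k q] assms(2) q by auto
qed

text \<open>Orders multiply under composition: \<open>R\<close> behaves like
  \<open>L (t - a)^k\<close> near \<open>a\<close> and \<open>S - a\<close> like
  \<open>M t^m\<close> near 0.\<close>

lemma order_compose:
  fixes R S :: "complex \<Rightarrow> complex"
  assumes R: "((\<lambda>t. R t / (t - a) ^ k) \<longlongrightarrow> L) (at a)"
    and S: "(S \<longlongrightarrow> a) (at 0)" "eventually (\<lambda>t. S t \<noteq> a) (at 0)"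
    and M: "((\<lambda>t. (S t - a) / t ^ m) \<longlongrightarrow> M) (at 0)"
  shows "((\<lambda>t. R (S t) / t ^ (m * k)) \<longlongrightarrow> L * M ^ k) (at 0)"
proof -
  have "filterlim S (at a) (at 0)"
    using S by (simp add: filterlim_at)
  from filterlim_compose[OF R this]
  have lim: "((\<lambda>t. R (S t) / (S t - a) ^ k * ((S t - a) / t ^ m) ^ k) \<longlongrightarrow> L * M ^ k) (at 0)"
    by (intro tendsto_intros M) simp
  have ev: "eventually (\<lambda>t. R (S t) / (S t - a) ^ k * ((S t - a) / t ^ m) ^ k =
      R (S t) / t ^ (m * k)) (at 0)"
    using S(2) by eventually_elim (simp add: power_divide power_mult)
  show ?thesis
    using lim unfolding tendsto_cong[OF ev] .
qed

lemma eventually_poly_nonzero: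
  assumes "poly E a \<noteq> (0 :: complex)"
  shows "eventually (\<lambda>t. poly E t \<noteq> 0) (at a)"
proof -
  have "((\<lambda>t. poly E t) \<longlongrightarrow> poly E a) (at a)"
    by (intro tendsto_intros)
  then show ?thesis
    using assms by (rule tendsto_imp_eventually_ne)
qed

lemma coeff_mult_1: "coeff (p * q) (Suc 0) = coeff p 0 * coeff q (Suc 0) + coeff p (Suc 0) * coeff q 0"
  by (simp add: coeff_mult)

text \<open>The coordinates \<open>x\<close> and \<open>z\<close> have order at least
  \<open>d - 1\<close>, hence at least 2, and \<open>y\<close> has no linear term. This is how the
  singularity of the cusp is detected.\<close>

lemma form_at_cusp_coeff_1:
  assumes d: "d \<ge> 3" and "is_form k g" "\<And>t. g (cusp_point d b c t) = poly p t"
  shows "coeff p 1 = 0"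
proof -
  let ?Q = "cusp_poly b c"
  obtain p' g0 g1 g2 where p': "\<And>t. g (cusp_point d b c t) = poly p' t"
    and dvd: "monom 1 (2 * d - 2) dvd p' * ?Q - ?Q ^ k * (smult g0 ?Q + monom g1 (d - 1) + monom g2 d)"
    by (rule form_at_cusp[OF d assms(2)]) (rule that)
  have "p' = p"
    using p' assms(3) by (intro poly_eqI_degree_lead_coeff poly_ext) auto
  have Q: "coeff ?Q 0 = 1" "coeff ?Q (Suc 0) = 0"
    by (simp_all add: cusp_poly_def)
  have "coeff (?Q ^ k) (Suc 0) = 0"
    by (induction k) (auto simp: coeff_mult_1 Q)
  moreover have "coeff (p' * ?Q - ?Q ^ k * (smult g0 ?Q + monom g1 (d - 1) + monom g2 d)) (Suc 0) = 0"
    using dvd d unfolding monom_1_dvd_iff' by simp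
  ultimately show ?thesis
    using d \<open>p' = p\<close> by (simp add: coeff_mult_1 Q)
qed

text \<open>If the image of the cusp were affine with parameter \<open>t0\<close>, the map would
  read \<open>t \<mapsto> S t\<close> there, with \<open>S - t0\<close> of some order
  \<open>m\<close>. Since \<open>\<psi>\<close> inverts it, \<open>x / y\<close> and
  \<open>z / y\<close>, of orders \<open>d - 1\<close> and \<open>d\<close> in \<open>t\<close>, are
  rational functions of \<open>S\<close>, so \<open>m\<close> divides both and equals 1. But the
  linear term of \<open>S - t0\<close> vanishes.\<close>

lemma isomorphism_cusp:
  assumes d: "d \<ge> 3"
    and \<phi>: "regular_map (zeros (curve_form d b1 c1)) (zeros (curve_form d b2 c2)) \<phi>"
    and \<psi>: "regular_map (zeros (curve_form d b2 c2)) (zeros (curve_form d b1 c1)) \<psi>"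
    and inv: "\<And>p. p \<in> zeros (curve_form d b1 c1) \<Longrightarrow> \<psi> (\<phi> p) = p"
  shows "\<phi> (point cusp) = point cusp"
proof (rule ccontr)
  assume not_cusp: "\<phi> (point cusp) \<noteq> point cusp"
  let ?C1 = "zeros (curve_form d b1 c1)" and ?C2 = "zeros (curve_form d b2 c2)"
  let ?Q = "cusp_poly b1 c1"
  have \<phi>_in: "\<phi> p \<in> ?C2" if "p \<in> ?C1" for p
    using \<phi> that by (auto simp: regular_map_def)
  obtain l u k and g :: "3 \<Rightarrow> complex ^ 3 \<Rightarrow> complex" and E and G :: "3 \<Rightarrow> complex poly"
    where u: "is_form l u" "u (cusp_point d b1 c1 0) \<noteq> 0" and g: "\<forall>i. is_form k (g i)"
      and E: "\<forall>t. u (cusp_point d b1 c1 t) = poly E t" and gG: "\<forall>i t. g i (cusp_point d b1 c1 t) = poly (G i) t"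
      and *: "\<forall>t. poly E t \<noteq> 0 \<longrightarrow> (\<chi> i. poly (G i) t) \<noteq> 0 \<and>
        \<phi> (point (cusp_point d b1 c1 t)) = point (\<chi> i. poly (G i) t)"
    by (rule regular_map_along_curve[OF cusp_point_poly param_nonzero[OF d vec2_nonzero(2)]
      cusp_point_in_curve[OF d] \<phi>]) (rule that)
  have E0: "poly E 0 \<noteq> 0"
    using u E by metis
  have G30: "poly (G 3) 0 \<noteq> 0"
  proof
    assume "poly (G 3) 0 = 0"
    moreover have "(\<chi> i. poly (G i) 0) \<noteq> 0" "\<phi> (point cusp) = point (\<chi> i. poly (G i) 0)"
      using * E0 cusp_point_0[OF d, of b1 c1] by auto
    ultimately have "\<phi> (point cusp) = point cusp"
      using curve_point_cusp[OF d, of "\<chi> i. poly (G i) 0" b2 c2] \<phi>_in[OF cusp_in_curve[OF d]] by simp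
    with not_cusp show False ..
  qed
  define S where "S t = poly (G 1) t / poly (G 3) t" for t
  have \<phi>_S: "\<phi> (point (cusp_point d b1 c1 t)) = point (affine_point d b2 c2 (S t))"
    if "poly E t \<noteq> 0" "poly (G 3) t \<noteq> 0" for t
    using * that \<phi>_in[OF cusp_point_in_curve[OF d], of t]
      curve_point_affine[OF d, of "\<chi> i. poly (G i) t" b2 c2] by (simp add: S_def)
  define t0 where "t0 = S 0"
  obtain l' u' k' and h :: "3 \<Rightarrow> complex ^ 3 \<Rightarrow> complex" and F and H :: "3 \<Rightarrow> complex poly"
    where u': "is_form l' u'" "u' (affine_point d b2 c2 t0) \<noteq> 0" and "\<forall>i. is_form k' (h i)"
      and F: "\<forall>t. u' (affine_point d b2 c2 t) = poly F t"
      and "\<forall>i t. h i (affine_point d b2 c2 t) = poly (H i) t"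
      and **: "\<forall>t. poly F t \<noteq> 0 \<longrightarrow> (\<chi> i. poly (H i) t) \<noteq> 0 \<and>
        \<psi> (point (affine_point d b2 c2 t)) = point (\<chi> i. poly (H i) t)"
    by (rule regular_map_along_curve[OF affine_point_poly param_nonzero[OF d vec2_nonzero(1)]
      affine_point_in_curve[OF d] \<psi>]) (rule that)
  have F0: "poly F t0 \<noteq> 0"
    using u' F by metis
  \<comment> \<open>\<open>\<psi>\<close> sends the point with parameter \<open>S t\<close> back to
    the original point; dividing by the second coordinate removes the projective scalar.\<close>
  have quot: "poly (H 2) (S t) \<noteq> 0 \<and> poly (H 1) (S t) / poly (H 2) (S t) = t ^ (d - 1) / poly ?Q t \<and>
      poly (H 3) (S t) / poly (H 2) (S t) = t ^ d / poly ?Q t"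
    if "poly E t \<noteq> 0" "poly (G 3) t \<noteq> 0" "poly F (S t) \<noteq> 0" "poly ?Q t \<noteq> 0" for t
  proof -
    let ?H = "\<chi> i. poly (H i) (S t)"
    have "\<psi> (\<phi> (point (cusp_point d b1 c1 t))) = point ?H" and H: "?H \<noteq> 0"
      using ** that \<phi>_S by auto
    then have eq: "point ?H = point (cusp_point d b1 c1 t)"
      using inv[OF cusp_point_in_curve[OF d]] by simp
    have "cusp_point d b1 c1 t $ 2 \<noteq> 0"
      using that(4) by (simp add: cusp_point_nth del: param_nth)
    then show ?thesis
      using is_form_zero_iff[OF is_form_coord H param_nonzero[OF d vec2_nonzero(2)] eq, of 2]
        is_form_quotient_eq[OF is_form_coord is_form_coord H param_nonzero[OF d vec2_nonzero(2)] eq, of 1 2]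
        is_form_quotient_eq[OF is_form_coord is_form_coord H param_nonzero[OF d vec2_nonzero(2)] eq, of 3 2]
      by (simp add: cusp_point_nth del: param_nth)
  qed
  have Q0: "poly ?Q 0 \<noteq> 0"
    by (simp add: cusp_poly_def)
  have S_lim: "(S \<longlongrightarrow> t0) (at 0)"
    unfolding t0_def S_def using G30 by (intro tendsto_intros)
  have "((\<lambda>t. poly F (S t)) \<longlongrightarrow> poly F t0) (at 0)"
    by (intro tendsto_intros S_lim)
  then have "eventually (\<lambda>t. poly F (S t) \<noteq> 0) (at 0)"
    using F0 by (rule tendsto_imp_eventually_ne)
  then have ev: "eventually (\<lambda>t. t \<noteq> 0 \<and> poly E t \<noteq> 0 \<and> poly (G 3) t \<noteq> 0 \<and> poly F (S t) \<noteq> 0 \<and>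
      poly ?Q t \<noteq> 0) (at 0)"
    using eventually_poly_nonzero[OF E0] eventually_poly_nonzero[OF G30] eventually_poly_nonzero[OF Q0]
      eventually_neq_at_within[of 0 0 UNIV] by eventually_elim simp
  then obtain t1 where t1: "t1 \<noteq> 0" "poly E t1 \<noteq> 0" "poly (G 3) t1 \<noteq> 0" "poly F (S t1) \<noteq> 0" "poly ?Q t1 \<noteq> 0"
    using eventually_happens[OF ev] by auto
  have H0: "poly (H 1) t0 = 0" "poly (H 2) t0 \<noteq> 0"
    using quot[of 0] E0 G30 F0 Q0 d by (auto simp: t0_def power_0_left)
  have "H 1 \<noteq> 0" "H 3 \<noteq> 0"
    using quot[OF t1(2-)] t1 by auto
  obtain k1 L1 q1 where L1: "L1 \<noteq> 0" "((\<lambda>t. (poly (H 1) t / poly (H 2) t) / (t - t0) ^ k1) \<longlongrightarrow> L1) (at t0)"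
    using rational_order[OF \<open>H 1 \<noteq> 0\<close> H0(2)] by metis
  obtain k3 L3 q3 where L3: "L3 \<noteq> 0" "((\<lambda>t. (poly (H 3) t / poly (H 2) t) / (t - t0) ^ k3) \<longlongrightarrow> L3) (at t0)"
    using rational_order[OF \<open>H 3 \<noteq> 0\<close> H0(2)] by metis
  have ev_S: "eventually (\<lambda>t. S t \<noteq> t0) (at 0)"
    using ev
  proof eventually_elim
    case (elim t)
    then have "poly (H 1) (S t) \<noteq> 0"
      using quot[of t] by auto
    with H0(1) show ?case
      by auto
  qed
  \<comment> \<open>The numerator of \<open>S - t0\<close>. It combines restrictions of plane forms,
    so its linear coefficient is 0.\<close>
  define N where "N = G 1 - smult t0 (G 3)"
  have N: "S t - t0 = poly N t / poly (G 3) t" if "poly (G 3) t \<noteq> 0" for t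
    using that by (simp add: N_def S_def field_simps)
  have "poly N 0 = 0"
    using N[OF G30] G30 by (simp add: t0_def)
  moreover have "coeff N 1 = 0"
  proof -
    have "coeff (G i) 1 = 0" for i
      by (rule form_at_cusp_coeff_1[OF d g[rule_format] gG[rule_format]])
    then show ?thesis
      by (simp add: N_def)
  qed
  \<comment> \<open>Otherwise \<open>S\<close> would be constantly \<open>t0\<close> near 0, whereas
    \<open>H 1\<close> vanishes at \<open>t0\<close> but not at \<open>S t\<close> for small nonzero
    \<open>t\<close>.\<close>
  moreover have "N \<noteq> 0"
  proof
    assume "N = 0"
    have "eventually (\<lambda>t. False) (at (0::complex))"
      using ev ev_S by eventually_elim (use N \<open>N = 0\<close> in force)
    then show False
      by simp
  qed
  then obtain m M q where M: "M \<noteq> 0" "((\<lambda>t. (poly N t / poly (G 3) t) / (t - 0) ^ m) \<longlongrightarrow> M) (at 0)"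
    and q: "N = [:- 0, 1:] ^ m * q" "poly q 0 \<noteq> 0"
    by (rule rational_order[OF _ G30]) (rule that)
  have "m \<noteq> 1"
    using calculation(2) q by (auto simp: poly_0_coeff_0)
  have ev': "eventually (\<lambda>t. (poly N t / poly (G 3) t) / (t - 0) ^ m = (S t - t0) / t ^ m) (at 0)"
    using ev by eventually_elim (simp add: N)
  have M': "((\<lambda>t. (S t - t0) / t ^ m) \<longlongrightarrow> M) (at 0)"
    using M(2) unfolding tendsto_cong[OF ev'] .
  have order: "n = m * k"
    if R: "((\<lambda>t. R t / (t - t0) ^ k) \<longlongrightarrow> L) (at t0)" and L: "L \<noteq> 0"
      and RS: "eventually (\<lambda>t. R (S t) = t ^ n / poly ?Q t) (at 0)" for R k L n
  proof -
    have "((\<lambda>t. R (S t) / t ^ (m * k) * poly ?Q t) \<longlongrightarrow> L * M ^ k * poly ?Q 0) (at 0)"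
      by (intro tendsto_intros order_compose[OF R S_lim ev_S M'])
    moreover have ev'': "eventually (\<lambda>t. R (S t) / t ^ (m * k) * poly ?Q t = t ^ n / t ^ (m * k)) (at 0)"
      using RS ev by eventually_elim simp
    ultimately have "((\<lambda>t. t ^ n / t ^ (m * k)) \<longlongrightarrow> L * M ^ k * poly ?Q 0) (at 0)"
      unfolding tendsto_cong[OF ev''] by blast
    then show ?thesis
      by (rule power_quotient_tendsto_unique) (use L M Q0 in simp)
  qed
  have "d - 1 = m * k1"
    by (rule order[OF L1(2,1)]) (use ev quot in \<open>auto elim!: eventually_mono\<close>)
  moreover have "d = m * k3"
    by (rule order[OF L3(2,1)]) (use ev quot in \<open>auto elim!: eventually_mono\<close>)
  ultimately have "m dvd d - (d - 1)"
    by (metis dvd_diff_nat dvd_triv_left)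
  with d \<open>m \<noteq> 1\<close> show False
    by simp
qed


subsection \<open>The induced map of the affine line\<close>

lemma poly_eqI_cofinite:
  fixes p q E :: "complex poly"
  assumes "E \<noteq> 0" "\<And>t. poly E t \<noteq> 0 \<Longrightarrow> poly p t = poly q t"
  shows "p = q"
proof -
  have "\<forall>t. poly ((p - q) * E) t = 0"
    using assms(2) by (metis eq_iff_diff_eq_0 mult_zero_left mult_zero_right poly_diff poly_mult)
  then have "(p - q) * E = 0"
    by (simp only: poly_all_0_iff_0)
  with assms(1) show ?thesis
    by simp
qed

text \<open>Choose \<open>S * B = A\<close> with \<open>B\<close> of least degree. \<open>S\<close>
  is finite everywhere, so \<open>A\<close> vanishes at each root of \<open>B\<close>, and a common
  linear factor could be cancelled. Hence \<open>B\<close> has no root and is constant.\<close>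

lemma locally_rational_imp_poly:
  fixes S :: "complex \<Rightarrow> complex"
  assumes local: "\<And>t0. \<exists>A B E. poly E t0 \<noteq> 0 \<and>
    (\<forall>t. poly E t \<noteq> 0 \<longrightarrow> poly B t \<noteq> 0 \<and> S t = poly A t / poly B t)"
  obtains P where "\<And>t. S t = poly P t"
proof -
  define rep where "rep n \<longleftrightarrow> (\<exists>A B E. degree B = n \<and> B \<noteq> 0 \<and> E \<noteq> 0 \<and>
    (\<forall>t. poly E t \<noteq> 0 \<longrightarrow> S t * poly B t = poly A t))" for n
  have "\<exists>n. rep n"
  proof -
    obtain A B E where E: "poly E 0 \<noteq> 0"
      and *: "\<forall>t. poly E t \<noteq> 0 \<longrightarrow> poly B t \<noteq> 0 \<and> S t = poly A t / poly B t"
      using local[of 0] by blast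
    then have "B \<noteq> 0" "E \<noteq> 0"
      by auto
    then show ?thesis
      using * unfolding rep_def by (intro exI[of _ "degree B"] exI[of _ A] exI[of _ B] exI[of _ E]) auto
  qed
  then have "rep (LEAST n. rep n)"
    by (rule LeastI_ex)
  then obtain A B E where AB: "degree B = (LEAST n. rep n)" "B \<noteq> 0" "E \<noteq> 0"
    "\<forall>t. poly E t \<noteq> 0 \<longrightarrow> S t * poly B t = poly A t"
    unfolding rep_def by blast
  have cross: "S t * poly B t = poly A t" and "poly B t = 0 \<Longrightarrow> poly A t = 0" for t
  proof -
    obtain A' B' E' where E': "poly E' t \<noteq> 0"
      and *: "\<forall>t. poly E' t \<noteq> 0 \<longrightarrow> poly B' t \<noteq> 0 \<and> S t = poly A' t / poly B' t"
      using local[of t] by blast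
    have "A * B' = A' * B"
    proof (rule poly_eqI_cofinite[of "E * E'"])
      show "E * E' \<noteq> 0"
        using AB E' by auto
      fix t assume "poly (E * E') t \<noteq> 0"
      then have "S t * poly B t = poly A t" "poly B' t \<noteq> 0" "S t = poly A' t / poly B' t"
        using AB * by auto
      then show "poly (A * B') t = poly (A' * B) t"
        by (simp add: field_simps)
    qed
    then have "poly A t * poly B' t = poly A' t * poly B t"
      by (metis poly_mult)
    moreover have B't: "poly B' t \<noteq> 0" "S t = poly A' t / poly B' t"
      using * E' by auto
    ultimately have "S t * poly B t * poly B' t = poly A t * poly B' t"
      by simp
    then show "S t * poly B t = poly A t"
      using B't(1) by simp
    then show "poly B t = 0 \<Longrightarrow> poly A t = 0"
      by simp
  qed
  have "degree B = 0"
  proof (rule ccontr)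
    assume deg: "degree B \<noteq> 0"
    then have "\<not> constant (poly B)"
      by (simp add: constant_degree)
    then obtain t0 where t0: "poly B t0 = 0"
      using fundamental_theorem_of_algebra by blast
    then have "poly A t0 = 0"
      using cross by (metis mult_zero_right)
    with t0 obtain A' B' where A': "A = [:- t0, 1:] * A'" and B': "B = [:- t0, 1:] * B'"
      by (metis dvdE poly_eq_0_iff_dvd)
    have "B' \<noteq> 0"
      using AB(2) B' by auto
    have "rep (degree B')"
      unfolding rep_def
    proof (intro exI conjI allI impI)
      show "B' \<noteq> 0"
        by fact
      show "[:- t0, 1:] \<noteq> 0"
        by simp
      fix t assume "poly [:- t0, 1:] t \<noteq> 0"
      moreover have "(t - t0) * (S t * poly B' t) = (t - t0) * poly A' t"
        using cross[of t] by (simp add: A' B' algebra_simps)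
      ultimately show "S t * poly B' t = poly A' t"
        by simp
    qed simp
    moreover have "degree B = Suc (degree B')"
      using \<open>B' \<noteq> 0\<close> unfolding B' by (subst degree_mult_eq) auto
    ultimately show False
      using AB(1) Least_le[of rep "degree B'"] by simp
  qed
  then obtain e where e: "B = [:e:]"
    by (rule degree_eq_zeroE)
  then have "S t = poly (smult (1 / e) A) t" for t
    using cross[of t] AB(2) by (simp add: field_simps)
  then show ?thesis
    using that by blast
qed

lemma regular_map_affine_part:
  assumes d: "d \<ge> 3"
    and \<phi>: "regular_map (zeros (curve_form d b1 c1)) (zeros (curve_form d b2 c2)) \<phi>"
    and cusp: "\<And>p. p \<in> zeros (curve_form d b1 c1) \<Longrightarrow> \<phi> p = point cusp \<Longrightarrow> p = point cusp"
  obtains P where "\<And>t. \<phi> (point (affine_point d b1 c1 t)) = point (affine_point d b2 c2 (poly P t))"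
proof -
  let ?C1 = "zeros (curve_form d b1 c1)" and ?C2 = "zeros (curve_form d b2 c2)"
  have \<phi>_in: "\<phi> p \<in> ?C2" if "p \<in> ?C1" for p
    using \<phi> that by (auto simp: regular_map_def)
  have local: "\<exists>A B E. poly E t0 \<noteq> 0 \<and> (\<forall>t. poly E t \<noteq> 0 \<longrightarrow> poly B t \<noteq> 0 \<and>
      \<phi> (point (affine_point d b1 c1 t)) = point (affine_point d b2 c2 (poly A t / poly B t)))" for t0
  proof -
    obtain l u k and g :: "3 \<Rightarrow> complex ^ 3 \<Rightarrow> complex" and E and G :: "3 \<Rightarrow> complex poly"
      where u: "is_form l u" "u (affine_point d b1 c1 t0) \<noteq> 0" and "\<forall>i. is_form k (g i)"
        and E: "\<forall>t. u (affine_point d b1 c1 t) = poly E t"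
        and "\<forall>i t. g i (affine_point d b1 c1 t) = poly (G i) t"
        and *: "\<forall>t. poly E t \<noteq> 0 \<longrightarrow> (\<chi> i. poly (G i) t) \<noteq> 0 \<and>
          \<phi> (point (affine_point d b1 c1 t)) = point (\<chi> i. poly (G i) t)"
      by (rule regular_map_along_curve[OF affine_point_poly param_nonzero[OF d vec2_nonzero(1)]
        affine_point_in_curve[OF d] \<phi>]) (rule that)
    have "poly (G 3) t \<noteq> 0 \<and> \<phi> (point (affine_point d b1 c1 t)) =
        point (affine_point d b2 c2 (poly (G 1) t / poly (G 3) t))" if "poly E t \<noteq> 0" for t
    proof -
      let ?w = "\<chi> i. poly (G i) t"
      have w: "?w \<noteq> 0" "\<phi> (point (affine_point d b1 c1 t)) = point ?w"
        using * that by auto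
      have in_C: "point ?w \<in> ?C2"
        using \<phi>_in[OF affine_point_in_curve[OF d]] w(2) by metis
      have "point ?w \<noteq> point cusp"
        using cusp[OF affine_point_in_curve[OF d], of t] affine_point_neq_cusp[OF d] w(2) by metis
      then have "?w $ 3 \<noteq> 0"
        using curve_point_cusp[OF d w(1) in_C] by blast
      then show ?thesis
        using curve_point_affine[OF d w(1) in_C] w(2) by simp
    qed
    moreover have "poly E t0 \<noteq> 0"
      using u E by metis
    ultimately show ?thesis
      by blast
  qed
  have "\<exists>s. \<phi> (point (affine_point d b1 c1 t)) = point (affine_point d b2 c2 s)" for t
    using local[of t] by blast
  then obtain S where S: "\<And>t. \<phi> (point (affine_point d b1 c1 t)) = point (affine_point d b2 c2 (S t))"
    by metis
  have "\<exists>A B E. poly E t0 \<noteq> 0 \<and> (\<forall>t. poly E t \<noteq> 0 \<longrightarrow> poly B t \<noteq> 0 \<and> S t = poly A t / poly B t)" for t0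
    using local[of t0] unfolding S by (metis affine_point_inj[OF d])
  then obtain P where "\<And>t. S t = poly P t"
    using locally_rational_imp_poly[of S] by blast
  then show ?thesis
    using that S by simp
qed

lemma isomorphism_affine_part:
  assumes d: "d \<ge> 3" and iso: "isomorphism (zeros (curve_form d b1 c1)) (zeros (curve_form d b2 c2)) \<phi>"
  obtains \<alpha> \<beta> where "\<alpha> \<noteq> 0" "\<phi> (point cusp) = point cusp"
    "\<And>t. \<phi> (point (affine_point d b1 c1 t)) = point (affine_point d b2 c2 (\<alpha> * t + \<beta>))"
proof -
  let ?C1 = "zeros (curve_form d b1 c1)" and ?C2 = "zeros (curve_form d b2 c2)"
  obtain \<psi> where \<phi>: "regular_map ?C1 ?C2 \<phi>" and \<psi>: "regular_map ?C2 ?C1 \<psi>"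
    and inv: "\<And>p. p \<in> ?C1 \<Longrightarrow> \<psi> (\<phi> p) = p" "\<And>q. q \<in> ?C2 \<Longrightarrow> \<phi> (\<psi> q) = q"
    using iso unfolding isomorphism_def by blast
  have \<phi>_cusp: "\<phi> (point cusp) = point cusp"
    by (rule isomorphism_cusp[OF d \<phi> \<psi> inv(1)])
  have \<psi>_cusp: "\<psi> (point cusp) = point cusp"
    by (rule isomorphism_cusp[OF d \<psi> \<phi> inv(2)])
  obtain P where P: "\<And>t. \<phi> (point (affine_point d b1 c1 t)) = point (affine_point d b2 c2 (poly P t))"
    using regular_map_affine_part[OF d \<phi>] inv(1) \<psi>_cusp by metis
  obtain P' where P': "\<And>t. \<psi> (point (affine_point d b2 c2 t)) = point (affine_point d b1 c1 (poly P' t))"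
    using regular_map_affine_part[OF d \<psi>] inv(2) \<phi>_cusp by metis
  have "poly P' (poly P t) = t" for t
    using inv(1)[OF affine_point_in_curve[OF d], of t] affine_point_inj[OF d] by (metis P P')
  \<comment> \<open>Degrees multiply under composition, so a polynomial inverse forces degree
    1.\<close>
  then have "P' \<circ>\<^sub>p P = [:0, 1:]"
    by (intro poly_ext) (simp add: poly_pcompose)
  then have "degree P' * degree P = 1"
    by (metis degree_pcompose degree_pCons_eq_if one_neq_zero pCons_eq_0_iff degree_1 One_nat_def one_pCons)
  then have "degree P = 1"
    by simp
  moreover obtain \<beta> P1 where P1: "P = pCons \<beta> P1"
    by (cases P)
  ultimately have "degree P1 = 0" "P1 \<noteq> 0"
    by (auto split: if_splits)
  then obtain \<alpha> where "P = [:\<beta>, \<alpha>:]" "\<alpha> \<noteq> 0"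
    using P1 by (auto elim: degree_eq_zeroE)
  then show ?thesis
    using that[of \<alpha> \<beta>] P \<phi>_cusp by (simp add: algebra_simps)
qed

subsection \<open>The moduli\<close>

text \<open>Here \<open>g / h = A t^(d-1) / W\<close> belongs to the local ring of the cusp. Modulo
  \<open>t^(2 d - 2)\<close> such a function is a constant plus
  \<open>t^(d-1) (u + v t) / Q\<close>, up to the value of \<open>h\<close>, with \<open>Q\<close>
  the cusp polynomial. The constant vanishes, and cancelling \<open>t^(d-1)\<close> leaves a
  congruence modulo \<open>t^(d-1)\<close>.\<close>

lemma local_ring_relation:
  assumes d: "d \<ge> 3" and gh: "is_form k g" "is_form k h"
    and G: "\<And>t. g (cusp_point d b c t) = poly G t" and H: "\<And>t. h (cusp_point d b c t) = poly H t"
    and GW: "G * W = A * monom 1 (d - 1) * H" and W0: "poly W 0 \<noteq> 0"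
  obtains u v where "monom 1 (d - 1) dvd [:u, v:] * W - smult (poly H 0) (A * cusp_poly b c)"
proof -
  define Q where "Q = cusp_poly b c"
  define X where "X = (monom 1 (d - 1) :: complex poly)"
  define L where "L g0 g1 g2 = smult g0 Q + X * [:g1, g2:]" for g0 g1 g2
  have XX: "monom 1 (2 * d - 2) = X * X"
  proof -
    have "2 * d - 2 = (d - 1) + (d - 1)"
      using d by simp
    then show ?thesis
      by (simp only: X_def mult_monom mult_1)
  qed
  have monom_d: "monom 1 d = X * [:0, 1:]"
    using d mult_monom[of "1::complex" "d - 1" 1 1] by (simp add: X_def monom_Suc monom_0)
  have L: "smult g0 Q + monom g1 (d - 1) + monom g2 d = L g0 g1 g2" for g0 g1 g2
  proof -
    have "monom g1 (d - 1) = smult g1 X"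
      by (simp add: smult_monom X_def)
    moreover have "monom g2 d = smult g2 (X * [:0, 1:])"
      unfolding monom_d[symmetric] by (simp add: smult_monom)
    ultimately show ?thesis
      by (simp add: L_def algebra_simps)
  qed
  have form: "\<exists>g0 g1 g2. X * X dvd P * Q - Q ^ k * L g0 g1 g2"
    if f: "is_form k f" and P: "\<And>t. f (cusp_point d b c t) = poly P t" for f P
  proof -
    obtain p g0 g1 g2 where p: "\<And>t. f (cusp_point d b c t) = poly p t"
      and dvd: "monom 1 (2 * d - 2) dvd p * cusp_poly b c -
        cusp_poly b c ^ k * (smult g0 (cusp_poly b c) + monom g1 (d - 1) + monom g2 d)"
      by (rule form_at_cusp[OF d f]) (rule that)
    have "p = P"
      using p P by (intro poly_ext) auto
    then show ?thesis
      using dvd unfolding XX L[unfolded Q_def] Q_def by blast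
  qed
  obtain g0 g1 g2 where g: "X * X dvd G * Q - Q ^ k * L g0 g1 g2"
    using form[OF gh(1) G] by blast
  obtain h0 h1 h2 where h: "X * X dvd H * Q - Q ^ k * L h0 h1 h2"
    using form[OF gh(2) H] by blast
  have X0: "poly X 0 = 0"
    using d by (simp add: X_def poly_monom)
  have Q0: "poly Q 0 = 1"
    by (simp add: Q_def cusp_poly_def)
  have L0: "poly (L g0 g1 g2) 0 = g0" for g0 g1 g2
    by (simp add: L_def X0 Q0)
  have zero: "poly p 0 = 0" if "X * X dvd p" for p
    using that X0 by (auto elim!: dvdE)
  have h0: "h0 = poly H 0"
    using zero[OF h] by (simp add: L0 Q0)
  \<comment> \<open>The combination is chosen so that \<open>GW\<close> eliminates the unknown
    restrictions \<open>G\<close> and \<open>H\<close>, leaving only the truncated linear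
    forms.\<close>
  have "X * X dvd W * (G * Q - Q ^ k * L g0 g1 g2) - A * X * (H * Q - Q ^ k * L h0 h1 h2)"
    by (rule dvd_diff[OF dvd_mult[OF g] dvd_mult[OF h]])
  also have "W * (G * Q - Q ^ k * L g0 g1 g2) - A * X * (H * Q - Q ^ k * L h0 h1 h2) =
      (G * W - A * X * H) * Q + Q ^ k * (A * X * L h0 h1 h2 - L g0 g1 g2 * W)"
    by (simp add: algebra_simps)
  also have "\<dots> = Q ^ k * (A * X * L h0 h1 h2 - L g0 g1 g2 * W)"
    using GW by (simp add: X_def)
  finally have "monom 1 (2 * d - 2) dvd Q ^ k * (A * X * L h0 h1 h2 - L g0 g1 g2 * W)"
    unfolding XX .
  then have main: "X * X dvd A * X * L h0 h1 h2 - L g0 g1 g2 * W"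
    unfolding XX[symmetric] by (rule monom_dvd_cancel) (simp add: Q0)
  have "g0 = 0"
    using zero[OF main] W0 by (simp add: L0 X0)
  \<comment> \<open>The coefficients \<open>h1\<close>, \<open>h2\<close> carry the factor
    \<open>X * X\<close> and drop out, so only the value of \<open>h\<close> at the cusp
    remains.\<close>
  then have "X * X dvd X * (smult h0 (A * Q) - [:g1, g2:] * W) + X * X * (A * [:h1, h2:])"
    using main by (simp add: L_def algebra_simps)
  then have "X * X dvd X * (smult h0 (A * Q) - [:g1, g2:] * W)"
    by (metis dvd_add_left_iff dvd_triv_left)
  moreover have "X \<noteq> 0"
    by (simp add: X_def monom_eq_0_iff)
  ultimately have "X dvd smult h0 (A * Q) - [:g1, g2:] * W"
    by (simp only: dvd_mult_cancel_left) simp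
  then have "X dvd [:g1, g2:] * W - smult h0 (A * Q)"
    by (metis dvd_minus_iff minus_diff_eq)
  then show ?thesis
    using that unfolding X_def Q_def h0 by blast
qed

lemma linear_power_coeffs:
  "coeff ([:a, b:] ^ n) 0 = (a::complex) ^ n"
  "coeff ([:a, b:] ^ n) (Suc 0) = of_nat n * a ^ (n - 1) * b"
proof -
  show 0: "coeff ([:a, b:] ^ n) 0 = a ^ n" for n
    by (induction n) auto
  show "coeff ([:a, b:] ^ n) (Suc 0) = of_nat n * a ^ (n - 1) * b"
  proof (induction n)
    case (Suc n)
    then show ?case
      by (cases n) (simp_all add: 0 algebra_simps)
  qed simp
qed

text \<open>In the parameter at the cusp, \<open>t \<mapsto> \<alpha> t + \<beta>\<close> becomes
  \<open>[1:t] \<mapsto> [\<alpha> + \<beta> t : t]\<close>. Membership of the pulled-back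
  \<open>z / y\<close> in the first local ring yields \<open>\<beta> = 0\<close>; that of
  \<open>x / y\<close> yields the relations between the moduli.\<close>

lemma isomorphic_curves_moduli:
  assumes d: "d \<ge> 4"
    and iso: "isomorphic (zeros (curve_form d b1 c1)) (zeros (curve_form d b2 c2))"
  obtains \<alpha> where "\<alpha> \<noteq> 0" "b2 = \<alpha> ^ 2 * b1" "d \<ge> 5 \<Longrightarrow> c2 = \<alpha> ^ 3 * c1"
proof -
  have d3: "d \<ge> 3"
    using d by simp
  let ?C1 = "zeros (curve_form d b1 c1)" and ?C2 = "zeros (curve_form d b2 c2)"
  obtain \<phi> where \<phi>_iso: "isomorphism ?C1 ?C2 \<phi>"
    using iso unfolding isomorphic_def by blast
  obtain \<alpha> \<beta> where \<alpha>: "\<alpha> \<noteq> 0" and \<phi>_cusp: "\<phi> (point cusp) = point cusp"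
    and \<phi>_affine: "\<And>t. \<phi> (point (affine_point d b1 c1 t)) = point (affine_point d b2 c2 (\<alpha> * t + \<beta>))"
    using isomorphism_affine_part[OF d3 \<phi>_iso] by blast
  have \<phi>: "regular_map ?C1 ?C2 \<phi>"
    using \<phi>_iso by (simp add: isomorphism_def)
  obtain l u k and g :: "3 \<Rightarrow> complex ^ 3 \<Rightarrow> complex" and E and G :: "3 \<Rightarrow> complex poly"
    where u: "is_form l u" "u (cusp_point d b1 c1 0) \<noteq> 0" and g: "\<forall>i. is_form k (g i)"
      and E: "\<forall>t. u (cusp_point d b1 c1 t) = poly E t" and gG: "\<forall>i t. g i (cusp_point d b1 c1 t) = poly (G i) t"
      and *: "\<forall>t. poly E t \<noteq> 0 \<longrightarrow> (\<chi> i. poly (G i) t) \<noteq> 0 \<and>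
        \<phi> (point (cusp_point d b1 c1 t)) = point (\<chi> i. poly (G i) t)"
    by (rule regular_map_along_curve[OF cusp_point_poly param_nonzero[OF d3 vec2_nonzero(2)]
      cusp_point_in_curve[OF d3] \<phi>]) (rule that)
  have E0: "poly E 0 \<noteq> 0"
    using u E by metis
  define s where "s = poly (G 2) 0"
  have s: "s \<noteq> 0"
  proof -
    have w: "(\<chi> i. poly (G i) 0) \<noteq> 0" "point (\<chi> i. poly (G i) 0) = point cusp"
      using * E0 \<phi>_cusp cusp_point_0[OF d3, of b1 c1] by auto
    then show ?thesis
      using is_form_zero_iff[OF is_form_coord w(1) cusp_nonzero w(2), of 2] by (simp add: s_def)
  qed
  define A where "A = [:\<alpha>, \<beta>:]"
  \<comment> \<open>The second coordinate of the image of the point with parameter \<open>t\<close>;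
    the other two are \<open>A t^(d-1)\<close> and \<open>t^d\<close>.\<close>
  define W where "W = A ^ d + smult b2 (A ^ (d - 2) * monom 1 2) + smult c2 (A ^ (d - 3) * monom 1 3)"
  have W: "poly W t = graph_form d b2 c2 (vector [poly A t, t])" for t
    by (simp add: W_def graph_form_def poly_monom)
  have image: "\<phi> (point (cusp_point d b1 c1 t)) = point (param d b2 c2 (vector [poly A t, t]))"
    and nz: "vector [poly A t, t] \<noteq> (0 :: complex ^ 2)" if t: "t \<noteq> 0" for t
  proof -
    show nz: "vector [poly A t, t] \<noteq> (0 :: complex ^ 2)"
      using t by (simp add: vec2_eq_iff)
    have "vector [poly A t, t] = t *s (vector [\<alpha> * (1 / t) + \<beta>, 1] :: complex ^ 2)"
      using t by (simp add: A_def vec2_eq_iff field_simps)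
    then have "point (vector [poly A t, t]) = point (vector [\<alpha> * (1 / t) + \<beta>, 1] :: complex ^ 2)"
      using point_scale[OF vec2_nonzero(1) t] by simp
    then have "point (affine_point d b2 c2 (\<alpha> * (1 / t) + \<beta>)) =
        point (param d b2 c2 (vector [poly A t, t]))"
      using param_map_point[OF d3 vec2_nonzero(1)] param_map_point[OF d3 nz] by metis
    then show "\<phi> (point (cusp_point d b1 c1 t)) = point (param d b2 c2 (vector [poly A t, t]))"
      using point_cusp_point[OF d3 t] \<phi>_affine by metis
  qed
  have cross: "poly (G 1) t * poly W t = poly A t * t ^ (d - 1) * poly (G 2) t"
    "poly (G 3) t * poly W t = t * t ^ (d - 1) * poly (G 2) t"
    if "poly ([:0, 1:] * E) t \<noteq> 0" for t
  proof -
    have t: "t \<noteq> 0" "poly E t \<noteq> 0"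
      using that by auto
    let ?w = "\<chi> i. poly (G i) t" and ?v = "param d b2 c2 (vector [poly A t, t])"
    have "?w \<noteq> 0" "point ?v = point ?w"
      using * t image[OF t(1)] by auto
    then obtain a where "?w = a *s ?v"
      using point_eq_iff[OF param_nonzero[OF d3 nz[OF t(1)]]] by blast
    then have "poly (G 1) t = a * (poly A t * t ^ (d - 1))" "poly (G 2) t = a * poly W t"
      "poly (G 3) t = a * t ^ d"
      by (auto simp: vec3_eq_iff W)
    moreover have "t ^ d = t * t ^ (d - 1)"
      using d by (metis power_eq_if not_numeral_le_zero)
    ultimately show "poly (G 1) t * poly W t = poly A t * t ^ (d - 1) * poly (G 2) t"
      "poly (G 3) t * poly W t = t * t ^ (d - 1) * poly (G 2) t"
      by simp_all
  qed
  have "E \<noteq> 0"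
    using E0 by auto
  then have "[:0, 1:] * E \<noteq> 0"
    by simp
  note eqI = poly_eqI_cofinite[OF this]
  have GW: "G 1 * W = A * monom 1 (d - 1) * G 2" "G 3 * W = [:0, 1:] * monom 1 (d - 1) * G 2"
    by (rule eqI, drule cross(1), simp add: poly_monom) (rule eqI, drule cross(2), simp add: poly_monom)
  have W0: "coeff W 0 = \<alpha> ^ d" and W1: "coeff W (Suc 0) = of_nat d * \<alpha> ^ (d - 1) * \<beta>"
    by (simp_all add: W_def A_def linear_power_coeffs coeff_mult_1 coeff_mult_0)
  have "poly W 0 \<noteq> 0"
    using \<alpha> by (simp add: poly_0_coeff_0 W0)
  obtain u1 v1 where r1: "monom 1 (d - 1) dvd [:u1, v1:] * W - smult s (A * cusp_poly b1 c1)"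
    using local_ring_relation[OF d3 g[rule_format] g[rule_format] gG[rule_format] gG[rule_format]
      GW(1) \<open>poly W 0 \<noteq> 0\<close>] unfolding s_def by blast
  obtain u3 v3 where r3: "monom 1 (d - 1) dvd [:u3, v3:] * W - smult s ([:0, 1:] * cusp_poly b1 c1)"
    using local_ring_relation[OF d3 g[rule_format] g[rule_format] gG[rule_format] gG[rule_format]
      GW(2) \<open>poly W 0 \<noteq> 0\<close>] unfolding s_def by blast
  have coeff1: "coeff ([:u1, v1:] * W - smult s (A * cusp_poly b1 c1)) n = 0" if "n < d - 1" for n
    using r1 that unfolding monom_1_dvd_iff' by blast
  have coeff3: "coeff ([:u3, v3:] * W - smult s ([:0, 1:] * cusp_poly b1 c1)) n = 0" if "n < d - 1" for n
    using r3 that unfolding monom_1_dvd_iff' by blast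
  \<comment> \<open>The congruences hold modulo \<open>t^(d-1)\<close>, so the coefficient of
    \<open>t^2\<close> is available exactly from \<open>d = 4\<close> on.\<close>
  have lt: "0 < d - 1" "Suc 0 < d - 1" "Suc (Suc 0) < d - 1"
    using d by auto
  \<comment> \<open>In the relation for \<open>z / y\<close>, the coefficients of \<open>t\<close>
    and \<open>t^2\<close> give \<open>v3 * \<alpha>^d = s\<close> and \<open>v3\<close> times the
    linear coefficient of \<open>W\<close> equal to 0; that coefficient is
    \<open>d \<alpha>^(d-1) \<beta>\<close>.\<close>
  have "u3 = 0"
    using coeff3[OF lt(1)] \<alpha> by (simp add: W0)
  then have "v3 \<noteq> 0" "v3 * coeff W (Suc 0) = 0"
    using coeff3[OF lt(2)] coeff3[OF lt(3)] s by (auto simp: cusp_poly_def)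
  then have "\<beta> = 0"
    using d \<alpha> by (simp add: W1)
  then have A: "A = [:\<alpha>:]"
    by (simp add: A_def)
  have W2: "coeff W (Suc (Suc 0)) = b2 * \<alpha> ^ (d - 2)" and W3: "coeff W (Suc (Suc (Suc 0))) = c2 * \<alpha> ^ (d - 3)"
    using d by (simp_all add: W_def A poly_const_pow numeral_2_eq_2 numeral_3_eq_3)
  have W1': "coeff W (Suc 0) = 0"
    using \<open>\<beta> = 0\<close> by (simp add: W1)
  have u1: "u1 * \<alpha> ^ d = s * \<alpha>"
    using coeff1[OF lt(1)] by (simp add: A W0 cusp_poly_def)
  have "v1 = 0"
    using coeff1[OF lt(2)] \<alpha> by (simp add: A W0 W1' cusp_poly_def)
  have d2: "\<alpha> ^ d = \<alpha> ^ (d - 2) * \<alpha> ^ 2" and d3': "\<alpha> ^ d = \<alpha> ^ (d - 3) * \<alpha> ^ 3"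
  proof -
    have "d = (d - 2) + 2" "d = (d - 3) + 3"
      using d by auto
    then show "\<alpha> ^ d = \<alpha> ^ (d - 2) * \<alpha> ^ 2" "\<alpha> ^ d = \<alpha> ^ (d - 3) * \<alpha> ^ 3"
      by (metis power_add)+
  qed
  have "u1 * (b2 * \<alpha> ^ (d - 2)) = s * \<alpha> * b1"
    using coeff1[OF lt(3)] \<open>v1 = 0\<close> by (simp add: A W2 cusp_poly_def)
  then have "u1 * \<alpha> ^ (d - 2) * b2 = u1 * \<alpha> ^ (d - 2) * (\<alpha> ^ 2 * b1)"
    unfolding u1[symmetric] d2 by (simp add: mult_ac)
  moreover have "u1 \<noteq> 0"
    using u1 s \<alpha> by auto
  ultimately have b: "b2 = \<alpha> ^ 2 * b1"
    using \<alpha> by simp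
  have c: "c2 = \<alpha> ^ 3 * c1" if "d \<ge> 5"
  proof -
    have "u1 * (c2 * \<alpha> ^ (d - 3)) = s * \<alpha> * c1"
      using coeff1[of "Suc (Suc (Suc 0))"] that \<open>v1 = 0\<close> by (simp add: A W3 cusp_poly_def)
    then have "u1 * \<alpha> ^ (d - 3) * c2 = u1 * \<alpha> ^ (d - 3) * (\<alpha> ^ 3 * c1)"
      unfolding u1[symmetric] d3' by (simp add: mult_ac)
    then show ?thesis
      using \<alpha> \<open>u1 \<noteq> 0\<close> by simp
  qed
  show ?thesis
    using that[OF \<alpha> b c] .
qed


section \<open>The count\<close>

lemma length_ordered_factorization:
  assumes "ns \<in> ordered_factorizations d"
  shows "2 ^ length ns \<le> d"
proof -
  have "2 ^ length ns \<le> prod_list ns" if "\<forall>n\<in>set ns. n \<ge> 2" for ns :: "nat list"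
    using that by (induction ns) (auto intro: mult_le_mono)
  then show ?thesis
    using assms by (auto simp: ordered_factorizations_def)
qed

text \<open>At most two factors are possible, and two factors can only be \<open>[2, 2]\<close>; so
  the length distinguishes the factorizations.\<close>

lemma ordered_factorizations_eqI:
  assumes "ns \<in> ordered_factorizations d" "ms \<in> ordered_factorizations d"
    and "d \<le> 4" "length ns = length ms"
  shows "ns = ms"
proof -
  have "ns = (if length ns = 1 then [d] else [2, 2])" if ns: "ns \<in> ordered_factorizations d" for ns
  proof -
    have "2 ^ length ns \<le> (2::nat) ^ 2"
      using length_ordered_factorization[OF ns] assms(3) by simp
    then have "length ns \<le> 2"
      by (simp only: power_increasing_iff)
    moreover have "length ns \<noteq> 0"
      using ns by (simp add: ordered_factorizations_def)
    ultimately consider "length ns = 1" | "length ns = 2"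
      by linarith
    then show ?thesis
    proof cases
      case 1
      then show ?thesis
        using ns by (cases ns) (auto simp: ordered_factorizations_def)
    next
      case 2
      then obtain m n where mn: "ns = [m, n]"
        by (metis (no_types, opaque_lifting) One_nat_def Suc_1 length_0_conv length_Suc_conv)
      then have "m \<ge> 2" "n \<ge> 2" "m * n \<le> 4"
        using ns assms(3) by (auto simp: ordered_factorizations_def)
      moreover from this have "m * 2 \<le> m * n" "2 * n \<le> m * n"
        by (simp_all only: mult_le_mono1 mult_le_mono2)
      ultimately have "m = 2" "n = 2"
        by linarith+
      then show ?thesis
        using mn by simp
    qed
  qed
  from this[OF assms(1)] this[OF assms(2)] assms(4) show ?thesis
    by simp
qed

text \<open>For \<open>d = 3\<close> one curve suffices; for \<open>d = 4\<close>, \<open>b\<close>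
  tells \<open>[4]\<close> from \<open>[2, 2]\<close>; for \<open>d \<ge> 5\<close>,
  \<open>c\<close> is the code of the list under \<open>to_nat\<close>.\<close>

lemma moduli_separate:
  assumes "d \<ge> 3"
  obtains b c :: "nat list \<Rightarrow> complex" where
    "\<And>ns ms. ns \<in> ordered_factorizations d \<Longrightarrow> ms \<in> ordered_factorizations d \<Longrightarrow>
      isomorphic (zeros (curve_form d (b ns) (c ns))) (zeros (curve_form d (b ms) (c ms))) \<Longrightarrow> ns = ms"
proof -
  consider "d = 3" | "d = 4" | "d \<ge> 5"
    using assms by linarith
  then show ?thesis
  proof cases
    case 1
    have "length ns = 1" if ns: "ns \<in> ordered_factorizations d" for ns
    proof -
      have "2 ^ length ns < (2::nat) ^ 2"
        using length_ordered_factorization[OF ns] 1 by simp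
      then have "length ns < 2"
        by (simp only: power_strict_increasing_iff)
      moreover have "length ns \<noteq> 0"
        using ns by (simp add: ordered_factorizations_def)
      ultimately show ?thesis
        by linarith
    qed
    then show ?thesis
      using ordered_factorizations_eqI[of _ d] 1 by (intro that[of "\<lambda>_. 0" "\<lambda>_. 0"]) simp
  next
    case 2
    define b where "b ns = (if length ns = 1 then 1 else (0::complex))" for ns :: "nat list"
    show ?thesis
    proof (rule that[of b "\<lambda>_. 0"])
      fix ns ms assume ns: "ns \<in> ordered_factorizations d" and ms: "ms \<in> ordered_factorizations d"
        and "isomorphic (zeros (curve_form d (b ns) 0)) (zeros (curve_form d (b ms) 0))"
      then obtain \<alpha> where "\<alpha> \<noteq> 0" "b ms = \<alpha> ^ 2 * b ns"
        using isomorphic_curves_moduli[of d] 2 by (metis order_refl)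
      then have iff: "length ns = 1 \<longleftrightarrow> length ms = 1"
        by (auto simp: b_def split: if_splits)
      have len: "length ns = 1 \<or> length ns = 2" if "ns \<in> ordered_factorizations d" for ns
      proof -
        have "2 ^ length ns \<le> (2::nat) ^ 2"
          using length_ordered_factorization[OF that] 2 by simp
        then have "length ns \<le> 2"
          by (simp only: power_increasing_iff)
        moreover have "length ns \<noteq> 0"
          using that by (simp add: ordered_factorizations_def)
        ultimately show ?thesis
          by linarith
      qed
      have "length ns = length ms"
        using len[OF ns] len[OF ms] iff by auto
      then show "ns = ms"
        using ordered_factorizations_eqI[OF ns ms] 2 by simp
    qed
  next
    case 3
    define c where "c ns = (of_nat (to_nat ns) :: complex)" for ns :: "nat list"
    show ?thesis
    proof (rule that[of "\<lambda>_. 1" c])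
      fix ns ms :: "nat list"
      assume "isomorphic (zeros (curve_form d 1 (c ns))) (zeros (curve_form d 1 (c ms)))"
      then obtain \<alpha> where \<alpha>: "1 = \<alpha> ^ 2 * 1" "c ms = \<alpha> ^ 3 * c ns"
        using isomorphic_curves_moduli[of d 1 "c ns" 1 "c ms"] 3 by auto
      \<comment> \<open>From \<open>\<alpha>^2 = 1\<close> only \<open>c\<close> up to sign is
        determined; squaring removes the sign, and natural numbers are recovered from their
        squares.\<close>
      have "(\<alpha> ^ 3) ^ 2 = (\<alpha> ^ 2) ^ 3"
        by (simp only: power_mult[symmetric] mult.commute)
      then have "c ms ^ 2 = (\<alpha> ^ 2) ^ 3 * c ns ^ 2"
        by (simp only: \<alpha>(2) power_mult_distrib)
      moreover have "\<alpha> ^ 2 = 1"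
        using \<alpha>(1) by simp
      ultimately have "c ms ^ 2 = c ns ^ 2"
        by (simp only: power_one mult_1)
      then have "to_nat ms ^ 2 = to_nat ns ^ 2"
        unfolding c_def by (metis of_nat_eq_iff of_nat_power)
      then show "ns = ms"
        by (simp add: power_eq_iff_eq_base)
    qed
  qed
qed

text \<open>In degree 2 the inequality fails: an irreducible conic is smooth, so no unicuspidal
  curve exists, while \<open>[2]\<close> is an ordered factorization.\<close>

theorem theorem1p8:
  fixes d :: nat
  assumes "d > 1" and "d \<noteq> 2"
  shows "ordered_factorizations d \<lesssim>
    {C. rational_unicuspidal_curve d C} // {(C, D). isomorphic C D}"
proof -
  have d: "d \<ge> 3"
    using assms by simp
  obtain b c :: "nat list \<Rightarrow> complex" where sep:
    "\<And>ns ms. ns \<in> ordered_factorizations d \<Longrightarrow> ms \<in> ordered_factorizations d \<Longrightarrow>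
      isomorphic (zeros (curve_form d (b ns) (c ns))) (zeros (curve_form d (b ms) (c ms))) \<Longrightarrow> ns = ms"
    using moduli_separate[OF d] by blast
  define C where "C ns = zeros (curve_form d (b ns) (c ns))" for ns
  let ?R = "{(C, D). isomorphic C D} :: (3 proj set \<times> 3 proj set) set"
  have "inj_on (\<lambda>ns. ?R `` {C ns}) (ordered_factorizations d)"
  proof (rule inj_onI)
    fix ns ms
    assume ns: "ns \<in> ordered_factorizations d" and ms: "ms \<in> ordered_factorizations d"
      and "?R `` {C ns} = ?R `` {C ms}"
    \<comment> \<open>Reflexivity puts \<open>C ms\<close> into its own class, so equality of the
      classes yields an isomorphism from \<open>C ns\<close> to \<open>C ms\<close>.\<close>
    moreover have "C ms \<in> ?R `` {C ms}"
      by (simp add: isomorphic_refl)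
    ultimately have "isomorphic (C ns) (C ms)"
      by (metis (no_types, lifting) Image_singleton_iff case_prodD mem_Collect_eq)
    then show "ns = ms"
      using sep[OF ns ms] by (simp add: C_def)
  qed
  moreover have "(\<lambda>ns. ?R `` {C ns}) ` ordered_factorizations d \<subseteq>
      {C. rational_unicuspidal_curve d C} // ?R"
  proof (rule image_subsetI)
    show "?R `` {C ns} \<in> {C. rational_unicuspidal_curve d C} // ?R" for ns
      by (rule quotientI) (simp add: C_def rational_unicuspidal_curve_curve_form[OF d])
  qed
  ultimately show ?thesis
    unfolding lepoll_def by blast
qed

end
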